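(* Let $p$ be a prime. Assume that a finite $p'$-group $H$ acts faithfully on a finite elementary abelian $p$-group $V$ with $|V|=p^n$, and let $G=H\ltimes V$. Let $d$ be a fixed positive integer with $d<n$. Then $G$ is a nontrivial $\mathfrak{C}(p^d)$-group if and only if one of the following statements holds. (1) $G$ is supersolvable. (2) $H$ is cyclic and $V$ is a homogeneous $\mathbb{F}_p[H]$-module all of whose irreducible $\mathbb{F}_p[H]$-submodules have dimension $e>1$ over $\mathbb{F}_p$, with $e\mid \gcd(d,n)$.
   Context: All groups are finite. A $p'$-group is a group of order prime to $p$; $|G|_p$ denotes the $p$-part of $|G|$. $H\ltimes V$ denotes the semidirect product with $V$ normal. A subgroup $X$ of $G$ is complemented in $G$ if there is a subgroup $K\leq G$ with $G=XK$ and $X\cap K=1$. $G$ is a $\mathfrak{C}(p^d)$-group if every subgroup of $G$ of order $p^d$ is complemented in $G$; it is a nontrivial $\mathfrak{C}(p^d)$-group if in addition $p^d\leq |G|_p$. $V$ is regarded as an $\mathbb{F}_p[H]$-module via the action of $H$. A module is homogeneous if it is a direct sum of isomorphic irreducible modules. *)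

theory Defs
  imports
    "HOL-Algebra.Algebra"
    "HOL-Number_Theory.Residues"
    "Jordan_Normal_Form.Missing_VectorSpace"
begin

definition elementary_abelian_group :: "nat \<Rightarrow> ('a, 'b) monoid_scheme \<Rightarrow> bool" where
  "elementary_abelian_group p V \<longleftrightarrow>
     comm_group V \<and> (\<forall>v \<in> carrier V. v [^]\<^bsub>V\<^esub> p = \<one>\<^bsub>V\<^esub>)"

text \<open>The pair \<open>(h, v)\<close> stands for the product \<open>v h\<close>, so that \<open>h v h\<^sup>-\<^sup>1 = \<phi> h v\<close>;
  the normal factor is \<open>{\<one>} \<times> carrier V\<close>.\<close>

definition semidirect_product ::
    "('h, 'a) monoid_scheme \<Rightarrow> ('v, 'b) monoid_scheme \<Rightarrow> ('h \<Rightarrow> 'v \<Rightarrow> 'v) \<Rightarrow> ('h \<times> 'v) monoid" where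
  "semidirect_product H V \<phi> =
     \<lparr>carrier = carrier H \<times> carrier V,
      monoid.mult = (\<lambda>(h, v) (k, w). (h \<otimes>\<^bsub>H\<^esub> k, v \<otimes>\<^bsub>V\<^esub> \<phi> h w)),
      one = (\<one>\<^bsub>H\<^esub>, \<one>\<^bsub>V\<^esub>)\<rparr>"

definition complemented :: "('a, 'b) monoid_scheme \<Rightarrow> 'a set \<Rightarrow> bool" where
  "complemented G A \<longleftrightarrow>
     (\<exists>K. subgroup K G \<and> carrier G = A <#>\<^bsub>G\<^esub> K \<and> A \<inter> K = {\<one>\<^bsub>G\<^esub>})"

definition C_group :: "nat \<Rightarrow> ('a, 'b) monoid_scheme \<Rightarrow> bool" where
  "C_group m G \<longleftrightarrow> (\<forall>A. subgroup A G \<and> card A = m \<longrightarrow> complemented G A)"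

definition nontrivial_C_group :: "nat \<Rightarrow> nat \<Rightarrow> ('a, 'b) monoid_scheme \<Rightarrow> bool" where
  "nontrivial_C_group p d G \<longleftrightarrow>
     C_group (p ^ d) G \<and> p ^ d \<le> p ^ multiplicity p (order G)"

definition supersolvable :: "('a, 'b) monoid_scheme \<Rightarrow> bool" where
  "supersolvable G \<longleftrightarrow>
     (\<exists>(k::nat) N. N 0 = {\<one>\<^bsub>G\<^esub>} \<and> N k = carrier G \<and> (\<forall>i\<le>k. N i \<lhd> G) \<and>
        (\<forall>i<k. N i \<subseteq> N (Suc i) \<and> cyclic_group (G\<lparr>carrier := N (Suc i)\<rparr> Mod N i)))"

text \<open>An elementary abelian \<open>p\<close>-group, written multiplicatively, as a vector space over
  \<^term>\<open>residue_ring (int p)\<close>. The fields \<open>mult\<close> and \<open>one\<close> are not part of a module structure.\<close>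

definition Fp_space :: "('v, 'b) monoid_scheme \<Rightarrow> (int, 'v) module" where
  "Fp_space V =
     \<lparr>carrier = carrier V, monoid.mult = undefined, one = undefined,
      ring.zero = \<one>\<^bsub>V\<^esub>, ring.add = monoid.mult V, smult = (\<lambda>k v. v [^]\<^bsub>V\<^esub> k)\<rparr>"

text \<open>A \<open>K[H]\<close>-module is given by a \<open>K\<close>-module \<open>M\<close> with an action \<open>\<phi>\<close> of the group \<open>H\<close> on it
  by \<open>K\<close>-linear maps: the element \<open>\<Sum>\<^sub>h a\<^sub>h h\<close> of \<open>K[H]\<close> sends \<open>v\<close> to \<open>\<Sum>\<^sub>h a\<^sub>h \<phi> h v\<close>.\<close>

definition KH_submodule :: "('k, 'a) ring_scheme \<Rightarrow> ('h, 'b) monoid_scheme \<Rightarrow>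
    ('h \<Rightarrow> 'v \<Rightarrow> 'v) \<Rightarrow> ('k, 'v, 'c) module_scheme \<Rightarrow> 'v set \<Rightarrow> bool" where
  "KH_submodule K H \<phi> M W \<longleftrightarrow>
     Module.submodule W K M \<and> (\<forall>h \<in> carrier H. \<forall>w \<in> W. \<phi> h w \<in> W)"

definition irreducible_KH_submodule :: "('k, 'a) ring_scheme \<Rightarrow> ('h, 'b) monoid_scheme \<Rightarrow>
    ('h \<Rightarrow> 'v \<Rightarrow> 'v) \<Rightarrow> ('k, 'v, 'c) module_scheme \<Rightarrow> 'v set \<Rightarrow> bool" where
  "irreducible_KH_submodule K H \<phi> M W \<longleftrightarrow>
     KH_submodule K H \<phi> M W \<and> W \<noteq> {\<zero>\<^bsub>M\<^esub>} \<and>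
     (\<forall>U. KH_submodule K H \<phi> M U \<and> U \<subseteq> W \<longrightarrow> U = {\<zero>\<^bsub>M\<^esub>} \<or> U = W)"

definition KH_isomorphic :: "('k, 'a) ring_scheme \<Rightarrow> ('h, 'b) monoid_scheme \<Rightarrow>
    ('h \<Rightarrow> 'v \<Rightarrow> 'v) \<Rightarrow> ('k, 'v, 'c) module_scheme \<Rightarrow> 'v set \<Rightarrow> 'v set \<Rightarrow> bool" where
  "KH_isomorphic K H \<phi> M W U \<longleftrightarrow>
     (\<exists>f \<in> module_hom K (M\<lparr>carrier := W\<rparr>) (M\<lparr>carrier := U\<rparr>).
        bij_betw f W U \<and> (\<forall>h \<in> carrier H. \<forall>w \<in> W. f (\<phi> h w) = \<phi> h (f w)))"

definition internal_direct_sum :: "('k, 'v, 'c) module_scheme \<Rightarrow> 'i set \<Rightarrow> ('i \<Rightarrow> 'v set) \<Rightarrow> bool" where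
  "internal_direct_sum M I W \<longleftrightarrow>
     bij_betw (\<lambda>x. \<Oplus>\<^bsub>M\<^esub>i\<in>I. x i) (\<Pi>\<^sub>E i\<in>I. W i) (carrier M)"

definition homogeneous_KH_module :: "('k, 'a) ring_scheme \<Rightarrow> ('h, 'b) monoid_scheme \<Rightarrow>
    ('h \<Rightarrow> 'v \<Rightarrow> 'v) \<Rightarrow> ('k, 'v, 'c) module_scheme \<Rightarrow> bool" where
  "homogeneous_KH_module K H \<phi> M \<longleftrightarrow>
     (\<exists>(m::nat) W. (\<forall>i<m. irreducible_KH_submodule K H \<phi> M (W i)) \<and>
        (\<forall>i<m. \<forall>j<m. KH_isomorphic K H \<phi> M (W i) (W j)) \<and>
        internal_direct_sum M {..<m} W)"

end

theory Submission
  imports Defs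
begin

text \<open>
  Write \<open>e\<close> for the dimension over \<open>F\<^sub>p\<close> of an irreducible submodule; submodules are the
  \<open>H\<close>-invariant subgroups of \<open>V\<close>, and by Maschke's theorem each of them has an invariant
  complement.

  \<^bold>\<open>Reduction to linear algebra.\<close> Since \<open>V\<close> is the normal Sylow \<open>p\<close>-subgroup, all subgroups of
  order \<open>p\<^sup>d\<close> lie in \<open>V\<close>. If \<open>K\<close> complements \<open>A \<le> V\<close> in \<open>G\<close>, then \<open>K \<inter> V\<close> is a submodule and
  complements \<open>A\<close> in \<open>V\<close>; conversely, if a submodule \<open>U\<close> complements \<open>A\<close> in \<open>V\<close>, then \<open>H U\<close>
  complements \<open>A\<close> in \<open>G\<close>. So \<open>G\<close> is a \<open>C(p\<^sup>d)\<close>-group iff every subspace of dimension \<open>d\<close> has an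
  invariant complement (\<open>nontrivial_C_group_iff\<close>). Supersolvability of \<open>G\<close> means that every
  irreducible submodule has order \<open>p\<close>: such a submodule embeds into a cyclic factor of a normal
  series (\<open>supersolvable_imp_lines\<close>), and conversely \<open>H\<close> is then abelian, because it acts by
  scalars on the irreducible submodules, and a flag of \<open>V\<close> extends to a series of \<open>G\<close>
  (\<open>lines_imp_supersolvable\<close>).

  \<^bold>\<open>Sufficiency.\<close> Given \<open>A\<close>, take a submodule \<open>U\<close> maximal with \<open>U \<inter> A = 1\<close>. If all irreducible
  submodules have order \<open>p\<close>, one of them outside \<open>U A\<close> could be added to \<open>U\<close>. In case (2) every
  vector spans an irreducible submodule of order \<open>p\<^sup>e\<close>, as the group ring acts through the field
  with \<open>p\<^sup>e\<close> elements; maximality of \<open>U\<close> says that \<open>V\<close> is the union of \<open>U\<close> and the sums of \<open>U\<close> with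
  the irreducible submodules that meet \<open>A\<close>, and counting shows that this is impossible unless
  \<open>U A = V\<close> (\<open>irred_cover_imp_complementing\<close>).

  \<^bold>\<open>Necessity: homogeneity.\<close> Let \<open>W\<close> be irreducible with \<open>e > 1\<close>, let \<open>T\<close> be its isotypic component
  and \<open>C\<close> an invariant complement of \<open>T\<close>. Every submodule splits along \<open>V = T \<oplus> C\<close>. Applied to an
  invariant complement of \<open>A\<^sub>1 \<oplus> A\<^sub>2\<close> with \<open>A\<^sub>1 \<le> T\<close> of dimension \<open>a\<close> and \<open>A\<^sub>2 \<le> C\<close> of dimension
  \<open>d - a\<close>, this gives a submodule of \<open>T\<close> of codimension \<open>a\<close>, so \<open>e\<close> divides \<open>dim T - a\<close>. If \<open>C\<close> were
  nonzero, two consecutive values of \<open>a\<close> would be available, contradicting \<open>e > 1\<close>. Hence \<open>V = T\<close>,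
  and \<open>e\<close> divides \<open>n\<close> and \<open>n - d\<close> (\<open>complementing_imp_isotypic\<close>).

  \<^bold>\<open>Necessity: cyclicity.\<close> Let \<open>D\<close> be the division ring of \<open>H\<close>-endomorphisms of \<open>W\<close> and let
  \<open>w \<in> W\<close> be nonzero. Inside a sum \<open>S\<close> of \<open>d / e + 1\<close> copies of \<open>W\<close>, the vectors \<open>f w\<close> for
  equivariant \<open>f : W \<rightarrow> S\<close> form a subspace that meets every irreducible submodule of \<open>S\<close>. If
  \<open>D w \<noteq> W\<close>, then \<open>|D|\<^sup>2 \<le> |W|\<close>, and this subspace has dimension at most \<open>d\<close>; a subspace of \<open>S\<close> of
  dimension \<open>d\<close> that contains it has no invariant complement. So \<open>D w = W\<close>
  (\<open>endo_transitive\<close>). By Wedderburn's theorem \<open>D\<close> is a field; it follows that \<open>H\<close> acts on \<open>W\<close>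
  through the cyclic group \<open>D - {0}\<close>, and faithfully, since \<open>V\<close> is a sum of copies of \<open>W\<close>
  (\<open>cyclic_of_transitive\<close>).
\<close>

section \<open>Finite division rings\<close>

locale finite_division_ring = ring R for R (structure) +
  assumes finite_carrier: "finite (carrier R)"
    and Units_eq: "Units R = carrier R - {\<zero>}"
begin

lemma one_nonzero: "\<one> \<noteq> \<zero>"
  using Units_one_closed Units_eq by auto

lemma nonzero_inv:
  assumes "x \<in> carrier R" "x \<noteq> \<zero>"
  shows "inv x \<in> carrier R" "inv x \<noteq> \<zero>" "x \<otimes> inv x = \<one>" "inv x \<otimes> x = \<one>"
  using assms Units_eq Units_inv_Units[of x] Units_inv_closed[of x] by auto

lemma cancel_inv:
  assumes "x \<in> carrier R" "x \<noteq> \<zero>" "y \<in> carrier R"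
  shows "inv x \<otimes> (x \<otimes> y) = y" "x \<otimes> (inv x \<otimes> y) = y"
  using m_assoc[of "inv x" x y] m_assoc[of x "inv x" y] nonzero_inv[OF assms(1,2)] assms(1,3)
  by simp_all

lemma mult_left_cancel:
  assumes "x \<in> carrier R" "x \<noteq> \<zero>" "y \<in> carrier R" "z \<in> carrier R" "x \<otimes> y = x \<otimes> z"
  shows "y = z"
proof -
  have "y = inv x \<otimes> (x \<otimes> y)" by (rule cancel_inv(1)[OF assms(1-3), symmetric])
  also have "\<dots> = inv x \<otimes> (x \<otimes> z)" by (simp only: assms(5))
  also have "\<dots> = z" by (rule cancel_inv(1)[OF assms(1,2,4)])
  finally show ?thesis .
qed

lemma mult_right_cancel:
  assumes "x \<in> carrier R" "x \<noteq> \<zero>" "y \<in> carrier R" "z \<in> carrier R" "y \<otimes> x = z \<otimes> x"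
  shows "y = z"
proof -
  have "y \<otimes> x \<otimes> inv x = z \<otimes> x \<otimes> inv x" by (simp only: assms(5))
  then show ?thesis using assms(1-4) by (simp add: m_assoc nonzero_inv)
qed

lemma nonzero_mult:
  assumes "x \<in> carrier R" "x \<noteq> \<zero>" "y \<in> carrier R" "y \<noteq> \<zero>"
  shows "x \<otimes> y \<noteq> \<zero>"
  using mult_left_cancel[of x y \<zero>] assms by auto

lemma nonzero_pow:
  assumes "x \<in> carrier R" "x \<noteq> \<zero>"
  shows "x [^] (n::nat) \<noteq> \<zero>"
  by (induction n) (simp_all add: assms one_nonzero nonzero_mult)

lemma pow_eq_one:
  assumes "x \<in> carrier R" "x \<noteq> \<zero>"
  obtains n :: nat where "n > 0" "x [^] n = \<one>"
proof -
  have "finite (range (\<lambda>n::nat. x [^] n))"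
    by (rule finite_subset[OF _ finite_carrier]) (use assms in auto)
  then have "\<not> inj_on (\<lambda>n::nat. x [^] n) UNIV"
    using finite_imageD infinite_UNIV_nat by blast
  then obtain m n :: nat where mn: "m < n" "x [^] m = x [^] n"
    using linorder_injI[of "\<lambda>n::nat. x [^] n"] by blast
  have "x [^] m \<otimes> \<one> = x [^] m \<otimes> x [^] (n - m)"
    using mn nat_pow_mult[of x m "n - m"] assms by simp
  from mult_left_cancel[OF _ _ _ _ this] have "\<one> = x [^] (n - m)"
    using assms nonzero_pow[OF assms] by simp
  with mn that[of "n - m"] show ?thesis by simp
qed

lemma commutes_pow:
  assumes comm: "x \<otimes> y = y \<otimes> x" and xy: "x \<in> carrier R" "y \<in> carrier R"
  shows "x [^] (n::nat) \<otimes> y = y \<otimes> x [^] n"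
proof (induction n)
  case (Suc n)
  have "x [^] Suc n \<otimes> y = x [^] n \<otimes> (y \<otimes> x)" using xy by (simp add: m_assoc comm[symmetric])
  also have "\<dots> = x [^] n \<otimes> y \<otimes> x" using xy by (simp add: m_assoc)
  also have "\<dots> = y \<otimes> x [^] Suc n" unfolding Suc using xy by (simp add: m_assoc)
  finally show ?case .
qed (use xy in simp)

lemma commutes_inv:
  assumes comm: "x \<otimes> y = y \<otimes> x" and xy: "x \<in> carrier R" "y \<in> carrier R" "x \<noteq> \<zero>"
  shows "inv x \<otimes> y = y \<otimes> inv x"
proof (rule mult_left_cancel[of x])
  have "x \<otimes> (inv x \<otimes> y) = y" using xy by (simp add: cancel_inv)
  also have "\<dots> = y \<otimes> (x \<otimes> inv x)" using xy by (simp add: nonzero_inv)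
  also have "\<dots> = y \<otimes> x \<otimes> inv x" using xy by (intro m_assoc[symmetric] nonzero_inv)
  also have "\<dots> = x \<otimes> y \<otimes> inv x" by (subst comm) (rule refl)
  also have "\<dots> = x \<otimes> (y \<otimes> inv x)" using xy by (intro m_assoc nonzero_inv)
  finally show "x \<otimes> (inv x \<otimes> y) = x \<otimes> (y \<otimes> inv x)" .
qed (use xy nonzero_inv in auto)

text \<open>The Vandermonde argument with coefficients on the right: subtracting \<open>\<mu>\<^sub>k\<close> times the relation for
  the exponent \<open>j\<close> from the one for \<open>j + 1\<close> removes the last summand. In this form the lemma
  covers Dedekind's independence of characters and also the independence of eigenvectors in a
  noncommutative ring.\<close>

lemma vandermonde_independent:
  fixes k :: nat
  assumes "\<And>i. i < k \<Longrightarrow> \<mu> i \<in> carrier R" "\<And>i j. i < k \<Longrightarrow> j < k \<Longrightarrow> \<mu> i \<otimes> \<mu> j = \<mu> j \<otimes> \<mu> i"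
    and "inj_on \<mu> {..<k}" and "\<And>i. i < k \<Longrightarrow> u i \<in> carrier R"
    and "\<And>j::nat. (\<Oplus>i\<in>{..<k}. \<mu> i [^] j \<otimes> u i) = \<zero>"
    and "i < k"
  shows "u i = \<zero>"
  using assms
proof (induction k arbitrary: u i)
  case (Suc k)
  note closed = Suc.prems(1,4)
  define c where "c = \<ominus> \<mu> k"
  have c: "c \<in> carrier R" using closed by (simp add: c_def)
  define v where "v i = (\<mu> i \<oplus> c) \<otimes> u i" for i
  have vk: "v k = \<zero>" using closed by (simp add: v_def c_def r_neg)
  have cc: "\<mu> i [^] j \<otimes> c = c \<otimes> \<mu> i [^] j" if "i < Suc k" for i and j :: nat
  proof (rule commutes_pow)
    show "\<mu> i \<otimes> c = c \<otimes> \<mu> i"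
      using Suc.prems(1)[of i] Suc.prems(1)[of k] that Suc.prems(2)[of k i]
      by (simp add: c_def l_minus r_minus)
  qed (use that closed c in auto)
  have "(\<Oplus>i\<in>{..<k}. \<mu> i [^] j \<otimes> v i) = \<zero>" for j :: nat
  proof -
    have 1: "\<mu> i [^] Suc j \<otimes> u i \<oplus> c \<otimes> (\<mu> i [^] j \<otimes> u i) = \<mu> i [^] j \<otimes> v i" if "i < Suc k" for i
    proof -
      have "\<mu> i [^] j \<otimes> v i = \<mu> i [^] j \<otimes> \<mu> i \<otimes> u i \<oplus> \<mu> i [^] j \<otimes> c \<otimes> u i"
        using closed[OF that] c by (simp add: v_def l_distr r_distr m_assoc)
      also have "\<dots> = \<mu> i [^] Suc j \<otimes> u i \<oplus> c \<otimes> (\<mu> i [^] j \<otimes> u i)"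
        unfolding cc[OF that] using closed[OF that] c by (simp add: m_assoc)
      finally show ?thesis by simp
    qed
    have "\<zero> = (\<Oplus>i\<in>{..<Suc k}. \<mu> i [^] Suc j \<otimes> u i) \<oplus> c \<otimes> (\<Oplus>i\<in>{..<Suc k}. \<mu> i [^] j \<otimes> u i)"
      using Suc.prems(5)[of j] Suc.prems(5)[of "Suc j"] c by simp
    also have "\<dots> = (\<Oplus>i\<in>{..<Suc k}. \<mu> i [^] Suc j \<otimes> u i) \<oplus> (\<Oplus>i\<in>{..<Suc k}. c \<otimes> (\<mu> i [^] j \<otimes> u i))"
      by (subst finsum_rdistr) (use closed c in auto)
    also have "\<dots> = (\<Oplus>i\<in>{..<Suc k}. \<mu> i [^] Suc j \<otimes> u i \<oplus> c \<otimes> (\<mu> i [^] j \<otimes> u i))"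
      by (subst finsum_addf) (use closed c in auto)
    also have "\<dots> = (\<Oplus>i\<in>{..<Suc k}. \<mu> i [^] j \<otimes> v i)"
      by (rule finsum_cong') (use closed c 1 in \<open>auto simp: v_def\<close>)
    also have "\<dots> = (\<Oplus>i\<in>{..<k}. \<mu> i [^] j \<otimes> v i)"
      unfolding lessThan_Suc by (subst finsum_insert) (use closed c in \<open>auto simp: v_def vk[unfolded v_def]\<close>)
    finally show ?thesis by simp
  qed
  note sum0 = this
  have v0: "v i = \<zero>" if "i < k" for i
  proof (rule Suc.IH)
    show "inj_on \<mu> {..<k}" using Suc.prems(3) by (rule inj_on_subset) auto
    show "\<mu> i \<otimes> \<mu> j = \<mu> j \<otimes> \<mu> i" if "i < k" "j < k" for i j using Suc.prems(2) that by simp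
  qed (use closed that c sum0 in \<open>auto simp: v_def\<close>)
  have u0: "u i = \<zero>" if "i < k" for i
  proof (rule ccontr)
    assume "u i \<noteq> \<zero>"
    then have "\<mu> i \<oplus> c = \<zero>"
      using v0[OF that] nonzero_mult[of "\<mu> i \<oplus> c" "u i"] closed[of i] that c by (auto simp: v_def)
    then have "\<mu> i = \<mu> k"
      using closed[of i] closed(1)[of k] that minus_equality[of "\<mu> i" c] c by (simp add: c_def)
    with inj_onD[OF Suc.prems(3), of i k] that show False by simp
  qed
  have "\<zero> = (\<Oplus>i\<in>{..<Suc k}. \<mu> i [^] (0::nat) \<otimes> u i)" using Suc.prems(5)[of 0] by simp
  also have "\<dots> = u k \<oplus> (\<Oplus>i\<in>{..<k}. u i)"
    unfolding lessThan_Suc by (subst finsum_insert) (use closed in \<open>auto intro!: arg_cong2[where f="(\<oplus>)"] finsum_cong'\<close>)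
  also have "(\<Oplus>i\<in>{..<k}. u i) = \<zero>"
    using u0 by (intro add.finprod_one_eqI) auto
  finally have "u k = \<zero>" using closed by simp
  with u0 Suc.prems(6) show ?case by (metis less_Suc_eq)
qed simp

text \<open>Summation over a cycle of length \<open>N\<close> is invariant under rotation.\<close>

lemma finsum_shift:
  fixes N :: nat
  assumes "\<And>i. i \<le> N \<Longrightarrow> g i \<in> carrier R" "g N = g 0"
  shows "(\<Oplus>i\<in>{..<N}. g (Suc i)) = (\<Oplus>i\<in>{..<N}. g i)"
proof -
  have "(\<Oplus>i\<in>{..<n}. g (Suc i)) \<oplus> g 0 = (\<Oplus>i\<in>{..<n}. g i) \<oplus> g n" if "n \<le> N" for n
    using that
  proof (induction n)
    case (Suc n)
    have c: "g i \<in> carrier R" if "i \<le> Suc n" for i using assms(1) Suc.prems that by simp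
    have "(\<Oplus>i\<in>{..<Suc n}. g (Suc i)) \<oplus> g 0 = g (Suc n) \<oplus> ((\<Oplus>i\<in>{..<n}. g (Suc i)) \<oplus> g 0)"
      unfolding lessThan_Suc using c by (subst finsum_insert) (auto simp: a_assoc Pi_def)
    also have "\<dots> = g (Suc n) \<oplus> ((\<Oplus>i\<in>{..<n}. g i) \<oplus> g n)" using Suc by simp
    also have "\<dots> = (\<Oplus>i\<in>{..<Suc n}. g i) \<oplus> g (Suc n)"
      unfolding lessThan_Suc using c by (subst finsum_insert) (auto simp: a_ac Pi_def)
    finally show ?case .
  qed simp
  from this[of N] show ?thesis using assms by (auto simp: Pi_def)
qed

text \<open>The maximal commutative subsets, equivalently the maximal subfields of the division ring.\<close>

definition selfcentral where
  "selfcentral K \<longleftrightarrow> (\<forall>z. z \<in> K \<longleftrightarrow> z \<in> carrier R \<and> (\<forall>x\<in>K. x \<otimes> z = z \<otimes> x))"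

lemma ex_selfcentral: "\<exists>K. selfcentral K"
proof -
  define C where "C = {K. K \<subseteq> carrier R \<and> (\<forall>x\<in>K. \<forall>y\<in>K. x \<otimes> y = y \<otimes> x)}"
  have "finite C" using finite_carrier by (auto simp: C_def intro: finite_subset[of _ "Pow (carrier R)"])
  moreover have "{} \<in> C" by (auto simp: C_def)
  ultimately obtain K where K: "K \<in> C" "\<And>L. L \<in> C \<Longrightarrow> K \<subseteq> L \<Longrightarrow> K = L"
    using finite_has_maximal2[of C "{}"] by auto
  have "z \<in> K" if "z \<in> carrier R" "\<forall>x\<in>K. x \<otimes> z = z \<otimes> x" for z
  proof -
    have "insert z K \<in> C" using K(1) that by (auto simp: C_def)
    then show ?thesis using K(2) by blast
  qed
  moreover have "z \<in> carrier R" "\<forall>x\<in>K. x \<otimes> z = z \<otimes> x" if "z \<in> K" for z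
    using K(1) that unfolding C_def by auto
  ultimately have "selfcentral K" unfolding selfcentral_def by auto
  then show ?thesis ..
qed

context
  fixes K assumes K: "selfcentral K"
begin

lemma selfcentral_iff: "z \<in> K \<longleftrightarrow> z \<in> carrier R \<and> (\<forall>x\<in>K. x \<otimes> z = z \<otimes> x)"
  by (rule spec[OF K[unfolded selfcentral_def]])

lemma selfcentral_mem: "z \<in> K \<Longrightarrow> z \<in> carrier R" by (rule conjunct1[OF iffD1[OF selfcentral_iff]])
lemma selfcentral_comm: "x \<in> K \<Longrightarrow> y \<in> K \<Longrightarrow> x \<otimes> y = y \<otimes> x"
  by (rule bspec[OF conjunct2[OF iffD1[OF selfcentral_iff]]])

lemma selfcentral_subring: "subring K R"
proof (rule subringI)
  show "K \<subseteq> carrier R" using selfcentral_mem by blast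
  show "\<one> \<in> K" by (subst selfcentral_iff) (auto simp: selfcentral_mem)
  fix x y assume xy: "x \<in> K" "y \<in> K"
  show "\<ominus> x \<in> K" using xy(1) by (subst selfcentral_iff) (auto simp: selfcentral_mem l_minus r_minus intro!: arg_cong[where f="a_inv R"] selfcentral_comm)
  show "x \<otimes> y \<in> K"
  proof (subst selfcentral_iff, intro conjI ballI)
    fix z assume z: "z \<in> K"
    then have "z \<otimes> (x \<otimes> y) = z \<otimes> x \<otimes> y" using xy by (simp add: selfcentral_mem m_assoc)
    also have "\<dots> = x \<otimes> z \<otimes> y" by (subst selfcentral_comm[OF z xy(1)]) (rule refl)
    also have "\<dots> = x \<otimes> (z \<otimes> y)" using xy z by (simp add: selfcentral_mem m_assoc)
    also have "\<dots> = x \<otimes> (y \<otimes> z)" by (subst selfcentral_comm[OF z xy(2)]) (rule refl)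
    also have "\<dots> = x \<otimes> y \<otimes> z" using xy z by (simp add: selfcentral_mem m_assoc)
    finally show "z \<otimes> (x \<otimes> y) = x \<otimes> y \<otimes> z" .
  qed (use xy selfcentral_mem in auto)
  show "x \<oplus> y \<in> K"
    by (subst selfcentral_iff) (use xy selfcentral_mem in \<open>auto simp: l_distr r_distr intro!: arg_cong2[where f="(\<oplus>)"] selfcentral_comm\<close>)
qed

lemma selfcentral_inv: "x \<in> K \<Longrightarrow> x \<noteq> \<zero> \<Longrightarrow> inv x \<in> K"
  by (subst selfcentral_iff) (use selfcentral_mem nonzero_inv(1) selfcentral_comm commutes_inv in metis)

lemma selfcentral_closed:
  "\<zero> \<in> K" "\<one> \<in> K" "x \<in> K \<Longrightarrow> y \<in> K \<Longrightarrow> x \<otimes> y \<in> K" "x \<in> K \<Longrightarrow> y \<in> K \<Longrightarrow> x \<oplus> y \<in> K"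
  using subringE[OF selfcentral_subring] by auto

lemma selfcentral_pow: "x \<in> K \<Longrightarrow> x [^] (n::nat) \<in> K"
  by (induction n) (auto simp: selfcentral_closed)

lemma selfcentral_field: "field (R\<lparr>carrier := K\<rparr>)"
proof (rule subfield_iff(2), rule subfieldI)
  show "subcring K R" by (rule subcringI[OF selfcentral_subring]) (rule selfcentral_comm)
  show "Units (R\<lparr>carrier := K\<rparr>) = K - {\<zero>}"
  proof
    show "Units (R\<lparr>carrier := K\<rparr>) \<subseteq> K - {\<zero>}"
      unfolding Units_def using selfcentral_mem one_nonzero by auto
    show "K - {\<zero>} \<subseteq> Units (R\<lparr>carrier := K\<rparr>)"
    proof
      fix x assume "x \<in> K - {\<zero>}"
      then have "inv x \<in> K" "x \<otimes> inv x = \<one>" "inv x \<otimes> x = \<one>" "x \<in> K"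
        using selfcentral_inv nonzero_inv selfcentral_mem by auto
      then show "x \<in> Units (R\<lparr>carrier := K\<rparr>)" unfolding Units_def by auto
    qed
  qed
qed

lemma selfcentral_generator:
  obtains a where "a \<in> K" "a \<noteq> \<zero>" "K = insert \<zero> (range (\<lambda>i::nat. a [^] i))"
proof -
  interpret F: field "R\<lparr>carrier := K\<rparr>" by (rule selfcentral_field)
  have "finite K" using finite_carrier selfcentral_mem by (meson finite_subset subsetI)
  then obtain a where a: "a \<in> carrier (mult_of (R\<lparr>carrier := K\<rparr>))"
    "carrier (mult_of (R\<lparr>carrier := K\<rparr>)) = {a [^]\<^bsub>R\<lparr>carrier := K\<rparr>\<^esub> i |i::nat. i \<in> UNIV}"
    using F.finite_field_mult_group_has_gen by auto
  have "a [^]\<^bsub>R\<lparr>carrier := K\<rparr>\<^esub> i = a [^] i" for i :: nat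
    by (simp add: nat_pow_def)
  with a have "K - {\<zero>} = range (\<lambda>i::nat. a [^] i)" "a \<in> K" "a \<noteq> \<zero>" by auto
  with that[of a] show ?thesis using selfcentral_closed(1) by auto
qed

lemma centralizer_generator:
  assumes "K = insert \<zero> (range (\<lambda>i::nat. a [^] i))" "a \<in> K" "z \<in> carrier R" "a \<otimes> z = z \<otimes> a"
  shows "z \<in> K"
proof (subst selfcentral_iff, intro conjI ballI)
  fix y assume "y \<in> K"
  then consider "y = \<zero>" | i :: nat where "y = a [^] i" by (subst (asm) assms(1)) auto
  then show "y \<otimes> z = z \<otimes> y"
    by cases (use assms(3) commutes_pow[OF assms(4) selfcentral_mem[OF assms(2)] assms(3)] in simp_all)
qed (use assms in auto)

text \<open>Conjugation by the generator \<open>a\<close> of a maximal subfield \<open>K\<close> has finite order \<open>N\<close>, and \<open>K\<close> contains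
  \<open>N\<close> roots of unity of order dividing \<open>N\<close>; so its discrete Fourier components
  \<open>w\<^sub>j = \<Sum>\<^sub>i a\<^sup>i\<^sup>j (a\<^sup>i z a\<^sup>-\<^sup>i)\<close> are eigenvectors, with eigenvalue \<open>a\<^sup>-\<^sup>j\<close>. Starting from
  \<open>z = a y a\<^sup>-\<^sup>1 - y\<close> removes the component that commutes with \<open>a\<close>. An eigenvector with eigenvalue
  other than 1 is an element outside \<open>K\<close> that normalizes \<open>K\<close>.\<close>

lemma ex_skew_normalizer:
  assumes gen: "K = insert \<zero> (range (\<lambda>i::nat. a [^] i))" "a \<in> K" "a \<noteq> \<zero>"
    and x0: "y \<in> carrier R" "y \<notin> K"
  obtains x s where "x \<in> carrier R" "x \<notin> K" "x \<otimes> a = a [^] (s::nat) \<otimes> x"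
proof -
  note a = selfcentral_mem[OF gen(2)]
  note b = nonzero_inv[OF a gen(3)]
  define N where "N = (LEAST n::nat. n > 0 \<and> a [^] n = \<one>)"
  obtain n0 :: nat where "n0 > 0" "a [^] n0 = \<one>" using pow_eq_one[OF a gen(3)] by blast
  then have N: "N > 0 \<and> a [^] N = \<one>"
    unfolding N_def by (intro LeastI[of "\<lambda>n. n > 0 \<and> a [^] n = \<one>" n0]) simp
  have inj: "inj_on (\<lambda>i::nat. a [^] i) {..<N}"
  proof (rule linorder_inj_onI)
    fix i j assume ij: "i < j" "i \<in> {..<N}" "j \<in> {..<N}"
    show "a [^] i \<noteq> a [^] j"
    proof
      assume "a [^] i = a [^] j"
      then have "a [^] i \<otimes> \<one> = a [^] i \<otimes> a [^] (j - i)"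
        using nat_pow_mult[OF a, of i "j - i"] ij a by simp
      from mult_left_cancel[OF _ _ _ _ this, symmetric] have "a [^] (j - i) = \<one>"
        using a nonzero_pow[OF a gen(3)] by simp
      then show False using not_less_Least[of "j - i" "\<lambda>n. n > 0 \<and> a [^] n = \<one>", folded N_def] ij by (auto intro: less_imp_diff_less)
    qed
  qed auto
  have bN: "inv a [^] N = \<one>"
  proof -
    have "inv a [^] n \<otimes> a [^] n = \<one>" for n :: nat
    proof (induction n)
      case (Suc n)
      have "inv a [^] Suc n \<otimes> a [^] Suc n = inv a [^] n \<otimes> inv a \<otimes> (a \<otimes> a [^] n)"
        by (simp only: nat_pow_Suc2[OF a] nat_pow_Suc[of "inv a"])
      also have "\<dots> = inv a [^] n \<otimes> (inv a \<otimes> (a \<otimes> a [^] n))"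
        using a b(1) by (simp add: m_assoc)
      also have "\<dots> = \<one>" using Suc a gen(3) by (simp add: cancel_inv)
      finally show ?case .
    qed simp
    from this[of N] show ?thesis using N b by simp
  qed
  define h where "h i = a [^] i \<otimes> y \<otimes> inv a [^] i" for i :: nat
  define f where "f i = h (Suc i) \<oplus> \<ominus> h i" for i
  have hc: "h i \<in> carrier R" and fc: "f i \<in> carrier R" for i using a b x0 by (auto simp: h_def f_def)
  have hS: "h (Suc i) = a \<otimes> h i \<otimes> inv a" for i
  proof -
    have "h (Suc i) = (a \<otimes> a [^] i) \<otimes> y \<otimes> (inv a [^] i \<otimes> inv a)"
      by (simp only: h_def nat_pow_Suc2[OF a] nat_pow_Suc[of "inv a"])
    then show ?thesis using a b(1) x0 by (simp add: h_def m_assoc)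
  qed
  have hN: "h N = h 0" using N bN by (simp add: h_def)
  have fS: "f (Suc i) = a \<otimes> f i \<otimes> inv a" for i
    unfolding f_def hS[of "Suc i"] hS[of i]
    using a b(1) hc by (simp add: l_distr r_distr l_minus r_minus)
  have fN: "f N = f 0" unfolding f_def using hN hS by simp
  define w where "w j = (\<Oplus>i\<in>{..<N}. (a [^] i) [^] j \<otimes> f i)" for j :: nat
  have wc: "w j \<in> carrier R" for j using fc a by (auto simp: w_def intro!: finsum_closed)
  have f0: "f 0 \<noteq> \<zero>"
  proof
    assume "f 0 = \<zero>"
    then have eq: "h (Suc 0) = h 0"
      using minus_equality[of "h (Suc 0)" "\<ominus> h 0"] hc by (simp add: f_def)
    then have "a \<otimes> y \<otimes> inv a \<otimes> a = y \<otimes> a" using a b(1) x0 by (simp add: h_def)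
    then have "a \<otimes> y = y \<otimes> a" using a b x0 by (simp add: m_assoc)
    with centralizer_generator[OF gen(1,2) x0(1)] x0(2) show False by simp
  qed
  have "\<exists>j. w j \<noteq> \<zero>"
  proof (rule ccontr)
    assume "\<not> (\<exists>j. w j \<noteq> \<zero>)"
    then have "f 0 = \<zero>"
      by (intro vandermonde_independent[of N "\<lambda>i. a [^] i" f])
        (use a fc inj N in \<open>auto simp: w_def nat_pow_mult add.commute\<close>)
    with f0 show False by simp
  qed
  then obtain j where j: "w j \<noteq> \<zero>" by blast
  have shift: "a [^] j \<otimes> (a \<otimes> w j \<otimes> inv a) = w j"
  proof -
    have "a [^] j \<otimes> (a \<otimes> w j \<otimes> inv a) = (\<Oplus>i\<in>{..<N}. a [^] j \<otimes> (a \<otimes> ((a [^] i) [^] j \<otimes> f i) \<otimes> inv a))"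
      unfolding w_def using a b fc by (simp add: finsum_ldistr finsum_rdistr Pi_def)
    also have "\<dots> = (\<Oplus>i\<in>{..<N}. (a [^] Suc i) [^] j \<otimes> f (Suc i))"
    proof (rule finsum_cong')
      fix i
      have "a [^] j \<otimes> (a \<otimes> ((a [^] i) [^] j \<otimes> f i) \<otimes> inv a)
          = a [^] j \<otimes> (a [^] Suc (i * j) \<otimes> (f i \<otimes> inv a))"
        unfolding nat_pow_Suc2[OF a] nat_pow_pow[OF a] using a b(1) fc by (simp add: m_assoc)
      also have "a [^] Suc (i * j) = a [^] (i * j) \<otimes> a" by simp
      also have "a [^] j \<otimes> (a [^] (i * j) \<otimes> a \<otimes> (f i \<otimes> inv a)) =
          (a [^] j \<otimes> a [^] (i * j)) \<otimes> (a \<otimes> f i \<otimes> inv a)"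
        using a b(1) fc by (simp add: m_assoc)
      also have "\<dots> = (a [^] Suc i) [^] j \<otimes> f (Suc i)"
        unfolding fS nat_pow_pow[OF a] nat_pow_mult[OF a] by simp
      finally show "a [^] j \<otimes> (a \<otimes> ((a [^] i) [^] j \<otimes> f i) \<otimes> inv a)
        = (a [^] Suc i) [^] j \<otimes> f (Suc i)" .
    qed (use a fc in auto)
    also have "\<dots> = w j"
      unfolding w_def using a fc N fN by (intro finsum_shift) auto
    finally show ?thesis .
  qed
  have comm: "w j \<otimes> a = a [^] Suc j \<otimes> w j"
  proof -
    have "w j \<otimes> a = a [^] j \<otimes> (a \<otimes> w j \<otimes> inv a) \<otimes> a" by (simp only: shift)
    also have "\<dots> = a [^] j \<otimes> a \<otimes> w j" using a b wc by (simp add: m_assoc)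
    finally show ?thesis by simp
  qed
  have "w j \<notin> K"
  proof
    assume "w j \<in> K"
    then have "w j \<otimes> a = a \<otimes> w j" using selfcentral_comm gen(2) by blast
    then have "a [^] Suc j \<otimes> w j = a \<otimes> w j" using comm by simp
    from mult_right_cancel[OF wc j _ _ this] have "a [^] Suc j = a" using a by simp
    then have "a \<otimes> a [^] j = a \<otimes> \<one>" unfolding nat_pow_Suc2[OF a, of j] using a by simp
    from mult_left_cancel[OF a gen(3) _ _ this] have aj: "a [^] j = \<one>" using a by simp
    have "(a [^] i) [^] j = \<one>" for i :: nat
      using nat_pow_pow[OF a, of i j] nat_pow_pow[OF a, of j i] aj by (simp add: mult.commute)
    then have "w j = (\<Oplus>i\<in>{..<N}. f i)" using fc by (simp add: w_def)
    also have "\<dots> = (\<Oplus>i\<in>{..<N}. h (Suc i)) \<oplus> (\<Oplus>i\<in>{..<N}. \<ominus> h i)"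
      unfolding f_def using hc by (intro finsum_addf) auto
    also have "(\<Oplus>i\<in>{..<N}. h (Suc i)) = (\<Oplus>i\<in>{..<N}. h i)"
      by (rule finsum_shift) (use hc hN in auto)
    also have "(\<Oplus>i\<in>{..<N}. h i) \<oplus> (\<Oplus>i\<in>{..<N}. \<ominus> h i) = (\<Oplus>i\<in>{..<N}. h i \<oplus> \<ominus> h i)"
      using hc by (intro finsum_addf[symmetric]) auto
    also have "\<dots> = \<zero>" using hc by (simp add: r_neg)
    finally show False using j by simp
  qed
  with that[OF wc _ comm] show ?thesis by simp
qed

text \<open>Let \<open>\<sigma>\<close> be the automorphism \<open>z \<mapsto> x z x\<^sup>-\<^sup>1\<close> of \<open>K\<close>, of order \<open>k\<close>, and let \<open>F\<close> be the group of nonzero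
  elements of its fixed field. The elements \<open>c x\<close> with \<open>c \<in> K - {0}\<close> induce \<open>\<sigma>\<close> too, and
  \<open>\<nu> c = (c x)\<^sup>k\<close> lies in \<open>F\<close>; up to the factor \<open>x\<^sup>k\<close>, \<open>\<nu>\<close> is the norm. By Hilbert's theorem 90 the
  fibres of \<open>\<nu>\<close> have at most \<open>|K - {0}| / |F|\<close> elements, so \<open>\<nu>\<close> is onto \<open>F\<close> and \<open>u\<^sup>k = 1\<close> for some
  \<open>u = c x\<close>. Then \<open>(u - 1) (1 + u + \<dots> + u\<^sup>k\<^sup>-\<^sup>1) = 0\<close>, although \<open>1, u, \<dots>, u\<^sup>k\<^sup>-\<^sup>1\<close> are linearly
  independent over \<open>K\<close> and \<open>u \<noteq> 1\<close>.\<close>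

lemma no_skew_normalizer:
  assumes gen: "K = insert \<zero> (range (\<lambda>i::nat. a [^] i))" "a \<in> K" "a \<noteq> \<zero>"
    and x: "x \<in> carrier R" "x \<notin> K" "x \<otimes> a = a [^] (s::nat) \<otimes> x"
  shows False
proof -
  note a = selfcentral_mem[OF gen(2)]
  have x0: "x \<noteq> \<zero>" using x(2) selfcentral_closed(1) by auto
  define \<sigma> where "\<sigma> z = x \<otimes> z \<otimes> inv x" for z
  have \<sigma>: "\<sigma> z \<in> K" "x \<otimes> z = \<sigma> z \<otimes> x" if z: "z \<in> K" for z
  proof -
    show eq: "x \<otimes> z = \<sigma> z \<otimes> x"
      unfolding \<sigma>_def using x(1) nonzero_inv[OF x(1) x0] selfcentral_mem[OF z] by (simp add: m_assoc)
    consider "z = \<zero>" | i :: nat where "z = a [^] i" using z by (subst (asm) gen(1)) auto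
    then have "\<exists>c\<in>K. x \<otimes> z = c \<otimes> x"
    proof cases
      case 1
      then show ?thesis using x(1) selfcentral_closed(1) by (intro bexI[of _ \<zero>]) auto
    next
      case 2
      have "x \<otimes> a [^] n = a [^] (s * n) \<otimes> x" for n :: nat
      proof (induction n)
        case (Suc n)
        have "x \<otimes> a [^] Suc n = x \<otimes> a [^] n \<otimes> a" using x(1) a by (simp add: m_assoc)
        also have "\<dots> = a [^] (s * n) \<otimes> (x \<otimes> a)" unfolding Suc using x(1) a by (simp add: m_assoc)
        also have "\<dots> = a [^] (s * n) \<otimes> a [^] s \<otimes> x" unfolding x(3) using x(1) a by (simp add: m_assoc)
        also have "\<dots> = a [^] (s * Suc n) \<otimes> x" using a by (simp add: nat_pow_mult add.commute)
        finally show ?case .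
      qed (use x(1) in simp)
      with 2 show ?thesis using selfcentral_pow[OF gen(2)] by blast
    qed
    then obtain c where c: "c \<in> K" "x \<otimes> z = c \<otimes> x" by blast
    have "\<sigma> z = c \<otimes> x \<otimes> inv x" by (simp only: \<sigma>_def c(2))
    also have "\<dots> = c" using selfcentral_mem[OF c(1)] x(1) nonzero_inv[OF x(1) x0] by (simp add: m_assoc)
    finally have "\<sigma> z = c" .
    with c show "\<sigma> z \<in> K" by simp
  qed
  have \<sigma>n: "(\<sigma> ^^ n) z \<in> K" if "z \<in> K" for n z
    by (induction n) (use that \<sigma> in auto)
  define twists where "twists u \<longleftrightarrow> u \<in> carrier R \<and> u \<noteq> \<zero> \<and> (\<forall>z\<in>K. u \<otimes> z = \<sigma> z \<otimes> u)" for u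
  have twistsD: "u \<in> carrier R" "u \<noteq> \<zero>" if "twists u" for u using that by (auto simp: twists_def)
  have twists_x: "twists x" using x(1) x0 \<sigma> by (simp add: twists_def)
  have twists_mult: "twists (c \<otimes> x)" if c: "c \<in> K" "c \<noteq> \<zero>" for c
    unfolding twists_def
  proof (intro conjI ballI)
    fix z assume z: "z \<in> K"
    have "c \<otimes> x \<otimes> z = c \<otimes> \<sigma> z \<otimes> x"
      using selfcentral_mem c z x(1) \<sigma>[OF z] by (simp add: m_assoc)
    also have "\<dots> = \<sigma> z \<otimes> c \<otimes> x" by (subst selfcentral_comm[OF c(1) \<sigma>(1)[OF z]]) (rule refl)
    finally show "c \<otimes> x \<otimes> z = \<sigma> z \<otimes> (c \<otimes> x)" using selfcentral_mem c z x(1) \<sigma>[OF z] by (simp add: m_assoc)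
  qed (use selfcentral_mem c x(1) x0 nonzero_mult in auto)
  have twists_pow: "u [^] n \<otimes> z = (\<sigma> ^^ n) z \<otimes> u [^] n" if u: "twists u" and z: "z \<in> K" for u z and n :: nat
    using z
  proof (induction n arbitrary: z)
    case (Suc n)
    have "u [^] Suc n \<otimes> z = u [^] n \<otimes> (u \<otimes> z)" using twistsD[OF u] selfcentral_mem Suc.prems by (simp add: m_assoc)
    also have "u \<otimes> z = \<sigma> z \<otimes> u" using u Suc.prems by (simp add: twists_def)
    also have "u [^] n \<otimes> (\<sigma> z \<otimes> u) = u [^] n \<otimes> \<sigma> z \<otimes> u"
      using twistsD[OF u] selfcentral_mem \<sigma>(1)[OF Suc.prems] by (simp add: m_assoc)
    also have "\<dots> = (\<sigma> ^^ Suc n) z \<otimes> u [^] n \<otimes> u"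
      by (subst Suc.IH) (use \<sigma>(1)[OF Suc.prems] in \<open>auto simp: funpow_swap1\<close>)
    finally show ?case using twistsD[OF u] selfcentral_mem \<sigma>n[OF Suc.prems, of "Suc n"] by (simp add: m_assoc)
  qed (use twistsD[OF u] selfcentral_mem in simp)

  define k where "k = (LEAST n::nat. n > 0 \<and> x [^] n \<in> K)"
  obtain n0 :: nat where "n0 > 0" "x [^] n0 = \<one>" using pow_eq_one[OF x(1) x0] by blast
  then have k: "k > 0 \<and> x [^] k \<in> K"
    unfolding k_def by (intro LeastI[of "\<lambda>n. n > 0 \<and> x [^] n \<in> K" n0]) (auto simp: selfcentral_closed)
  have k_least: "x [^] n \<notin> K" if "0 < n" "n < k" for n
    using not_less_Least[of n "\<lambda>n. n > 0 \<and> x [^] n \<in> K"] that k_def by auto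
  have \<sigma>k: "(\<sigma> ^^ k) z = z" if z: "z \<in> K" for z
  proof (rule mult_right_cancel[of "x [^] k"])
    have "(\<sigma> ^^ k) z \<otimes> x [^] k = x [^] k \<otimes> z" using twists_pow[OF twists_x z] by simp
    also have "\<dots> = z \<otimes> x [^] k" using selfcentral_comm z k by blast
    finally show "(\<sigma> ^^ k) z \<otimes> x [^] k = z \<otimes> x [^] k" .
  qed (use selfcentral_mem z \<sigma>n x(1) nonzero_pow[OF x(1) x0] in auto)

  define \<mu> where "\<mu> i = (\<sigma> ^^ i) a" for i
  have \<mu>K: "\<mu> i \<in> K" for i using \<sigma>n gen(2) by (simp add: \<mu>_def)
  \<comment> \<open>By minimality of \<open>k\<close>, no smaller power of \<open>x\<close> centralizes \<open>a\<close>, so the powers of \<open>\<sigma>\<close> are distinct.\<close>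
  have \<mu>_inj: "inj_on \<mu> {..<k}"
  proof (rule linorder_inj_onI)
    fix i j assume ij: "i < j" "i \<in> {..<k}" "j \<in> {..<k}"
    show "\<mu> i \<noteq> \<mu> j"
    proof
      assume eq: "\<mu> i = \<mu> j"
      have split: "x [^] j = x [^] i \<otimes> x [^] (j - i)" using nat_pow_mult[OF x(1), of i "j - i"] ij by simp
      have "x [^] i \<otimes> (x [^] (j - i) \<otimes> a) = x [^] j \<otimes> a" unfolding split using x(1) a by (simp add: m_assoc)
      also have "\<dots> = \<mu> i \<otimes> x [^] j" using twists_pow[OF twists_x gen(2), of j] eq by (simp add: \<mu>_def)
      also have "\<dots> = x [^] i \<otimes> a \<otimes> x [^] (j - i)"
        unfolding split using twists_pow[OF twists_x gen(2), of i] x(1) selfcentral_mem[OF \<mu>K] by (simp add: \<mu>_def m_assoc)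
      also have "\<dots> = x [^] i \<otimes> (a \<otimes> x [^] (j - i))" using x(1) a by (simp add: m_assoc)
      finally have "x [^] i \<otimes> (x [^] (j - i) \<otimes> a) = x [^] i \<otimes> (a \<otimes> x [^] (j - i))" .
      from mult_left_cancel[OF _ _ _ _ this] have "x [^] (j - i) \<otimes> a = a \<otimes> x [^] (j - i)"
        using x(1) a nonzero_pow[OF x(1) x0] by simp
      then have "x [^] (j - i) \<in> K"
        by (intro centralizer_generator[OF gen(1,2)]) (use x(1) in auto)
      with k_least[of "j - i"] ij show False by (auto intro: less_imp_diff_less)
    qed
  qed auto
  have independent: "\<exists>j::nat. (\<Oplus>i\<in>{..<k}. \<mu> i [^] j \<otimes> u i) \<noteq> \<zero>"
    if u: "\<And>i. u i \<in> carrier R" "u 0 \<noteq> \<zero>" for u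
  proof (rule ccontr)
    assume "\<not> ?thesis"
    then have "u 0 = \<zero>"
      by (intro vandermonde_independent[of k \<mu> u]) (use u \<mu>K selfcentral_mem selfcentral_comm \<mu>_inj k in auto)
    with u show False by simp
  qed
  have \<mu>_pow: "u [^] i \<otimes> a [^] (j::nat) = \<mu> i [^] j \<otimes> u [^] i" if u: "twists u" for u and i :: nat and j
  proof (induction j)
    case (Suc j)
    have "u [^] i \<otimes> a [^] Suc j = u [^] i \<otimes> a [^] j \<otimes> a" using twistsD[OF u] a by (simp add: m_assoc)
    also have "\<dots> = \<mu> i [^] j \<otimes> (u [^] i \<otimes> a)" unfolding Suc using twistsD[OF u] a selfcentral_mem[OF \<mu>K] by (simp add: m_assoc)
    also have "\<dots> = \<mu> i [^] j \<otimes> (\<mu> i \<otimes> u [^] i)" using twists_pow[OF u gen(2)] by (simp add: \<mu>_def)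
    also have "\<dots> = \<mu> i [^] Suc j \<otimes> u [^] i" using twistsD[OF u] selfcentral_mem[OF \<mu>K] by (simp add: m_assoc)
    finally show ?case .
  qed (use twistsD[OF u] in simp)

  define F where "F = {f \<in> K - {\<zero>}. f \<otimes> x = x \<otimes> f}"
  define \<nu> where "\<nu> c = (c \<otimes> x) [^] k" for c
  have finK: "finite K" using finite_carrier selfcentral_mem by (meson finite_subset subsetI)
  have powK: "u [^] k \<in> K" if u: "twists u" for u
  proof (subst selfcentral_iff, intro conjI ballI)
    fix z assume "z \<in> K"
    then show "z \<otimes> u [^] k = u [^] k \<otimes> z" using twists_pow[OF u] \<sigma>k by simp
  qed (use twistsD[OF u] in simp)
  have \<nu>F: "\<nu> c \<in> F" if c: "c \<in> K - {\<zero>}" for c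
  proof -
    define u where "u = c \<otimes> x"
    have u: "twists u" using twists_mult c by (simp add: u_def)
    note uK = powK[OF u]
    have "c \<otimes> (u [^] k \<otimes> x) = c \<otimes> u [^] k \<otimes> x" using selfcentral_mem c x(1) twistsD[OF u] by (simp add: m_assoc)
    also have "\<dots> = u [^] k \<otimes> c \<otimes> x" using selfcentral_comm[OF _ uK, of c] c by simp
    also have "\<dots> = u [^] k \<otimes> u" unfolding u_def using selfcentral_mem c x(1) by (simp add: m_assoc)
    also have "\<dots> = u \<otimes> u [^] k" using commutes_pow[of u u] twistsD[OF u] by simp
    also have "\<dots> = c \<otimes> (x \<otimes> u [^] k)" using selfcentral_mem c x(1) twistsD[OF u] by (simp add: u_def m_assoc)
    finally have "c \<otimes> (u [^] k \<otimes> x) = c \<otimes> (x \<otimes> u [^] k)" .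
    from mult_left_cancel[OF _ _ _ _ this] have "u [^] k \<otimes> x = x \<otimes> u [^] k"
      using selfcentral_mem c x(1) twistsD[OF u] by auto
    then show ?thesis unfolding F_def \<nu>_def u_def[symmetric] using uK nonzero_pow twistsD[OF u] by simp
  qed
  have hilbert90: "\<exists>b\<in>K-{\<zero>}. c' \<otimes> x \<otimes> b = b \<otimes> (c \<otimes> x)"
    if c: "c \<in> K - {\<zero>}" "c' \<in> K - {\<zero>}" and eq: "\<nu> c = \<nu> c'" for c c'
  proof -
    define u v where "u = c \<otimes> x" and "v = c' \<otimes> x"
    have twists: "twists u" "twists v" using twists_mult c by (auto simp: u_def v_def)
    note uc = twistsD[OF twists(1)] twistsD[OF twists(2)]
    have uv: "v [^] k = u [^] k" using eq by (simp add: \<nu>_def u_def v_def)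
    obtain j :: nat where j: "(\<Oplus>i\<in>{..<k}. \<mu> i [^] j \<otimes> (v [^] i \<otimes> u [^] (k - i))) \<noteq> \<zero>"
      using independent[of "\<lambda>i. v [^] i \<otimes> u [^] (k - i)"] uc nonzero_pow by auto
    define z where "z = a [^] j"
    have z: "z \<in> K" using selfcentral_pow gen(2) by (simp add: z_def)
    \<comment> \<open>The sum intertwines \<open>u\<close> and \<open>v\<close> because \<open>u\<^sup>k = v\<^sup>k\<close>; independence provides a \<open>z\<close> for which it does not vanish.\<close>
    define b where "b = (\<Oplus>i\<in>{..<k}. v [^] i \<otimes> z \<otimes> u [^] (k - i))"
    have summand: "v [^] i \<otimes> z \<otimes> u [^] (k - i) \<in> carrier R" for i using uc selfcentral_mem[OF z] by simp
    have "b = (\<Oplus>i\<in>{..<k}. \<mu> i [^] j \<otimes> (v [^] i \<otimes> u [^] (k - i)))"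
      unfolding b_def
    proof (rule finsum_cong')
      fix i
      show "v [^] i \<otimes> z \<otimes> u [^] (k - i) = \<mu> i [^] j \<otimes> (v [^] i \<otimes> u [^] (k - i))"
        unfolding z_def \<mu>_pow[OF twists(2)] using uc selfcentral_mem[OF \<mu>K] by (simp add: m_assoc)
    qed (use uc selfcentral_mem[OF \<mu>K] in auto)
    with j have b0: "b \<noteq> \<zero>" by simp
    have bc: "b \<in> carrier R" unfolding b_def using summand by (intro finsum_closed) auto
    have "b \<in> K"
    proof (subst selfcentral_iff, intro conjI ballI bc)
      fix y assume y: "y \<in> K"
      have "y \<otimes> (v [^] i \<otimes> z \<otimes> u [^] (k - i)) = v [^] i \<otimes> z \<otimes> u [^] (k - i) \<otimes> y" if "i < k" for i
      proof -
        have "v [^] i \<otimes> z \<otimes> u [^] (k - i) \<otimes> y = v [^] i \<otimes> z \<otimes> (u [^] (k - i) \<otimes> y)"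
          using uc selfcentral_mem y z by (simp add: m_assoc)
        also have "\<dots> = v [^] i \<otimes> (z \<otimes> (\<sigma> ^^ (k - i)) y) \<otimes> u [^] (k - i)"
          unfolding twists_pow[OF twists(1) y] using uc selfcentral_mem z \<sigma>n[OF y] by (simp add: m_assoc)
        also have "\<dots> = v [^] i \<otimes> ((\<sigma> ^^ (k - i)) y \<otimes> z) \<otimes> u [^] (k - i)"
          by (subst selfcentral_comm[OF z \<sigma>n[OF y]]) (rule refl)
        also have "\<dots> = (v [^] i \<otimes> (\<sigma> ^^ (k - i)) y) \<otimes> z \<otimes> u [^] (k - i)"
          using uc selfcentral_mem z \<sigma>n[OF y] by (simp add: m_assoc)
        also have "v [^] i \<otimes> (\<sigma> ^^ (k - i)) y = (\<sigma> ^^ k) y \<otimes> v [^] i"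
          unfolding twists_pow[OF twists(2) \<sigma>n[OF y]] using that by (simp add: funpow_add[symmetric, THEN fun_cong, unfolded comp_def])
        finally show ?thesis using uc selfcentral_mem y z by (simp add: \<sigma>k[OF y] m_assoc)
      qed
      then have "(\<Oplus>i\<in>{..<k}. y \<otimes> (v [^] i \<otimes> z \<otimes> u [^] (k - i)))
          = (\<Oplus>i\<in>{..<k}. v [^] i \<otimes> z \<otimes> u [^] (k - i) \<otimes> y)"
        by (intro finsum_cong') (use summand selfcentral_mem[OF y] in auto)
      then show "y \<otimes> b = b \<otimes> y"
        unfolding b_def using summand selfcentral_mem[OF y] by (simp add: finsum_ldistr finsum_rdistr Pi_def)
    qed
    moreover have "v \<otimes> b = b \<otimes> u"
    proof -
      define g where "g i = v [^] i \<otimes> z \<otimes> u [^] (Suc k - i)" for i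
      have gc: "g i \<in> carrier R" for i using uc selfcentral_mem[OF z] by (simp add: g_def)
      have "v \<otimes> b = (\<Oplus>i\<in>{..<k}. g (Suc i))"
        unfolding b_def g_def nat_pow_Suc2[OF uc(3)]
        using uc selfcentral_mem[OF z] by (simp add: finsum_rdistr m_assoc Pi_def)
      also have "\<dots> = (\<Oplus>i\<in>{..<k}. g i)"
      proof (rule finsum_shift[OF gc])
        have "g k = u [^] k \<otimes> z \<otimes> u" using uc by (simp add: g_def uv)
        also have "u [^] k \<otimes> z = z \<otimes> u [^] k" using selfcentral_comm[OF powK[OF twists(1)] z] .
        finally show "g k = g 0" using uc selfcentral_mem[OF z] by (simp add: g_def m_assoc)
      qed
      also have "\<dots> = (\<Oplus>i\<in>{..<k}. v [^] i \<otimes> z \<otimes> u [^] (k - i) \<otimes> u)"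
        by (rule finsum_cong') (use uc selfcentral_mem[OF z] in \<open>auto simp: g_def Suc_diff_le m_assoc\<close>)
      also have "\<dots> = b \<otimes> u"
        unfolding b_def using uc summand by (simp add: finsum_ldistr Pi_def)
      finally show ?thesis .
    qed
    ultimately show ?thesis using b0 unfolding u_def v_def by auto
  qed
  have FK: "F \<subseteq> K - {\<zero>}" by (auto simp: F_def)
  have fiber: "card {c \<in> K - {\<zero>}. \<nu> c = \<gamma>} * card F \<le> card (K - {\<zero>})" for \<gamma>
  proof (cases "{c \<in> K - {\<zero>}. \<nu> c = \<gamma>} = {}")
    case False
    then obtain c where c: "c \<in> K - {\<zero>}" "\<nu> c = \<gamma>" by auto
    \<comment> \<open>All elements of the fibre have this form, and \<open>g\<close> is constant on the cosets of \<open>F\<close>.\<close>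
    define g where "g b = b \<otimes> (c \<otimes> x) \<otimes> inv b \<otimes> inv x" for b
    have inv: "inv b \<in> K" "b \<otimes> inv b = \<one>" "inv b \<otimes> b = \<one>" if "b \<in> K - {\<zero>}" for b
      using that selfcentral_inv nonzero_inv selfcentral_mem by auto
    note ix = nonzero_inv[OF x(1) x0]
    have "{c \<in> K - {\<zero>}. \<nu> c = \<gamma>} \<subseteq> g ` (K - {\<zero>})"
    proof
      fix c' assume c': "c' \<in> {c \<in> K - {\<zero>}. \<nu> c = \<gamma>}"
      then obtain b where b: "b \<in> K - {\<zero>}" "c' \<otimes> x \<otimes> b = b \<otimes> (c \<otimes> x)"
        using hilbert90[of c c'] c by auto
      have "g b = c' \<otimes> x \<otimes> b \<otimes> inv b \<otimes> inv x" by (simp add: g_def b(2))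
      also have "\<dots> = c'" using c' b(1) selfcentral_mem inv[OF b(1)] x(1) ix by (simp add: m_assoc)
      finally show "c' \<in> g ` (K - {\<zero>})" using b(1) by auto
    qed
    then have "card {c \<in> K - {\<zero>}. \<nu> c = \<gamma>} * card F \<le> card (g ` (K - {\<zero>})) * card F"
      using finK by (intro mult_right_mono card_mono) auto
    also have "\<dots> = (\<Sum>y\<in>g ` (K - {\<zero>}). card F)" by simp
    also have "\<dots> \<le> (\<Sum>y\<in>g ` (K - {\<zero>}). card {b \<in> K - {\<zero>}. g b = y})"
    proof (rule sum_mono)
      fix y assume "y \<in> g ` (K - {\<zero>})"
      then obtain b where b: "b \<in> K - {\<zero>}" "y = g b" by auto
      have "(\<lambda>f. b \<otimes> f) ` F \<subseteq> {b \<in> K - {\<zero>}. g b = y}"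
      proof clarify
        fix f assume f: "f \<in> F"
        then have fK: "f \<in> K" "f \<noteq> \<zero>" and fx: "f \<otimes> x = x \<otimes> f" by (auto simp: F_def)
        have bf: "b \<otimes> f \<in> K - {\<zero>}" using b(1) fK selfcentral_closed(3) nonzero_mult selfcentral_mem by auto
        have "b \<otimes> (c \<otimes> x) \<otimes> inv b \<otimes> (b \<otimes> f) = b \<otimes> (c \<otimes> x) \<otimes> (inv b \<otimes> b) \<otimes> f"
          using b(1) c fK selfcentral_mem inv(1)[OF b(1)] x(1) by (simp add: m_assoc)
        also have "\<dots> = b \<otimes> c \<otimes> (x \<otimes> f)"
          using b(1) c fK selfcentral_mem inv(3)[OF b(1)] x(1) by (simp add: m_assoc)
        also have "\<dots> = b \<otimes> (c \<otimes> f) \<otimes> x"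
          unfolding fx[symmetric] using b(1) c fK selfcentral_mem x(1) by (simp add: m_assoc)
        also have "c \<otimes> f = f \<otimes> c" using selfcentral_comm c fK by blast
        also have "b \<otimes> (f \<otimes> c) \<otimes> x = b \<otimes> f \<otimes> (c \<otimes> x)"
          using b(1) c fK selfcentral_mem x(1) by (simp add: m_assoc)
        finally have 1: "b \<otimes> (c \<otimes> x) \<otimes> inv b \<otimes> (b \<otimes> f) = b \<otimes> f \<otimes> (c \<otimes> x)" .
        have "g (b \<otimes> f) = b \<otimes> (c \<otimes> x) \<otimes> inv b \<otimes> (b \<otimes> f) \<otimes> inv (b \<otimes> f) \<otimes> inv x"
          by (simp only: g_def 1)
        also have "\<dots> = b \<otimes> (c \<otimes> x) \<otimes> inv b \<otimes> ((b \<otimes> f) \<otimes> inv (b \<otimes> f)) \<otimes> inv x"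
          using selfcentral_mem[OF inv(1)[OF bf]] selfcentral_mem[OF inv(1)[OF b(1)]] b(1) c fK selfcentral_mem x(1) ix(1)
          by (simp add: m_assoc)
        also have "\<dots> = g b" unfolding inv(2)[OF bf]
          using selfcentral_mem[OF inv(1)[OF b(1)]] b(1) c selfcentral_mem x(1) ix(1) by (simp add: g_def)
        finally show "b \<otimes> f \<in> K - {\<zero>} \<and> g (b \<otimes> f) = y" using bf b(2) by simp
      qed
      moreover have "inj_on (\<lambda>f. b \<otimes> f) F"
        by (rule inj_onI, rule mult_left_cancel[of b]) (use b FK selfcentral_mem in auto)
      ultimately show "card F \<le> card {b \<in> K - {\<zero>}. g b = y}"
        using finK by (intro card_inj_on_le[of "\<lambda>f. b \<otimes> f"]) auto
    qed
    also have "\<dots> = card (K - {\<zero>})"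
      using sum.image_gen[of "K - {\<zero>}" "\<lambda>_. 1::nat" g] finK by simp
    finally show ?thesis .
  next
    case True
    show ?thesis unfolding True by simp
  qed
  have "card (K - {\<zero>}) * card F = (\<Sum>\<gamma>\<in>\<nu> ` (K - {\<zero>}). card {c \<in> K - {\<zero>}. \<nu> c = \<gamma>} * card F)"
    using sum.image_gen[of "K - {\<zero>}" "\<lambda>_. 1::nat" \<nu>] finK by (simp add: sum_distrib_right)
  also have "\<dots> \<le> (\<Sum>\<gamma>\<in>\<nu> ` (K - {\<zero>}). card (K - {\<zero>}))" by (rule sum_mono) (rule fiber)
  also have "\<dots> = card (K - {\<zero>}) * card (\<nu> ` (K - {\<zero>}))" by simp
  finally have "card F \<le> card (\<nu> ` (K - {\<zero>}))"
    using gen(2,3) finK by (auto simp: card_gt_0_iff)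
  moreover have "\<nu> ` (K - {\<zero>}) \<subseteq> F" using \<nu>F by auto
  moreover have "finite F" using FK finK by (meson finite_Diff finite_subset)
  ultimately have "\<nu> ` (K - {\<zero>}) = F" by (metis card_seteq)
  moreover have "\<one> \<in> F" using x(1) one_nonzero by (simp add: F_def selfcentral_closed)
  ultimately obtain c where c: "c \<in> K - {\<zero>}" "\<nu> c = \<one>" by (metis imageE)
  define u where "u = c \<otimes> x"
  have u: "twists u" using twists_mult c by (simp add: u_def)
  note uc = twistsD[OF u]
  have uk: "u [^] k = \<one>" using c(2) by (simp add: \<nu>_def u_def)
  define S where "S = (\<Oplus>i\<in>{..<k}. u [^] i)"
  have Sc: "S \<in> carrier R" using uc by (auto simp: S_def intro!: finsum_closed)
  obtain j :: nat where j: "(\<Oplus>i\<in>{..<k}. \<mu> i [^] j \<otimes> u [^] i) \<noteq> \<zero>"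
    using independent[of "\<lambda>i. u [^] i"] uc one_nonzero by auto
  have "S \<otimes> a [^] j = (\<Oplus>i\<in>{..<k}. \<mu> i [^] j \<otimes> u [^] i)"
    unfolding S_def \<mu>_pow[OF u, symmetric] using uc a by (simp add: finsum_ldistr)
  with j have S0: "S \<noteq> \<zero>" using a by auto
  have "u \<otimes> S = (\<Oplus>i\<in>{..<k}. u [^] Suc i)"
    unfolding S_def nat_pow_Suc2[OF uc(1)] using uc by (simp add: finsum_rdistr)
  also have "\<dots> = S" unfolding S_def using uc uk by (intro finsum_shift) auto
  finally have "u \<otimes> S = \<one> \<otimes> S" using Sc by simp
  from mult_right_cancel[OF Sc S0 _ _ this] have "c \<otimes> x = \<one>" using uc by (simp add: u_def)
  then have "inv c \<otimes> (c \<otimes> x) = inv c \<otimes> \<one>" by simp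
  then have "x = inv c" using cancel_inv[of c x] c(1) selfcentral_mem x(1) nonzero_inv[of c] by simp
  with x(2) selfcentral_inv[of c] c(1) show False by simp
qed

end

text \<open>A maximal subfield that is not the whole ring would be normalized by an element outside it,
  and this is impossible.\<close>

theorem wedderburn:
  assumes "x \<in> carrier R" "y \<in> carrier R"
  shows "x \<otimes> y = y \<otimes> x"
proof -
  obtain K where K: "selfcentral K" using ex_selfcentral by blast
  obtain a where a: "a \<in> K" "a \<noteq> \<zero>" "K = insert \<zero> (range (\<lambda>i::nat. a [^] i))"
    using selfcentral_generator[OF K] by blast
  have "z \<in> K" if "z \<in> carrier R" for z
  proof (rule ccontr)
    assume "z \<notin> K"
    then obtain w s where "w \<in> carrier R" "w \<notin> K" "w \<otimes> a = a [^] (s::nat) \<otimes> w"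
      using ex_skew_normalizer[OF K a(3,1,2) \<open>z \<in> carrier R\<close>] by metis
    then show False by (rule no_skew_normalizer[OF K a(3,1,2)])
  qed
  with assms show ?thesis by (intro selfcentral_comm[OF K])
qed

end

section \<open>Cyclic factors and normal series\<close>

text \<open>Subgroups of cyclic groups are cyclic, stated for embeddings: the least positive exponent that
  occurs in the image divides all the others.\<close>

lemma cyclic_group_injective:
  assumes "group G" "group Q" "\<theta> \<in> hom G Q" "inj_on \<theta> (carrier G)" "cyclic_group Q"
  shows "cyclic_group G"
proof -
  interpret G: group G by fact
  interpret Q: group Q by fact
  interpret \<theta>: group_hom G Q \<theta> by unfold_locales fact
  obtain g where g: "g \<in> carrier Q" "carrier Q = range (\<lambda>i::int. g [^]\<^bsub>Q\<^esub> i)"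
    using assms(5) Q.cyclic_group by auto
  have pow: "\<exists>i::int. \<theta> x = g [^]\<^bsub>Q\<^esub> i" if "x \<in> carrier G" for x
    using \<theta>.hom_closed[OF that] g(2) by auto
  have inj1: "x = \<one>\<^bsub>G\<^esub>" if "x \<in> carrier G" "\<theta> x = \<one>\<^bsub>Q\<^esub>" for x
    using inj_onD[OF assms(4), of x "\<one>\<^bsub>G\<^esub>"] that by simp
  define P where "P m \<longleftrightarrow> m > 0 \<and> (\<exists>x\<in>carrier G. \<theta> x = g [^]\<^bsub>Q\<^esub> int m)" for m
  show ?thesis
  proof (cases "\<exists>m. P m")
    case False
    have "x = \<one>\<^bsub>G\<^esub>" if x: "x \<in> carrier G" for x
    proof -
      obtain i :: int where i: "\<theta> x = g [^]\<^bsub>Q\<^esub> i" using pow[OF x] by blast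
      have "\<not> P (nat i)" "\<not> P (nat (- i))" using False by auto
      have "\<theta> (inv\<^bsub>G\<^esub> x) = g [^]\<^bsub>Q\<^esub> (- i)" using x g(1) i by (simp add: Q.int_pow_neg)
      then have "\<not> 0 < - i" using \<open>\<not> P (nat (- i))\<close> G.inv_closed[OF x] unfolding P_def by (metis int_nat_eq order.strict_implies_order zero_less_nat_eq)
      moreover have "\<not> 0 < i" using \<open>\<not> P (nat i)\<close> x i unfolding P_def by (metis int_nat_eq order.strict_implies_order zero_less_nat_eq)
      ultimately have "i = 0" by simp
      with i inj1[OF x] show ?thesis by simp
    qed
    then have "carrier G = {\<one>\<^bsub>G\<^esub>}" by auto
    then show ?thesis using trivial_imp_cyclic_group G.is_group by (auto simp: trivial_group_def)
  next
    case True
    define m where "m = (LEAST m. P m)"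
    have "P m" unfolding m_def using True by (rule LeastI_ex)
    then obtain x0 where x0: "m > 0" "x0 \<in> carrier G" "\<theta> x0 = g [^]\<^bsub>Q\<^esub> int m" by (auto simp: P_def)
    have "x \<in> range (\<lambda>i::int. x0 [^]\<^bsub>G\<^esub> i)" if x: "x \<in> carrier G" for x
    proof -
      obtain i :: int where i: "\<theta> x = g [^]\<^bsub>Q\<^esub> i" using pow[OF x] by blast
      define q r where "q = i div int m" and "r = i mod int m"
      have r: "0 \<le> r" "r < int m" "i = int m * q + r" using x0(1) by (simp_all add: q_def r_def)
      define y where "y = x0 [^]\<^bsub>G\<^esub> (- q) \<otimes>\<^bsub>G\<^esub> x"
      have y: "y \<in> carrier G" "x = x0 [^]\<^bsub>G\<^esub> q \<otimes>\<^bsub>G\<^esub> y"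
        using x x0(2) by (auto simp: y_def G.int_pow_neg G.m_assoc[symmetric])
      have "\<theta> y = (g [^]\<^bsub>Q\<^esub> int m) [^]\<^bsub>Q\<^esub> (- q) \<otimes>\<^bsub>Q\<^esub> g [^]\<^bsub>Q\<^esub> i"
        using x x0 i by (simp add: y_def \<theta>.hom_int_pow)
      also have "\<dots> = g [^]\<^bsub>Q\<^esub> r"
        unfolding Q.int_pow_pow[OF g(1)] Q.int_pow_mult[OF g(1), symmetric] using r(3) by simp
      finally have yr: "\<theta> y = g [^]\<^bsub>Q\<^esub> r" .
      have "\<not> P (nat r)" using not_less_Least[of "nat r" P] r x0(1) by (auto simp: m_def)
      then have "r = 0" using y(1) yr r(1) by (auto simp: P_def)
      then have "y = \<one>\<^bsub>G\<^esub>" using inj1[OF y(1)] yr by simp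
      then have "x = x0 [^]\<^bsub>G\<^esub> q" using y(2) x0(2) by simp
      then show ?thesis by blast
    qed
    then show ?thesis unfolding G.cyclic_group using x0(2) by (intro bexI[OF _ x0(2)]) auto
  qed
qed

lemma cyclic_factor_group:
  assumes "N \<lhd> S" "g \<in> carrier S" "\<And>x. x \<in> carrier S \<Longrightarrow> \<exists>a\<in>N. \<exists>i::int. x = a \<otimes>\<^bsub>S\<^esub> g [^]\<^bsub>S\<^esub> i"
  shows "cyclic_group (S Mod N)"
proof -
  interpret N: normal N S by fact
  interpret Q: group "S Mod N" by (rule N.factorgroup_is_group)
  interpret Z: group integer_group by (rule group_integer_group)
  define f where "f i = N #>\<^bsub>S\<^esub> (g [^]\<^bsub>S\<^esub> i)" for i :: int
  have "f \<in> epi integer_group (S Mod N)"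
    unfolding epi_def
  proof (intro CollectI conjI)
    show "f \<in> hom integer_group (S Mod N)"
      using assms(2) by (auto simp: hom_def f_def FactGroup_def N.rcos_sum N.int_pow_mult RCOSETS_def)
    show "f ` carrier integer_group = carrier (S Mod N)"
    proof
      show "f ` carrier integer_group \<subseteq> carrier (S Mod N)"
        using assms(2) by (auto simp: f_def FactGroup_def RCOSETS_def)
      show "carrier (S Mod N) \<subseteq> f ` carrier integer_group"
      proof
        fix C assume "C \<in> carrier (S Mod N)"
        then obtain x where x: "x \<in> carrier S" "C = N #>\<^bsub>S\<^esub> x" by (auto simp: FactGroup_def RCOSETS_def)
        then obtain a and i :: int where ai: "a \<in> N" "x = a \<otimes>\<^bsub>S\<^esub> g [^]\<^bsub>S\<^esub> i" using assms(3) by blast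
        have "x \<in> N #>\<^bsub>S\<^esub> (g [^]\<^bsub>S\<^esub> i)" using ai by (auto simp: r_coset_def)
        then have "f i = C"
          unfolding f_def x(2) using assms(2) by (intro N.repr_independence) (auto simp: N.is_subgroup)
        then show "C \<in> f ` carrier integer_group" by auto
      qed
    qed
  qed
  then show ?thesis
    by (rule Z.cyclic_group_epimorphic_image[OF _ cyclic_integer_group Q.is_group])
qed

text \<open>Greedy construction of the series, along any property \<open>P\<close> of normal subgroups that can always be
  continued by a cyclic factor.\<close>

lemma supersolvableI:
  assumes fin: "finite (carrier G)" and one: "P {\<one>\<^bsub>G\<^esub>}"
    and normal: "\<And>N. P N \<Longrightarrow> N \<lhd> G"
    and step: "\<And>N. P N \<Longrightarrow> N \<noteq> carrier G \<Longrightarrow>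
      \<exists>N'. P N' \<and> N \<subset> N' \<and> cyclic_group (G\<lparr>carrier := N'\<rparr> Mod N)"
  shows "supersolvable G"
proof -
  have sub: "N \<subseteq> carrier G" if "P N" for N
    using normal[OF that] by (simp add: normal_def subgroup.subset)
  have "\<exists>(k::nat) M. M 0 = N \<and> M k = carrier G \<and> (\<forall>i\<le>k. P (M i)) \<and>
      (\<forall>i<k. M i \<subseteq> M (Suc i) \<and> cyclic_group (G\<lparr>carrier := M (Suc i)\<rparr> Mod M i))" if "P N" for N
    using that
  proof (induction "card (carrier G) - card N" arbitrary: N rule: less_induct)
    case less
    show ?case
    proof (cases "N = carrier G")
      case True
      show ?thesis
        by (rule exI[of _ 0], rule exI[of _ "\<lambda>_. N"]) (use less.prems True in simp)
    next
      case False
      then obtain N' where N': "P N'" "N \<subset> N'" "cyclic_group (G\<lparr>carrier := N'\<rparr> Mod N)"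
        using step less.prems by blast
      have "card N < card N'" "card N' \<le> card (carrier G)"
        using N' sub[OF N'(1)] fin by (auto intro: psubset_card_mono card_mono finite_subset)
      then obtain k :: nat and M where M: "M 0 = N'" "M k = carrier G" "\<forall>i\<le>k. P (M i)"
        "\<forall>i<k. M i \<subseteq> M (Suc i) \<and> cyclic_group (G\<lparr>carrier := M (Suc i)\<rparr> Mod M i)"
        using less.hyps[OF _ N'(1)] by (metis diff_less_mono2 less_le_trans)
      show ?thesis
        by (rule exI[of _ "Suc k"], rule exI[of _ "case_nat N M"])
          (use M N' less.prems in \<open>auto split: nat.split simp: less_Suc_eq_0_disj\<close>)
    qed
  qed
  from this[OF one] show ?thesis
    unfolding supersolvable_def using normal by blast
qed

section \<open>Subgroups of an elementary abelian group\<close>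

locale elementary_abelian = comm_group V for V (structure) +
  fixes p n :: nat
  assumes prime_p: "Factorial_Ring.prime p"
    and pow_p: "v \<in> carrier V \<Longrightarrow> v [^] p = \<one>"
    and order_V: "order V = p ^ n"
begin

lemma p_gt_1: "p > 1" using prime_p by (rule prime_gt_1_nat)

lemma finite_V: "finite (carrier V)"
  using order_V p_gt_1 by (metis card.infinite not_one_less_zero order_def power_not_zero)

lemma sub_mem: "subgroup A V \<Longrightarrow> x \<in> A \<Longrightarrow> x \<in> carrier V"
  by (rule subgroup.mem_carrier)

lemma sub_finite: "subgroup A V \<Longrightarrow> finite A"
  using finite_V finite_subset subgroup.subset by metis

lemma subgroup_card:
  assumes "subgroup A V" obtains k where "k \<le> n" "card A = p ^ k"
proof -
  have "card A dvd p ^ n" using lagrange[OF assms] order_V by (metis dvd_triv_right)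
  with that show ?thesis using divides_primepow_nat[OF prime_p] by auto
qed

lemma set_mult_iff: "x \<in> A <#> B \<longleftrightarrow> (\<exists>a\<in>A. \<exists>b\<in>B. x = a \<otimes> b)"
  by (auto simp: set_mult_def)

lemma set_mult_upper:
  assumes "subgroup A V" "subgroup B V"
  shows "A \<subseteq> A <#> B" "B \<subseteq> A <#> B"
proof -
  show "A \<subseteq> A <#> B"
    using assms subgroup.one_closed[OF assms(2)] by (force simp: set_mult_iff dest: sub_mem)
  show "B \<subseteq> A <#> B"
    using assms subgroup.one_closed[OF assms(1)] by (force simp: set_mult_iff dest: sub_mem)
qed

lemma set_mult_commute:
  assumes "subgroup A V" "subgroup B V" shows "A <#> B = B <#> A"
proof -
  have "a \<otimes> b = b \<otimes> a" if "a \<in> A" "b \<in> B" for a b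
    using that sub_mem[OF assms(1)] sub_mem[OF assms(2)] by (simp add: m_comm)
  then show ?thesis unfolding set_eq_iff set_mult_iff by metis
qed

lemma set_mult_least:
  assumes "subgroup C V" "A \<subseteq> C" "B \<subseteq> C" shows "A <#> B \<subseteq> C"
  using assms by (auto simp: set_mult_iff intro!: subgroup.m_closed)

lemma disjointD:
  assumes "A \<inter> B = {\<one>}" "x \<in> A" "x \<in> B" shows "x = \<one>"
  using assms by blast

lemma disjointI:
  assumes "subgroup A V" "subgroup B V" "\<And>x. x \<in> A \<Longrightarrow> x \<in> B \<Longrightarrow> x = \<one>"
  shows "A \<inter> B = {\<one>}"
  using assms subgroup.one_closed by blast

text \<open>Factorizations along independent subgroups are unique. Most of what follows treats \<open>V\<close> as a
  vector space in multiplicative notation: \<open>A \<inter> B = {\<one>}\<close> says that the sum \<open>A <#> B\<close> is direct.\<close>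

lemma disjoint_unique:
  assumes "subgroup A V" "subgroup B V" "A \<inter> B = {\<one>}"
    and "a \<in> A" "a' \<in> A" "b \<in> B" "b' \<in> B" "a \<otimes> b = a' \<otimes> b'"
  shows "a = a'" "b = b'"
proof -
  note c = sub_mem[OF assms(1,4)] sub_mem[OF assms(1,5)] sub_mem[OF assms(2,6)] sub_mem[OF assms(2,7)]
  have "inv a' \<otimes> a = inv a' \<otimes> (a \<otimes> b) \<otimes> inv b" using c by (simp add: m_assoc)
  also have "\<dots> = b' \<otimes> inv b" unfolding assms(8) using c by (simp add: m_assoc[symmetric])
  finally have eq: "inv a' \<otimes> a = b' \<otimes> inv b" .
  have "inv a' \<otimes> a \<in> A" "b' \<otimes> inv b \<in> B"
    using assms by (auto intro!: subgroup.m_closed subgroup.m_inv_closed)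
  with eq have "inv a' \<otimes> a = \<one>" using disjointD[OF assms(3)] by simp
  moreover from this eq have "b' \<otimes> inv b = \<one>" by simp
  ultimately show "a = a'" "b = b'"
    using c by (metis inv_closed inv_equality inv_inv)+
qed

lemma card_set_mult:
  assumes "subgroup A V" "subgroup B V" "A \<inter> B = {\<one>}"
  shows "card (A <#> B) = card A * card B"
proof -
  have "bij_betw (\<lambda>(a, b). a \<otimes> b) (A \<times> B) (A <#> B)"
    unfolding bij_betw_def
  proof
    show "inj_on (\<lambda>(a, b). a \<otimes> b) (A \<times> B)"
      using disjoint_unique[OF assms] by (auto simp: inj_on_def)
  qed (auto simp: set_mult_def)
  from bij_betw_same_card[OF this] show ?thesis by (simp add: card_cartesian_product)
qed

lemma modular_law:
  assumes "subgroup A V" "subgroup B V" "subgroup C V" "A \<subseteq> C"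
  shows "(A <#> B) \<inter> C = A <#> (B \<inter> C)"
proof
  show "(A <#> B) \<inter> C \<subseteq> A <#> (B \<inter> C)"
  proof
    fix x assume "x \<in> (A <#> B) \<inter> C"
    then obtain a b where ab: "a \<in> A" "b \<in> B" "x = a \<otimes> b" "x \<in> C" by (auto simp: set_mult_iff)
    have "b = inv a \<otimes> x" using ab sub_mem assms by (simp add: m_assoc[symmetric])
    moreover have "inv a \<otimes> x \<in> C"
      using ab assms by (auto intro!: subgroup.m_closed subgroup.m_inv_closed)
    ultimately show "x \<in> A <#> (B \<inter> C)" using ab by (auto simp: set_mult_iff)
  qed
  show "A <#> (B \<inter> C) \<subseteq> (A <#> B) \<inter> C"
  proof
    fix x assume "x \<in> A <#> (B \<inter> C)"
    then obtain a b where "a \<in> A" "b \<in> B" "b \<in> C" "x = a \<otimes> b" by (auto simp: set_mult_iff)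
    moreover from this have "x \<in> C" using assms by (auto intro!: subgroup.m_closed)
    ultimately show "x \<in> (A <#> B) \<inter> C" by (auto simp: set_mult_iff)
  qed
qed

text \<open>The exchange step used with every maximal choice of a subgroup independent of \<open>B\<close>: such a
  choice \<open>A\<close> can be enlarged by any subgroup independent of the sum \<open>A <#> B\<close>.\<close>

lemma disjoint_extend:
  assumes "subgroup A V" "subgroup B V" "subgroup Y V"
    and "A \<inter> B = {\<one>}" "(A <#> B) \<inter> Y = {\<one>}"
  shows "(A <#> Y) \<inter> B = {\<one>}"
proof (rule disjointI)
  show "subgroup (A <#> Y) V" "subgroup B V" using assms mult_subgroups by auto
  fix y assume "y \<in> A <#> Y" "y \<in> B"
  then obtain a x where ax: "a \<in> A" "x \<in> Y" "y = a \<otimes> x" by (auto simp: set_mult_iff)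
  then have "x = inv a \<otimes> y" using sub_mem assms by (simp add: m_assoc[symmetric])
  moreover have "inv a \<in> A" using ax assms by (auto intro!: subgroup.m_inv_closed)
  ultimately have "x \<in> A <#> B" using \<open>y \<in> B\<close> by (auto simp: set_mult_iff)
  then have "x = \<one>" using disjointD[OF assms(5)] ax by blast
  then have "y \<in> A" using ax sub_mem assms by simp
  then show "y = \<one>" using disjointD[OF assms(4)] \<open>y \<in> B\<close> by blast
qed

lemma card_one_iff: "subgroup A V \<Longrightarrow> card A = 1 \<longleftrightarrow> A = {\<one>}"
  using subgroup.one_closed[of A V] by (auto simp: card_Suc_eq elim!: card_1_singletonE)

lemma sub_inter: "subgroup A V \<Longrightarrow> subgroup B V \<Longrightarrow> subgroup (A \<inter> B) V"
  by (rule subgroups_Inter_pair)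

lemma card_sub_dvd:
  assumes "subgroup A V" "subgroup B V" "A \<subseteq> B" shows "card A dvd card B"
proof -
  interpret B: group "V\<lparr>carrier := B\<rparr>" using assms(2) by (rule subgroup.subgroup_is_group) (rule is_group)
  have "subgroup A (V\<lparr>carrier := B\<rparr>)" using assms by (simp add: subgroup_incl)
  from B.lagrange[OF this, symmetric] show ?thesis by (simp add: order_def)
qed

lemma prime_subgroup_cases:
  assumes "subgroup A V" "subgroup Y V" "card Y = p"
  shows "A \<inter> Y = {\<one>} \<or> Y \<subseteq> A"
proof -
  have "card (A \<inter> Y) dvd p" using card_sub_dvd[OF sub_inter assms(2), of A Y] assms by auto
  then consider "card (A \<inter> Y) = 1" | "card (A \<inter> Y) = p" using prime_p by (auto simp: prime_nat_iff)
  then show ?thesis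
  proof cases
    case 1 then show ?thesis using card_one_iff[OF sub_inter] assms by blast
  next
    case 2
    then have "A \<inter> Y = Y" using assms sub_finite by (intro card_subset_eq) auto
    then show ?thesis by blast
  qed
qed

lemma cyclic_subgroup:
  assumes "x \<in> carrier V" "x \<noteq> \<one>"
  shows "subgroup (generate V {x}) V" "x \<in> generate V {x}" "card (generate V {x}) = p"
proof -
  show "subgroup (generate V {x}) V" using generate_is_subgroup assms by simp
  show "x \<in> generate V {x}" by (simp add: generate.incl)
  have "ord x dvd p" using pow_eq_id[OF assms(1)] pow_p[OF assms(1)] by simp
  moreover have "ord x \<noteq> 1" using assms ord_eq_1 by blast
  ultimately have "ord x = p" using prime_p by (auto simp: prime_nat_iff)
  then show "card (generate V {x}) = p" using generate_pow_card[OF assms(1)] by simp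
qed

lemma ex_subgroup_between:
  assumes "subgroup A V" "subgroup B V" "A \<subseteq> B" "card A = p ^ a" "card B = p ^ b" "a \<le> c" "c \<le> b"
  shows "\<exists>C. subgroup C V \<and> A \<subseteq> C \<and> C \<subseteq> B \<and> card C = p ^ c"
  using assms(6,1,3,4,7)
proof (induction c rule: dec_induct)
  case (step c)
  then obtain C where C: "subgroup C V" "A \<subseteq> C" "C \<subseteq> B" "card C = p ^ c" by auto
  have "card C < card B" using C(4) assms(5) step.prems p_gt_1 by (simp add: power_strict_increasing)
  then obtain x where x: "x \<in> B" "x \<notin> C" using C(3) by (metis card_mono leD sub_finite[OF C(1)] subsetI)
  have xV: "x \<in> carrier V" "x \<noteq> \<one>" using x assms(2) sub_mem subgroup.one_closed[OF C(1)] by auto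
  note Y = cyclic_subgroup[OF xV]
  have "C \<inter> generate V {x} = {\<one>}" using prime_subgroup_cases[OF C(1) Y(1,3)] Y(2) x by auto
  then have "card (C <#> generate V {x}) = p ^ Suc c"
    using card_set_mult[OF C(1) Y(1)] C(4) Y(3) by simp
  moreover have "generate V {x} \<subseteq> B" using generate_subgroup_incl[of "{x}" B] x assms(2) by simp
  ultimately show ?case
    using mult_subgroups[OF C(1) Y(1)] set_mult_least[OF assms(2) C(3)] set_mult_upper(1)[OF C(1) Y(1)] C(2)
    by blast
qed auto

lemma ex_subgroup_of_card:
  assumes "subgroup B V" "card B = p ^ b" "c \<le> b"
  shows "\<exists>C. subgroup C V \<and> C \<subseteq> B \<and> card C = p ^ c"
  using ex_subgroup_between[OF triv_subgroup assms(1), of 0 b c] assms subgroup.one_closed[OF assms(1)] by auto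

text \<open>The predicate \<open>P\<close> allows the maximum to be taken over all subgroups or over the submodules.\<close>

lemma ex_maximal_disjoint:
  assumes "subgroup A V" "P {\<one>}"
  obtains U where "subgroup U V" "P U" "U \<inter> A = {\<one>}"
    "\<And>U'. subgroup U' V \<Longrightarrow> P U' \<Longrightarrow> U' \<inter> A = {\<one>} \<Longrightarrow> U \<subseteq> U' \<Longrightarrow> U' = U"
proof -
  define \<U> where "\<U> = {U. subgroup U V \<and> P U \<and> U \<inter> A = {\<one>}}"
  have "finite \<U>"
    by (rule finite_subset[of _ "Pow (carrier V)"]) (auto simp: \<U>_def finite_V dest: sub_mem)
  moreover have "{\<one>} \<in> \<U>" using assms subgroup.one_closed[OF assms(1)] triv_subgroup by (auto simp: \<U>_def)
  ultimately obtain U where U: "U \<in> \<U>" "\<forall>U'\<in>\<U>. U \<subseteq> U' \<longrightarrow> U' = U"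
    using finite_has_maximal2[of \<U> "{\<one>}"] by auto
  show ?thesis by (rule that[of U]) (use U in \<open>auto simp: \<U>_def\<close>)
qed

lemma ex_complement:
  assumes "subgroup A V"
  obtains U where "subgroup U V" "U \<inter> A = {\<one>}" "U <#> A = carrier V"
proof -
  obtain U where U: "subgroup U V" "U \<inter> A = {\<one>}"
    "\<And>U'. subgroup U' V \<Longrightarrow> True \<Longrightarrow> U' \<inter> A = {\<one>} \<Longrightarrow> U \<subseteq> U' \<Longrightarrow> U' = U"
    by (rule ex_maximal_disjoint[OF assms, of "\<lambda>_. True"]) auto
  have UA: "subgroup (U <#> A) V" by (rule mult_subgroups[OF U(1) assms])
  have "x \<in> U <#> A" if x: "x \<in> carrier V" for x
  proof (rule ccontr)
    assume nx: "x \<notin> U <#> A"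
    then have "x \<noteq> \<one>" using subgroup.one_closed[OF UA] by auto
    note Y = cyclic_subgroup[OF x this]
    have "(U <#> A) \<inter> generate V {x} = {\<one>}" using prime_subgroup_cases[OF UA Y(1,3)] Y(2) nx by auto
    from disjoint_extend[OF U(1) assms Y(1) U(2) this]
    have "U <#> generate V {x} = U" using U(3) mult_subgroups[OF U(1) Y(1)] set_mult_upper(1)[OF U(1) Y(1)] by auto
    then have "x \<in> U" using set_mult_upper(2)[OF U(1) Y(1)] Y(2) by blast
    then show False using nx set_mult_upper(1)[OF U(1) assms] by blast
  qed
  with UA have "U <#> A = carrier V" by (auto dest: sub_mem)
  with U that show ?thesis by blast
qed

end

section \<open>Submodules under a coprime action\<close>

locale coprime_action = elementary_abelian V p n + H: group H
  for V (structure) and p n and H :: "('h, 'c) monoid_scheme" +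
  fixes act :: "'h \<Rightarrow> 'a \<Rightarrow> 'a"
  assumes finite_H: "finite (carrier H)" and coprime_H: "coprime (order H) p"
    and act_closed: "h \<in> carrier H \<Longrightarrow> v \<in> carrier V \<Longrightarrow> act h v \<in> carrier V"
    and act_mult: "h \<in> carrier H \<Longrightarrow> v \<in> carrier V \<Longrightarrow> w \<in> carrier V \<Longrightarrow>
      act h (v \<otimes> w) = act h v \<otimes> act h w"
    and act_comp: "h \<in> carrier H \<Longrightarrow> k \<in> carrier H \<Longrightarrow> v \<in> carrier V \<Longrightarrow>
      act (h \<otimes>\<^bsub>H\<^esub> k) v = act h (act k v)"
    and act_id: "v \<in> carrier V \<Longrightarrow> act \<one>\<^bsub>H\<^esub> v = v"
begin

definition invariant where
  "invariant U \<longleftrightarrow> subgroup U V \<and> (\<forall>h\<in>carrier H. \<forall>u\<in>U. act h u \<in> U)"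

definition irred where
  "irred W \<longleftrightarrow> invariant W \<and> W \<noteq> {\<one>} \<and> (\<forall>U. invariant U \<and> U \<subseteq> W \<longrightarrow> U = {\<one>} \<or> U = W)"

text \<open>The domain is an explicit set, so that a map can be restricted to smaller submodules without
  changing it.\<close>

definition equiv_hom where
  "equiv_hom f A B \<longleftrightarrow> f \<in> A \<rightarrow> B \<and> (\<forall>a\<in>A. \<forall>b\<in>A. f (a \<otimes> b) = f a \<otimes> f b) \<and>
     (\<forall>h\<in>carrier H. \<forall>a\<in>A. f (act h a) = act h (f a))"

definition isom where
  "isom A B \<longleftrightarrow> (\<exists>f. equiv_hom f A B \<and> bij_betw f A B)"

lemma act_one: "h \<in> carrier H \<Longrightarrow> act h \<one> = \<one>"
  using act_mult[of h \<one> \<one>] act_closed[of h \<one>] by (simp add: l_cancel_one')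

lemma act_inv:
  assumes "h \<in> carrier H" "v \<in> carrier V" shows "act h (inv v) = inv (act h v)"
proof -
  have "act h (inv v) \<otimes> act h v = \<one>" using assms by (simp add: act_mult[symmetric] act_one)
  then show ?thesis using assms by (intro inv_equality[symmetric]) (auto intro: act_closed)
qed

lemma invariant_subgroup: "invariant U \<Longrightarrow> subgroup U V" by (simp add: invariant_def)
lemma invariant_act: "invariant U \<Longrightarrow> h \<in> carrier H \<Longrightarrow> u \<in> U \<Longrightarrow> act h u \<in> U" by (simp add: invariant_def)
lemma invariant_mem: "invariant U \<Longrightarrow> u \<in> U \<Longrightarrow> u \<in> carrier V" using invariant_subgroup sub_mem by blast

lemma invariant_triv: "invariant {\<one>}" by (simp add: invariant_def triv_subgroup act_one)
lemma invariant_carrier: "invariant (carrier V)" by (simp add: invariant_def subgroup_self act_closed)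

lemma invariant_inter: "invariant A \<Longrightarrow> invariant B \<Longrightarrow> invariant (A \<inter> B)"
  by (auto simp: invariant_def intro: sub_inter)

lemma invariant_set_mult: 
  assumes "invariant A" "invariant B" shows "invariant (A <#> B)"
  unfolding invariant_def
proof (intro conjI ballI)
  show "subgroup (A <#> B) V" using assms by (intro mult_subgroups invariant_subgroup)
  fix h u assume "h \<in> carrier H" "u \<in> A <#> B"
  then obtain a b where ab: "a \<in> A" "b \<in> B" "u = a \<otimes> b" by (auto simp: set_mult_iff)
  then have "act h u = act h a \<otimes> act h b" using assms \<open>h \<in> carrier H\<close> by (simp add: act_mult invariant_mem)
  moreover have "act h a \<in> A" "act h b \<in> B" using ab assms \<open>h \<in> carrier H\<close> by (auto intro: invariant_act)
  ultimately show "act h u \<in> A <#> B" by (auto simp: set_mult_iff)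
qed

lemma irredD:
  assumes "irred W"
  shows "invariant W" "W \<noteq> {\<one>}" "invariant U \<Longrightarrow> U \<subseteq> W \<Longrightarrow> U \<noteq> {\<one>} \<Longrightarrow> U = W"
  using assms by (auto simp: irred_def)

lemma irred_nonzero:
  assumes "irred W" obtains w where "w \<in> W" "w \<noteq> \<one>"
  using irredD(1,2)[OF assms] subgroup.one_closed[OF invariant_subgroup] by blast

lemma irred_cases:
  assumes "irred W" "invariant U" shows "U \<inter> W = {\<one>} \<or> W \<subseteq> U"
  using irredD(3)[OF assms(1) invariant_inter[OF assms(2) irredD(1)[OF assms(1)]]] by auto

lemma ex_irred:
  assumes "invariant U" "U \<noteq> {\<one>}" shows "\<exists>W. irred W \<and> W \<subseteq> U"
  using assms
proof (induction "card U" arbitrary: U rule: less_induct)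
  case less
  show ?case
  proof (cases "irred U")
    case False
    then obtain U' where U': "invariant U'" "U' \<subseteq> U" "U' \<noteq> {\<one>}" "U' \<noteq> U"
      using less.prems by (auto simp: irred_def)
    then have "card U' < card U" using sub_finite[OF invariant_subgroup[OF less.prems(1)]] by (intro psubset_card_mono) auto
    from less.hyps[OF this U'(1,3)] U'(2) show ?thesis by blast
  qed auto
qed

lemma equiv_homD:
  assumes "equiv_hom f A B"
  shows "a \<in> A \<Longrightarrow> f a \<in> B" "a \<in> A \<Longrightarrow> b \<in> A \<Longrightarrow> f (a \<otimes> b) = f a \<otimes> f b"
    "h \<in> carrier H \<Longrightarrow> a \<in> A \<Longrightarrow> f (act h a) = act h (f a)"
  using assms by (auto simp: equiv_hom_def)

lemma equiv_hom_one:
  assumes "equiv_hom f A B" "subgroup A V" "subgroup B V" shows "f \<one> = \<one>"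
proof -
  have "f \<one> \<in> carrier V" "f \<one> \<otimes> f \<one> = f \<one>"
    using equiv_homD(1,2)[OF assms(1)] sub_mem[OF assms(3)] subgroup.one_closed[OF assms(2)]
    by (metis l_one one_closed)+
  then show ?thesis by (simp add: l_cancel_one')
qed

lemma equiv_hom_inv:
  assumes "equiv_hom f A B" "subgroup A V" "subgroup B V" "a \<in> A" shows "f (inv a) = inv (f a)"
proof -
  have "f (inv a) \<otimes> f a = f (inv a \<otimes> a)"
    using assms by (simp add: equiv_homD(2)[OF assms(1)] subgroup.m_inv_closed)
  also have "\<dots> = \<one>" using assms sub_mem equiv_hom_one[OF assms(1-3)] by simp
  finally show ?thesis
    using assms equiv_homD(1)[OF assms(1)] sub_mem subgroup.m_inv_closed by (metis inv_equality)
qed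

lemma equiv_hom_kernel:
  assumes "equiv_hom f A B" "invariant A" "invariant B"
  shows "invariant {a \<in> A. f a = \<one>}"
  unfolding invariant_def
proof (intro conjI ballI)
  note [simp] = equiv_hom_one[OF assms(1) invariant_subgroup[OF assms(2)] invariant_subgroup[OF assms(3)]]
    equiv_hom_inv[OF assms(1) invariant_subgroup[OF assms(2)] invariant_subgroup[OF assms(3)]]
  show "subgroup {a \<in> A. f a = \<one>} V"
    using assms invariant_subgroup[OF assms(2)] exI[of "\<lambda>x. x \<in> A \<and> f x = \<one>" \<one>] subgroup.one_closed[OF invariant_subgroup[OF assms(2)]]
    by (intro subgroupI) (auto simp: equiv_homD(2)[OF assms(1)] invariant_mem subgroup.m_inv_closed subgroup.m_closed
        subgroup.one_closed)
  fix h u assume "h \<in> carrier H" "u \<in> {a \<in> A. f a = \<one>}"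
  then show "act h u \<in> {a \<in> A. f a = \<one>}"
    using assms by (auto simp: equiv_homD(3)[OF assms(1)] act_one invariant_act)
qed

lemma equiv_hom_image:
  assumes "equiv_hom f A B" "invariant A" "invariant B"
  shows "invariant (f ` A)"
  unfolding invariant_def
proof (intro conjI ballI)
  note A = invariant_subgroup[OF assms(2)] and B = invariant_subgroup[OF assms(3)]
  show "subgroup (f ` A) V"
  proof (rule subgroupI)
    show "f ` A \<subseteq> carrier V" using equiv_homD(1)[OF assms(1)] sub_mem[OF B] by auto
    show "f ` A \<noteq> {}" using subgroup.one_closed[OF A] by auto
    fix x y assume "x \<in> f ` A" "y \<in> f ` A"
    then obtain a b where ab: "a \<in> A" "b \<in> A" "x = f a" "y = f b" by auto
    show "inv x \<in> f ` A"
      using ab equiv_hom_inv[OF assms(1) A B ab(1)] subgroup.m_inv_closed[OF A ab(1)] by (metis imageI)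
    show "x \<otimes> y \<in> f ` A"
      using ab equiv_homD(2)[OF assms(1) ab(1,2)] subgroup.m_closed[OF A ab(1,2)] by (metis imageI)
  qed
  fix h u assume h: "h \<in> carrier H" and "u \<in> f ` A"
  then obtain a where a: "a \<in> A" "u = f a" by auto
  with equiv_homD(3)[OF assms(1) h a(1)] invariant_act[OF assms(2) h a(1)] show "act h u \<in> f ` A" by (metis imageI)
qed

lemma equiv_hom_injI:
  assumes "equiv_hom f A B" "subgroup A V" "subgroup B V" "\<And>a. a \<in> A \<Longrightarrow> f a = \<one> \<Longrightarrow> a = \<one>"
  shows "inj_on f A"
proof (rule inj_onI)
  fix x y assume xy: "x \<in> A" "y \<in> A" "f x = f y"
  have "f (x \<otimes> inv y) = f x \<otimes> inv (f y)"
    using xy assms by (simp add: equiv_homD(2)[OF assms(1)] subgroup.m_inv_closed equiv_hom_inv)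
  also have "\<dots> = \<one>" unfolding xy(3) using equiv_homD(1)[OF assms(1) xy(2)] sub_mem[OF assms(3)] by simp
  finally have "f (x \<otimes> inv y) = \<one>" .
  moreover have "x \<otimes> inv y \<in> A" using assms(2) xy(1,2) by (intro subgroup.m_closed subgroup.m_inv_closed)
  ultimately have "x \<otimes> inv y = \<one>" by (rule assms(4)[rotated])
  then show "x = y" using xy sub_mem[OF assms(2)] inv_equality[of x "inv y"] by simp
qed

text \<open>The kernel is a proper submodule of an irreducible one, hence trivial.\<close>

lemma irred_hom_inj:
  assumes "irred W" "invariant B" "equiv_hom f W B" "w \<in> W" "f w \<noteq> \<one>"
  shows "inj_on f W"
proof (rule equiv_hom_injI[OF assms(3)])
  note W = irredD(1)[OF assms(1)]
  show "subgroup W V" "subgroup B V" using W assms(2) by (simp_all add: invariant_subgroup)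
  have "{a \<in> W. f a = \<one>} = {\<one>}"
    using irredD(3)[OF assms(1) equiv_hom_kernel[OF assms(3) W assms(2)]] assms(4,5) by auto
  then show "a = \<one>" if "a \<in> W" "f a = \<one>" for a using that by auto
qed

lemma schur:
  assumes "irred W" "irred U" "equiv_hom f W U" "w \<in> W" "f w \<noteq> \<one>"
  shows "bij_betw f W U"
  unfolding bij_betw_def
proof
  show "inj_on f W" using assms irredD(1) irred_hom_inj by blast
  have "f ` W \<noteq> {\<one>}" using assms(4,5) by auto
  then show "f ` W = U"
    using equiv_hom_image[OF assms(3) irredD(1)[OF assms(1)] irredD(1)[OF assms(2)]] equiv_homD(1)[OF assms(3)]
    by (intro irredD(3)[OF assms(2)]) auto
qed

lemma equiv_hom_id: "equiv_hom (\<lambda>x. x) A A" by (auto simp: equiv_hom_def)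

lemma equiv_hom_comp:
  assumes "equiv_hom f A B" "equiv_hom g B C" shows "equiv_hom (\<lambda>x. g (f x)) A C"
  using assms by (auto simp: equiv_hom_def Pi_iff)

lemma equiv_hom_mono: "equiv_hom f A B \<Longrightarrow> A' \<subseteq> A \<Longrightarrow> B \<subseteq> B' \<Longrightarrow> equiv_hom f A' B'"
  by (auto simp: equiv_hom_def subset_iff)

lemma isom_refl: "isom A A"
  unfolding isom_def using equiv_hom_id bij_betw_id[unfolded id_def] by blast

lemma isom_trans: "isom A B \<Longrightarrow> isom B C \<Longrightarrow> isom A C"
  unfolding isom_def using equiv_hom_comp bij_betw_trans[unfolded comp_def] by blast

lemma equiv_hom_inv_into:
  assumes f: "equiv_hom f A B" "bij_betw f A B" and A: "invariant A"
  shows "equiv_hom (inv_into A f) B A"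
proof -
  define g where "g = inv_into A f"
  have g: "g b \<in> A" "f (g b) = b" if "b \<in> B" for b
    using f(2) that by (auto simp: g_def bij_betw_def inv_into_into f_inv_into_f)
  have gf: "g (f a) = a" if "a \<in> A" for a using f(2) that by (simp add: g_def bij_betw_def)
  have "equiv_hom g B A"
    unfolding equiv_hom_def
  proof (intro conjI ballI)
    show "g \<in> B \<rightarrow> A" using g by auto
    fix x y assume xy: "x \<in> B" "y \<in> B"
    have "x \<otimes> y = f (g x \<otimes> g y)" using xy g by (simp add: equiv_homD(2)[OF f(1)])
    then show "g (x \<otimes> y) = g x \<otimes> g y"
      using gf xy g invariant_subgroup[OF A] subgroup.m_closed by metis
  next
    fix h x assume hx: "h \<in> carrier H" "x \<in> B"
    have "act h x = f (act h (g x))" using hx g by (simp add: equiv_homD(3)[OF f(1)])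
    then show "g (act h x) = act h (g x)" using gf hx g invariant_act[OF A] by metis
  qed
  then show ?thesis by (simp add: g_def)
qed

lemma isom_sym:
  assumes "isom A B" "invariant A" shows "isom B A"
  using assms equiv_hom_inv_into bij_betw_inv_into unfolding isom_def by blast

lemma isom_card: "isom A B \<Longrightarrow> card A = card B"
  by (auto simp: isom_def bij_betw_same_card)

lemma isom_irred:
  assumes "isom W U" "irred W" "invariant U" shows "irred U"
proof -
  obtain f where f: "equiv_hom f W U" "bij_betw f W U" using assms(1) by (auto simp: isom_def)
  obtain g where g: "equiv_hom g U W" "bij_betw g U W"
    using isom_sym[OF assms(1) irredD(1)[OF assms(2)]] by (auto simp: isom_def)
  show ?thesis
    unfolding irred_def
  proof (intro conjI allI impI assms(3))
    show "U \<noteq> {\<one>}"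
      using isom_card[OF assms(1)] card_one_iff[OF invariant_subgroup] irredD(1,2)[OF assms(2)] assms(3) by metis
    fix B assume B: "invariant B \<and> B \<subseteq> U"
    have gB: "equiv_hom g B W" using g(1) B by (blast intro: equiv_hom_mono)
    have "invariant (g ` B)" using equiv_hom_image[OF gB] B irredD(1)[OF assms(2)] by blast
    moreover have "g ` B \<subseteq> W" using equiv_homD(1)[OF gB] by auto
    ultimately have "g ` B = {\<one>} \<or> g ` B = W" using irredD(3)[OF assms(2)] by blast
    moreover have "card (g ` B) = card B"
      using g(2) B by (intro card_image) (auto simp: bij_betw_def intro: inj_on_subset)
    ultimately consider "card B = 1" | "card B = card U"
      using isom_card[OF assms(1)] by (auto simp flip: One_nat_def)
    then show "B = {\<one>} \<or> B = U"
    proof cases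
      case 1 then show ?thesis using card_one_iff[OF invariant_subgroup] B by blast
    next
      case 2 then show ?thesis using B card_subset_eq sub_finite[OF invariant_subgroup[OF assms(3)]] by blast
    qed
  qed
qed

text \<open>The projection of \<open>A <#> B\<close> onto \<open>A\<close> along \<open>B\<close>.\<close>

definition proj where
  "proj A B v = (THE a. a \<in> A \<and> (\<exists>b\<in>B. v = a \<otimes> b))"

lemma proj_eq:
  assumes "subgroup A V" "subgroup B V" "A \<inter> B = {\<one>}" "a \<in> A" "b \<in> B"
  shows "proj A B (a \<otimes> b) = a"
  unfolding proj_def using assms disjoint_unique(1)[OF assms(1-3)] by (intro the_equality) auto

lemma proj_id:
  assumes "subgroup A V" "subgroup B V" "A \<inter> B = {\<one>}"
  shows "a \<in> A \<Longrightarrow> proj A B a = a" "b \<in> B \<Longrightarrow> proj A B b = \<one>"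
  using proj_eq[OF assms, of a \<one>] proj_eq[OF assms, of \<one> b] assms(1,2) sub_mem
  by (auto simp: subgroup.one_closed)

lemma proj_mult:
  assumes "subgroup A V" "subgroup B V" "A \<inter> B = {\<one>}" "x \<in> A <#> B" "y \<in> A <#> B"
  shows "proj A B (x \<otimes> y) = proj A B x \<otimes> proj A B y"
proof -
  obtain a b c d where ab: "a \<in> A" "b \<in> B" "x = a \<otimes> b" and cd: "c \<in> A" "d \<in> B" "y = c \<otimes> d"
    using assms(4,5) by (auto simp: set_mult_iff)
  have "x \<otimes> y = (a \<otimes> c) \<otimes> (b \<otimes> d)" using ab cd sub_mem[OF assms(1)] sub_mem[OF assms(2)] by (simp add: m_ac)
  then show ?thesis
    using ab cd assms by (simp add: proj_eq subgroup.m_closed)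
qed

lemma proj_mem:
  assumes "subgroup A V" "subgroup B V" "A \<inter> B = {\<one>}" "x \<in> A <#> B"
  shows "proj A B x \<in> A" "\<exists>b\<in>B. x = proj A B x \<otimes> b"
proof -
  obtain a b where ab: "a \<in> A" "b \<in> B" "x = a \<otimes> b" using assms(4) by (auto simp: set_mult_iff)
  have "proj A B x = a" unfolding ab(3) by (rule proj_eq[OF assms(1-3) ab(1,2)])
  then show "proj A B x \<in> A" "\<exists>b\<in>B. x = proj A B x \<otimes> b" using ab by auto
qed

lemma proj_decomp:
  assumes "subgroup A V" "subgroup B V" "A \<inter> B = {\<one>}" "x \<in> A <#> B"
  shows "x = proj A B x \<otimes> proj B A x"
proof -
  obtain a b where ab: "a \<in> A" "b \<in> B" "x = a \<otimes> b" using assms(4) by (auto simp: set_mult_iff)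
  have BA: "B \<inter> A = {\<one>}" using assms(3) by blast
  have "x = b \<otimes> a" using ab sub_mem[OF assms(1)] sub_mem[OF assms(2)] by (simp add: m_comm)
  then have "proj B A x = b" using proj_eq[OF assms(2,1) BA ab(2,1)] by simp
  moreover have "proj A B x = a" unfolding ab(3) by (rule proj_eq[OF assms(1-3) ab(1,2)])
  ultimately show ?thesis using ab(3) by simp
qed

lemma proj_equiv_hom:
  assumes "invariant A" "invariant B" "A \<inter> B = {\<one>}"
  shows "equiv_hom (proj A B) (A <#> B) A"
  unfolding equiv_hom_def
proof (intro conjI ballI)
  note AB = invariant_subgroup[OF assms(1)] invariant_subgroup[OF assms(2)] assms(3)
  show "proj A B \<in> (A <#> B) \<rightarrow> A" using proj_mem(1)[OF AB] by auto
  show "proj A B (a \<otimes> b) = proj A B a \<otimes> proj A B b" if "a \<in> A <#> B" "b \<in> A <#> B" for a b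
    using proj_mult[OF AB] that by auto
  fix h x assume h: "h \<in> carrier H" and "x \<in> A <#> B"
  then obtain a b where ab: "a \<in> A" "b \<in> B" "x = a \<otimes> b" by (auto simp: set_mult_iff)
  have "act h x = act h a \<otimes> act h b" using ab h assms by (simp add: act_mult invariant_mem)
  then show "proj A B (act h x) = act h (proj A B x)"
    using ab h assms AB by (simp add: proj_eq invariant_act)
qed

lemma finprod_image:
  assumes "finite S" "g \<in> S \<rightarrow> carrier V" "f \<in> carrier V \<rightarrow> carrier V"
    and "\<And>x y. x \<in> carrier V \<Longrightarrow> y \<in> carrier V \<Longrightarrow> f (x \<otimes> y) = f x \<otimes> f y"
  shows "f (finprod V g S) = finprod V (\<lambda>x. f (g x)) S"
  using assms(1,2)
proof (induction S rule: finite_induct)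
  case empty
  have "f \<one> \<otimes> f \<one> = f \<one>" "f \<one> \<in> carrier V" using assms(4)[of \<one> \<one>] assms(3) by auto
  then show ?case by (simp add: l_cancel_one')
next
  case (insert x S)
  then show ?case using assms(3) by (simp add: assms(4) finprod_closed Pi_iff)
qed

lemma finprod_in_subgroup:
  assumes "subgroup U V" "g \<in> S \<rightarrow> U"
  shows "finprod V g S \<in> U"
proof (cases "finite S")
  case True
  then show ?thesis using assms(2)
  proof (induction S rule: finite_induct)
    case (insert x S)
    then have "g \<in> S \<rightarrow> carrier V" "g x \<in> carrier V" using sub_mem[OF assms(1)] by auto
    with insert show ?case using assms(1) by (simp add: subgroup.m_closed)
  qed (simp add: subgroup.one_closed[OF assms(1)])
qed (simp add: subgroup.one_closed[OF assms(1)])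

text \<open>Average a linear projection \<open>\<pi>\<close> onto \<open>U\<close> over \<open>H\<close>. Without dividing by \<open>|H|\<close>, the resulting
  equivariant map \<open>T\<close> acts on \<open>U\<close> as the power map with exponent \<open>|H|\<close>, which is injective since
  \<open>|H|\<close> is prime to \<open>p\<close>; the kernel of \<open>T\<close> is the complement.\<close>

lemma maschke:
  assumes U: "invariant U"
  obtains C where "invariant C" "U \<inter> C = {\<one>}" "U <#> C = carrier V"
proof -
  note sU = invariant_subgroup[OF U]
  obtain A where A: "subgroup A V" "A \<inter> U = {\<one>}" "A <#> U = carrier V" using ex_complement[OF sU] by blast
  have UA: "U \<inter> A = {\<one>}" "U <#> A = carrier V" using A set_mult_commute[OF sU A(1)] by (simp_all add: Int_commute)
  define \<pi> where "\<pi> = proj U A"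
  have \<pi>U: "\<pi> v \<in> U" if "v \<in> carrier V" for v using proj_mem(1)[OF sU A(1) UA(1)] that UA(2) by (simp add: \<pi>_def)
  have \<pi>m: "\<pi> (v \<otimes> w) = \<pi> v \<otimes> \<pi> w" if "v \<in> carrier V" "w \<in> carrier V" for v w
    using proj_mult[OF sU A(1) UA(1)] that UA(2) by (simp add: \<pi>_def)
  have \<pi>_id: "\<pi> u = u" if "u \<in> U" for u using proj_id(1)[OF sU A(1) UA(1) that] by (simp add: \<pi>_def)
  define t where "t h v = act h (\<pi> (act (inv\<^bsub>H\<^esub> h) v))" for h v
  define T where "T v = finprod V (\<lambda>h. t h v) (carrier H)" for v
  have tU: "t h v \<in> U" if "h \<in> carrier H" "v \<in> carrier V" for h v
    using that by (simp add: t_def invariant_act[OF U] \<pi>U act_closed)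
  have tV: "t h v \<in> carrier V" if "h \<in> carrier H" "v \<in> carrier V" for h v
    using tU[OF that] sub_mem[OF sU] by blast
  have TU: "T v \<in> U" if "v \<in> carrier V" for v
    unfolding T_def using tU that by (intro finprod_in_subgroup[OF sU]) auto
  have T: "equiv_hom T (carrier V) U"
    unfolding equiv_hom_def
  proof (intro conjI ballI)
    show "T \<in> carrier V \<rightarrow> U" using TU by auto
    fix v w assume vw: "v \<in> carrier V" "w \<in> carrier V"
    have "T (v \<otimes> w) = finprod V (\<lambda>h. t h v \<otimes> t h w) (carrier H)"
      unfolding T_def
    proof (rule finprod_cong')
      fix h assume h: "h \<in> carrier H"
      show "t h (v \<otimes> w) = t h v \<otimes> t h w"
        using h vw \<pi>U sub_mem[OF sU] by (simp add: t_def act_mult \<pi>m act_closed)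
    qed (use tV vw in auto)
    also have "\<dots> = T v \<otimes> T w" unfolding T_def using tV vw by (intro finprod_multf) auto
    finally show "T (v \<otimes> w) = T v \<otimes> T w" .
  next
    fix k v assume k: "k \<in> carrier H" and v: "v \<in> carrier V"
    have bij: "(\<lambda>h. k \<otimes>\<^bsub>H\<^esub> h) ` carrier H = carrier H" "inj_on (\<lambda>h. k \<otimes>\<^bsub>H\<^esub> h) (carrier H)"
      using k H.surj_const_mult H.inj_on_cmult by auto
    have "T (act k v) = finprod V (\<lambda>h. t (k \<otimes>\<^bsub>H\<^esub> h) (act k v)) (carrier H)"
      unfolding T_def using finprod_reindex[OF _ bij(2), of "\<lambda>h. t h (act k v)"] bij(1) tV k v
      by (simp add: act_closed)
    also have "\<dots> = finprod V (\<lambda>h. act k (t h v)) (carrier H)"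
    proof (rule finprod_cong')
      fix h assume h: "h \<in> carrier H"
      have "act (inv\<^bsub>H\<^esub> (k \<otimes>\<^bsub>H\<^esub> h)) (act k v) = act (inv\<^bsub>H\<^esub> h) v"
        using h k v by (simp add: act_comp[symmetric] H.inv_mult_group H.m_assoc)
      then show "t (k \<otimes>\<^bsub>H\<^esub> h) (act k v) = act k (t h v)"
        unfolding t_def using h k v \<pi>U[OF act_closed, of "inv\<^bsub>H\<^esub> h" v] sub_mem[OF sU] by (simp add: act_comp)
    qed (use tV v k in \<open>auto intro: act_closed\<close>)
    also have "\<dots> = act k (T v)"
      unfolding T_def using tV v k by (intro finprod_image[symmetric]) (auto simp: finite_H act_mult intro: act_closed)
    finally show "T (act k v) = act k (T v)" .
  qed
  have T_pow: "T u = u [^] order H" if u: "u \<in> U" for u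
  proof -
    have "T u = finprod V (\<lambda>h. u) (carrier H)"
      unfolding T_def
    proof (rule finprod_cong')
      fix h assume h: "h \<in> carrier H"
      then show "t h u = u"
        unfolding t_def using u invariant_act[OF U _ u] sub_mem[OF sU u]
        by (simp add: \<pi>_id act_comp[symmetric] act_id)
    qed (use sub_mem[OF sU u] in auto)
    then show ?thesis using finprod_const[OF sub_mem[OF sU u]] by (simp add: order_def)
  qed
  define C where "C = {v \<in> carrier V. T v = \<one>}"
  have C: "invariant C" unfolding C_def by (rule equiv_hom_kernel[OF T invariant_carrier U])
  have TU_inj: "u = \<one>" if "u \<in> U" "T u = \<one>" for u
  proof -
    have uV: "u \<in> carrier V" using that sub_mem[OF sU] by blast
    have "ord u dvd order H" "ord u dvd p" using T_pow that pow_p uV pow_eq_id by auto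
    then have "ord u = 1" using coprime_H by (metis coprime_common_divisor_nat)
    then show ?thesis using ord_eq_1 uV by blast
  qed
  have "U \<inter> C = {\<one>}"
    by (rule disjointI[OF sU invariant_subgroup[OF C]]) (use TU_inj in \<open>auto simp: C_def\<close>)
  moreover have "U <#> C = carrier V"
  proof
    show "U <#> C \<subseteq> carrier V" using invariant_mem[OF invariant_set_mult[OF U C]] by blast
    show "carrier V \<subseteq> U <#> C"
    proof
      fix v assume v: "v \<in> carrier V"
      have "equiv_hom T U U" using T by (rule equiv_hom_mono) (use sub_mem[OF sU] in auto)
      then have "inj_on T U" "T ` U \<subseteq> U"
        using equiv_hom_injI[OF _ sU sU] TU_inj equiv_homD(1) by blast+
      then have "T ` U = U" using endo_inj_surj[of U T] sub_finite[OF sU] by blast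
      with TU[OF v] obtain u where u: "u \<in> U" "T v = T u" by (metis imageE)
      note uV = sub_mem[OF sU u(1)]
      have "T (inv u \<otimes> v) = inv (T u) \<otimes> T v"
        using equiv_homD(2)[OF T] equiv_hom_inv[OF T subgroup_self sU uV] uV v by simp
      also have "\<dots> = \<one>" using u TU[OF uV] sub_mem[OF sU] by simp
      finally have "inv u \<otimes> v \<in> C" using uV v by (simp add: C_def)
      moreover have "v = u \<otimes> (inv u \<otimes> v)" using uV v by (simp add: m_assoc[symmetric])
      ultimately show "v \<in> U <#> C" using u(1) unfolding set_mult_iff by blast
    qed
  qed
  ultimately show ?thesis using that C by blast
qed

lemma ex_irred_outside:
  assumes "invariant U" "invariant B" "U \<subseteq> B" "U \<noteq> B"
  shows "\<exists>W. irred W \<and> W \<subseteq> B \<and> U \<inter> W = {\<one>}"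
proof -
  obtain C where C: "invariant C" "U \<inter> C = {\<one>}" "U <#> C = carrier V" using maschke[OF assms(1)] by blast
  have "B = U <#> (C \<inter> B)"
    using modular_law[OF invariant_subgroup[OF assms(1)] invariant_subgroup[OF C(1)] invariant_subgroup[OF assms(2)] assms(3)] C(3) invariant_mem[OF assms(2)]
    by blast
  then have "C \<inter> B \<noteq> {\<one>}"
    using assms(4) invariant_mem[OF assms(1)] by (auto simp: set_mult_def)
  with ex_irred[OF invariant_inter[OF C(1) assms(2)]] obtain W where W: "irred W" "W \<subseteq> C \<inter> B" by blast
  have "U \<inter> W = {\<one>}"
    by (rule disjointI) (use W C(2) assms(1) irredD(1) invariant_subgroup in auto)
  with W show ?thesis by blast
qed

text \<open>Splitting off one irreducible summand is the induction step of all dimension counts.\<close>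

lemma irred_decompose:
  assumes "invariant S" "S \<noteq> {\<one>}"
  obtains U C where "irred U" "U \<subseteq> S" "invariant C" "C \<subseteq> S" "U \<inter> C = {\<one>}" "U <#> C = S"
    "card S = card U * card C" "card C < card S"
proof -
  obtain U where U: "irred U" "U \<subseteq> S" using ex_irred[OF assms] by blast
  note iU = irredD(1)[OF U(1)]
  obtain C where C: "invariant C" "U \<inter> C = {\<one>}" "U <#> C = carrier V" using maschke[OF iU] by blast
  have iCS: "invariant (C \<inter> S)" using invariant_inter C(1) assms(1) by blast
  have S: "U <#> (C \<inter> S) = S"
    using modular_law[OF invariant_subgroup[OF iU] invariant_subgroup[OF C(1)] invariant_subgroup[OF assms(1)] U(2)] C(3)
      invariant_mem[OF assms(1)] by blast
  have disj: "U \<inter> (C \<inter> S) = {\<one>}" using C(2) U(2) by blast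
  have "C \<inter> S \<noteq> S" using disj U(2) irredD(2)[OF U(1)] by blast
  then have less: "card (C \<inter> S) < card S"
    by (intro psubset_card_mono sub_finite[OF invariant_subgroup[OF assms(1)]]) blast
  have "card S = card U * card (C \<inter> S)"
    using card_set_mult[OF invariant_subgroup[OF iU] invariant_subgroup[OF iCS] disj] S by simp
  from that[OF U iCS _ disj S this less] show ?thesis by simp
qed

end

context coprime_action begin

section \<open>Invariant complements: sufficient conditions\<close>

text \<open>The linear form of the \<open>C(p\<^sup>d)\<close> property: every \<open>d\<close>-dimensional subspace has an invariant
  complement.\<close>

definition complementing where
  "complementing d \<longleftrightarrow> (\<forall>A. subgroup A V \<and> card A = p ^ d \<longrightarrow>
     (\<exists>U. invariant U \<and> A \<inter> U = {\<one>} \<and> A <#> U = carrier V))"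

text \<open>Let \<open>B\<close> be maximal among the submodules contained in \<open>S\<close>. If \<open>B\<close> were proper, Maschke's theorem
  would give an irreducible submodule independent of \<open>B\<close>; adding it to \<open>B\<close> stays inside \<open>S\<close>.\<close>

lemma irreds_span:
  assumes S: "subgroup S V" "\<And>W. irred W \<Longrightarrow> W \<subseteq> S"
  shows "S = carrier V"
proof -
  define \<B> where "\<B> = {B. invariant B \<and> B \<subseteq> S}"
  have "finite \<B>" by (rule finite_subset[of _ "Pow S"]) (auto simp: \<B>_def sub_finite[OF S(1)])
  moreover have "{\<one>} \<in> \<B>" using invariant_triv subgroup.one_closed[OF S(1)] by (auto simp: \<B>_def)
  ultimately obtain B where "B \<in> \<B>" and B_max: "\<forall>B'\<in>\<B>. B \<subseteq> B' \<longrightarrow> B' = B"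
    using finite_has_maximal2[of \<B> "{\<one>}"] by auto
  then have B: "invariant B" "B \<subseteq> S" by (auto simp: \<B>_def)
  have "B = carrier V"
  proof (rule ccontr)
    assume "B \<noteq> carrier V"
    then obtain W where W: "irred W" "B \<inter> W = {\<one>}"
      using ex_irred_outside[OF B(1) invariant_carrier] invariant_mem[OF B(1)] by blast
    note iW = irredD(1)[OF W(1)]
    have "B <#> W \<in> \<B>"
      using invariant_set_mult[OF B(1) iW] set_mult_least[OF S(1) B(2) S(2)[OF W(1)]] by (simp add: \<B>_def)
    then have "B <#> W = B" using B_max set_mult_upper(1)[OF invariant_subgroup[OF B(1)] invariant_subgroup[OF iW]] by blast
    then have "W \<subseteq> B" using set_mult_upper(2)[OF invariant_subgroup[OF B(1)] invariant_subgroup[OF iW]] by simp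
    then show False using W(2) irredD(2)[OF W(1)] by blast
  qed
  then show ?thesis using B(2) sub_mem[OF S(1)] by blast
qed

text \<open>A submodule of order \<open>p\<close> meets any subgroup trivially or lies in it, so a maximal submodule
  independent of \<open>A\<close> can be enlarged until it complements \<open>A\<close>.\<close>

lemma lines_imp_complementing:
  assumes "\<And>W. irred W \<Longrightarrow> card W = p"
  shows "complementing d"
  unfolding complementing_def
proof (intro allI impI)
  fix A assume "subgroup A V \<and> card A = p ^ d"
  then have A: "subgroup A V" by blast
  obtain U where U: "subgroup U V" "invariant U" "U \<inter> A = {\<one>}"
    "\<And>U'. subgroup U' V \<Longrightarrow> invariant U' \<Longrightarrow> U' \<inter> A = {\<one>} \<Longrightarrow> U \<subseteq> U' \<Longrightarrow> U' = U"
    using ex_maximal_disjoint[OF A, of invariant] invariant_triv by metis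
  have UA: "subgroup (U <#> A) V" by (rule mult_subgroups[OF U(1) A])
  have "W \<subseteq> U <#> A" if W: "irred W" for W
  proof (rule ccontr)
    assume nsub: "\<not> W \<subseteq> U <#> A"
    note iW = irredD(1)[OF W] 
    have "(U <#> A) \<inter> W = {\<one>}" using prime_subgroup_cases[OF UA invariant_subgroup[OF iW] assms[OF W]] nsub by blast
    from disjoint_extend[OF U(1) A invariant_subgroup[OF iW] U(3) this]
    have "U <#> W = U"
      using U(4) invariant_set_mult[OF U(2) iW] invariant_subgroup set_mult_upper(1)[OF U(1) invariant_subgroup[OF iW]] by blast
    then have "W \<subseteq> U" using set_mult_upper(2)[OF U(1) invariant_subgroup[OF iW]] by simp
    then show False using nsub set_mult_upper(1)[OF U(1) A] by blast
  qed
  from irreds_span[OF UA this] have "A <#> U = carrier V" using set_mult_commute[OF A U(1)] by simp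
  with U(2,3) show "\<exists>U. invariant U \<and> A \<inter> U = {\<one>} \<and> A <#> U = carrier V" by (metis Int_commute)
qed

lemma invariant_card:
  assumes "invariant T" "\<And>W. irred W \<Longrightarrow> W \<subseteq> T \<Longrightarrow> card W = p ^ e"
  shows "\<exists>k. card T = p ^ (e * k)"
  using assms
proof (induction "card T" arbitrary: T rule: less_induct)
  case less
  show ?case
  proof (cases "T = {\<one>}")
    case True
    then show ?thesis by (intro exI[of _ 0]) simp
  next
    case False
    obtain W C where WC: "irred W" "W \<subseteq> T" "invariant C" "C \<subseteq> T" "card T = card W * card C"
      "card C < card T"
      using irred_decompose[OF less.prems(1) False] by metis
    then obtain k where "card C = p ^ (e * k)" using less.hyps[OF WC(6,3)] less.prems(2) by blast
    with WC(5) less.prems(2)[OF WC(1,2)] have "card T = p ^ (e * Suc k)" by (simp add: power_add)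
    then show ?thesis ..
  qed
qed

text \<open>For a submodule \<open>U\<close> maximal with \<open>U \<inter> A = 1\<close>, adding the irreducible submodule of any \<open>x \<notin> U\<close> must
  produce a nontrivial element \<open>a\<close> of \<open>A\<close>, and then \<open>x\<close> lies in the sum of \<open>U\<close> and the irreducible
  submodule of \<open>a\<close>. So \<open>V\<close> is covered by \<open>U\<close> and \<open>p\<^sup>d - 1\<close> sets of at most \<open>|U| (p\<^sup>e - 1)\<close> elements,
  fewer than \<open>|U| p\<^sup>d\<^sup>+\<^sup>e\<close> elements in total. As all dimensions are multiples of \<open>e\<close>, this forces
  \<open>|U| |A| = |V|\<close>.\<close>

lemma irred_cover_imp_complementing:
  assumes cover: "\<And>x. x \<in> carrier V \<Longrightarrow> x \<noteq> \<one> \<Longrightarrow> \<exists>W. irred W \<and> x \<in> W"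
    and card_irred: "\<And>W. irred W \<Longrightarrow> card W = p ^ e"
    and "0 < e" "0 < d" "e dvd d"
  shows "complementing d"
  unfolding complementing_def
proof (intro allI impI)
  fix A assume "subgroup A V \<and> card A = p ^ d"
  then have A: "subgroup A V" "card A = p ^ d" by auto
  obtain U where U: "subgroup U V" "invariant U" "U \<inter> A = {\<one>}"
    "\<And>U'. subgroup U' V \<Longrightarrow> invariant U' \<Longrightarrow> U' \<inter> A = {\<one>} \<Longrightarrow> U \<subseteq> U' \<Longrightarrow> U' = U"
    using ex_maximal_disjoint[OF A(1), of invariant] invariant_triv by metis
  obtain m where "card (carrier V) = p ^ (e * m)" using invariant_card[OF invariant_carrier] card_irred by blast
  then have n: "n = e * m" using order_V p_gt_1 by (simp add: order_def)
  obtain j where j: "card U = p ^ (e * j)" using invariant_card[OF U(2)] card_irred by blast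
  obtain k where k: "d = e * k" using assms(5) by blast
  have UA: "subgroup (U <#> A) V" by (rule mult_subgroups[OF U(1) A(1)])
  have cardUA: "card (U <#> A) = p ^ (e * (j + k))"
    using card_set_mult[OF U(1) A(1) U(3)] j A(2) k by (simp add: power_add distrib_left)
  have "U <#> A = carrier V"
  proof (rule ccontr)
    assume neq: "U <#> A \<noteq> carrier V"
    have "U <#> A \<subset> carrier V" using neq subgroup.subset[OF UA] by blast
    from psubset_card_mono[OF finite_V this] have "p ^ (e * (j + k)) < p ^ (e * m)"
      using cardUA n order_V by (simp add: order_def)
    then have "j + k < m" using p_gt_1 by simp
    then have "e * (j + k + 1) \<le> e * m" by (intro mult_left_mono) auto
    then have le: "p ^ (e * j) * p ^ (d + e) \<le> p ^ n"
      unfolding power_add[symmetric] using p_gt_1 by (intro power_increasing) (auto simp: n k algebra_simps)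
    obtain w where w: "irred (w a)" "a \<in> w a" if "a \<in> carrier V" "a \<noteq> \<one>" for a
      using cover by metis
    have sub: "carrier V \<subseteq> U \<union> (\<Union>a\<in>A - {\<one>}. (U <#> w a) - U)"
    proof
      fix x assume x: "x \<in> carrier V"
      show "x \<in> U \<union> (\<Union>a\<in>A - {\<one>}. (U <#> w a) - U)"
      proof (cases "x \<in> U")
        case False
        then have x1: "x \<noteq> \<one>" using subgroup.one_closed[OF U(1)] by auto
        note W = w[OF x x1]
        note iW = irredD(1)[OF W(1)]
        have UW: "invariant (U <#> w x)" by (rule invariant_set_mult[OF U(2) iW])
        have "(U <#> w x) \<inter> A \<noteq> {\<one>}"
        proof
          assume "(U <#> w x) \<inter> A = {\<one>}"
          then have "U <#> w x = U"
            using U(4) UW invariant_subgroup[OF UW] set_mult_upper(1)[OF U(1) invariant_subgroup[OF iW]] by blast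
          then have "w x \<subseteq> U" using set_mult_upper(2)[OF U(1) invariant_subgroup[OF iW]] by simp
          with W(2) False show False by blast
        qed
        then obtain a where a: "a \<in> A" "a \<noteq> \<one>" "a \<in> U <#> w x"
          using subgroup.one_closed[OF A(1)] subgroup.one_closed[OF invariant_subgroup[OF UW]] by blast
        then obtain u y where uy: "u \<in> U" "y \<in> w x" "a = u \<otimes> y" by (auto simp: set_mult_iff)
        have aV: "a \<in> carrier V" using a A(1) sub_mem by blast
        note Wa = w[OF aV a(2)]
        note iWa = irredD(1)[OF Wa(1)]
        have "y \<noteq> \<one>" using uy a U(1,3) sub_mem[OF U(1)] by auto
        have "y = inv u \<otimes> a" using uy sub_mem[OF U(1)] invariant_mem[OF iW] by (simp add: m_assoc[symmetric])
        moreover have "inv u \<in> U" using uy(1) U(1) by (simp add: subgroup.m_inv_closed)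
        ultimately have "y \<in> U <#> w a" using Wa(2) by (auto simp: set_mult_iff)
        then have "w x \<subseteq> U <#> w a"
          using irred_cases[OF W(1) invariant_set_mult[OF U(2) iWa]] uy(2) \<open>y \<noteq> \<one>\<close> by blast
        then show ?thesis using W(2) a False by blast
      qed simp
    qed
    have finA: "finite A" "finite U" using sub_finite A(1) U(1) by auto
    have bound: "card ((U <#> w a) - U) \<le> p ^ (e * j) * (p ^ e - 1)" if a: "a \<in> A - {\<one>}" for a
    proof -
      have aV: "a \<in> carrier V" "a \<noteq> \<one>" using a A(1) sub_mem by auto
      note Wa = w[OF aV]
      note iWa = irredD(1)[OF Wa(1)]
      have "a \<notin> U" using a U(3) by blast
      then have "U \<inter> w a = {\<one>}" using irred_cases[OF Wa(1) U(2)] Wa(2) by blast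
      then have "card (U <#> w a) = p ^ (e * j) * p ^ e"
        using card_set_mult[OF U(1) invariant_subgroup[OF iWa]] j card_irred[OF Wa(1)] by simp
      then have "card ((U <#> w a) - U) = p ^ (e * j) * p ^ e - p ^ (e * j)"
        using card_Diff_subset[OF finA(2) set_mult_upper(1)[OF U(1) invariant_subgroup[OF iWa]]] j by simp
      then show ?thesis by (simp add: diff_mult_distrib2)
    qed
    have "finite (U <#> w a)" if a: "a \<in> A - {\<one>}" for a
    proof -
      have "a \<in> carrier V" "a \<noteq> \<one>" using a A(1) sub_mem by auto
      then have "subgroup (w a) V" using w(1) irredD(1) invariant_subgroup by blast
      then show ?thesis using sub_finite mult_subgroups U(1) by blast
    qed
    then have "finite (U \<union> (\<Union>a\<in>A - {\<one>}. (U <#> w a) - U))" using finA by blast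
    from card_mono[OF this sub]
    have "p ^ n \<le> card (U \<union> (\<Union>a\<in>A - {\<one>}. (U <#> w a) - U))"
      using order_V by (simp add: order_def)
    also have "\<dots> \<le> card U + card (\<Union>a\<in>A - {\<one>}. (U <#> w a) - U)" by (rule card_Un_le)
    also have "card (\<Union>a\<in>A - {\<one>}. (U <#> w a) - U) \<le> (\<Sum>a\<in>A - {\<one>}. card ((U <#> w a) - U))"
      using finA by (intro card_UN_le) auto
    also have "\<dots> \<le> (\<Sum>a\<in>A - {\<one>}. p ^ (e * j) * (p ^ e - 1))" by (rule sum_mono) (rule bound)
    also have "\<dots> = (p ^ d - 1) * (p ^ (e * j) * (p ^ e - 1))"
      using subgroup.one_closed[OF A(1)] A(2) finA by (simp add: card_Diff_subset)
    finally have "p ^ n \<le> p ^ (e * j) * (1 + (p ^ d - 1) * (p ^ e - 1))" using j by (simp add: algebra_simps)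
    also have "\<dots> < p ^ (e * j) * p ^ (d + e)"
    proof -
      have "2 \<le> p ^ d" "2 \<le> p ^ e" using p_gt_1 assms(3,4) self_le_power[of p d] self_le_power[of p e] by linarith+
      then obtain x y where "p ^ d = x + 2" "p ^ e = y + 2" by (metis add.commute le_Suc_ex)
      then have "1 + (p ^ d - 1) * (p ^ e - 1) < p ^ (d + e)" by (simp add: power_add)
      then show ?thesis by (rule mult_strict_left_mono) (use p_gt_1 in simp)
    qed
    finally show False using le by simp
  qed
  then have "A <#> U = carrier V" using set_mult_commute[OF A(1) U(1)] by simp
  with U(2,3) show "\<exists>U. invariant U \<and> A \<inter> U = {\<one>} \<and> A <#> U = carrier V" by (metis Int_commute)
qed

section \<open>Isotypic modules for an abelian group\<close>

text \<open>The module is generated by the copies of \<open>W\<close>; the sum of all copies is avoided by saying that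
  every subgroup that contains them is the whole group.\<close>

definition isotypic where
  "isotypic W \<longleftrightarrow> irred W \<and>
     (\<forall>S. subgroup S V \<and> (\<forall>U. irred U \<and> isom W U \<longrightarrow> U \<subseteq> S) \<longrightarrow> S = carrier V)"

text \<open>The image of the group ring of \<open>H\<close> over the prime field in the endomorphisms of \<open>V\<close>. Scalars are
  iterated sums, and the identity is the action of the unit of \<open>H\<close>.\<close>

inductive_set group_ring :: "('a \<Rightarrow> 'a) set" where
  gr_act: "h \<in> carrier H \<Longrightarrow> act h \<in> group_ring"
| gr_inv: "f \<in> group_ring \<Longrightarrow> (\<lambda>v. inv (f v)) \<in> group_ring"
| gr_mult: "f \<in> group_ring \<Longrightarrow> g \<in> group_ring \<Longrightarrow> (\<lambda>v. f v \<otimes> g v) \<in> group_ring"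

lemma group_ring_closed:
  assumes "f \<in> group_ring" "invariant U" "u \<in> U" shows "f u \<in> U"
  using assms(1) by induction (use assms(2,3) invariant_subgroup in \<open>auto intro: invariant_act subgroup.m_closed subgroup.m_inv_closed\<close>)

lemma group_ring_natural:
  assumes "f \<in> group_ring" "equiv_hom F A B" "invariant A" "invariant B" "a \<in> A"
  shows "F (f a) = f (F a)"
  using assms(1)
proof induction
  case (gr_act h)
  then show ?case using equiv_homD(3)[OF assms(2)] assms(5) by simp
next
  case (gr_inv f)
  then show ?case
    using equiv_hom_inv[OF assms(2) invariant_subgroup[OF assms(3)] invariant_subgroup[OF assms(4)]] group_ring_closed assms(3,5) by simp
next
  case (gr_mult f g)
  then show ?case using equiv_homD(2)[OF assms(2)] group_ring_closed assms(3,5) by simp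
qed

lemma group_ring_hom:
  assumes "f \<in> group_ring" "v \<in> carrier V" "w \<in> carrier V"
  shows "f (v \<otimes> w) = f v \<otimes> f w"
  using assms(1)
proof induction
  case (gr_inv f)
  have "f v \<in> carrier V" "f w \<in> carrier V" using group_ring_closed[OF gr_inv(1) invariant_carrier] assms by auto
  then show ?case by (simp add: gr_inv inv_mult)
next
  case (gr_mult f g)
  have "f v \<in> carrier V" "f w \<in> carrier V" "g v \<in> carrier V" "g w \<in> carrier V"
    using group_ring_closed[OF gr_mult(1) invariant_carrier] group_ring_closed[OF gr_mult(2) invariant_carrier] assms by auto
  then show ?case by (simp add: gr_mult m_ac)
qed (use assms act_mult in auto)

lemma group_ring_act:
  assumes "f \<in> group_ring" "h \<in> carrier H"
  shows "\<exists>g\<in>group_ring. \<forall>v\<in>carrier V. act h (f v) = g v"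
  using assms(1)
proof induction
  case (gr_act k)
  show ?case
    by (rule bexI[of _ "act (h \<otimes>\<^bsub>H\<^esub> k)"]) (use gr_act assms(2) in \<open>auto simp: act_comp intro: group_ring.gr_act\<close>)
next
  case (gr_inv f)
  then obtain g where g: "g \<in> group_ring" "\<forall>v\<in>carrier V. act h (f v) = g v" by blast
  have "act h (inv (f v)) = inv (g v)" if v: "v \<in> carrier V" for v
    using g(2) v group_ring_closed[OF gr_inv(1) invariant_carrier v] by (simp add: act_inv assms(2))
  then show ?case using group_ring.gr_inv[OF g(1)] by (intro bexI[of _ "\<lambda>v. inv (g v)"]) auto
next
  case (gr_mult f1 f2)
  then obtain g1 g2 where g: "g1 \<in> group_ring" "\<forall>v\<in>carrier V. act h (f1 v) = g1 v"
    "g2 \<in> group_ring" "\<forall>v\<in>carrier V. act h (f2 v) = g2 v" by blast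
  have "act h (f1 v \<otimes> f2 v) = g1 v \<otimes> g2 v" if v: "v \<in> carrier V" for v
    using g v group_ring_closed[OF gr_mult(1) invariant_carrier v] group_ring_closed[OF gr_mult(2) invariant_carrier v]
    by (simp add: act_mult assms(2))
  then show ?case using group_ring.gr_mult[OF g(1,3)] by (intro bexI[of _ "\<lambda>v. g1 v \<otimes> g2 v"]) auto
qed

text \<open>The submodule generated by \<open>x\<close>.\<close>

lemma group_ring_orbit:
  assumes x: "x \<in> carrier V"
  shows "invariant ((\<lambda>f. f x) ` group_ring)" "x \<in> (\<lambda>f. f x) ` group_ring"
proof -
  show "x \<in> (\<lambda>f. f x) ` group_ring"
    by (rule image_eqI[of _ _ "act \<one>\<^bsub>H\<^esub>"]) (auto simp: act_id x intro: gr_act)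
  show "invariant ((\<lambda>f. f x) ` group_ring)"
    unfolding invariant_def
  proof (intro conjI ballI)
    show "subgroup ((\<lambda>f. f x) ` group_ring) V"
    proof (rule subgroupI)
      show "(\<lambda>f. f x) ` group_ring \<subseteq> carrier V" using group_ring_closed[OF _ invariant_carrier x] by auto
      show "(\<lambda>f. f x) ` group_ring \<noteq> {}" using \<open>x \<in> (\<lambda>f. f x) ` group_ring\<close> by blast
      fix y z assume "y \<in> (\<lambda>f. f x) ` group_ring" "z \<in> (\<lambda>f. f x) ` group_ring"
      then obtain f g where fg: "f \<in> group_ring" "g \<in> group_ring" "y = f x" "z = g x" by auto
      show "inv y \<in> (\<lambda>f. f x) ` group_ring" using imageI[OF gr_inv[OF fg(1)], of "\<lambda>f. f x"] fg(3) by simp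
      show "y \<otimes> z \<in> (\<lambda>f. f x) ` group_ring"
        using imageI[OF gr_mult[OF fg(1,2)], of "\<lambda>f. f x"] fg(3,4) by simp
    qed
    fix h u assume h: "h \<in> carrier H" and "u \<in> (\<lambda>f. f x) ` group_ring"
    then obtain f where f: "f \<in> group_ring" "u = f x" by auto
    obtain g where "g \<in> group_ring" "act h (f x) = g x" using group_ring_act[OF f(1) h] x by blast
    then show "act h u \<in> (\<lambda>f. f x) ` group_ring" using f(2) by auto
  qed
qed

text \<open>As \<open>H\<close> is abelian, two elements of the group ring that agree on one nonzero vector \<open>w\<close> of \<open>W\<close> agree
  on \<open>W\<close>, hence on all copies of \<open>W\<close>, hence on \<open>V\<close>. So \<open>f w \<mapsto> f x\<close> maps \<open>W\<close> onto the submodule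
  generated by \<open>x\<close>, which is therefore not larger than \<open>W\<close> and has to be irreducible.\<close>

lemma isotypic_abelian_irred_cover:
  assumes W: "isotypic W" and card_irred: "\<And>U. irred U \<Longrightarrow> card U = card W"
    and abelian: "\<And>h k. h \<in> carrier H \<Longrightarrow> k \<in> carrier H \<Longrightarrow> h \<otimes>\<^bsub>H\<^esub> k = k \<otimes>\<^bsub>H\<^esub> h"
    and x: "x \<in> carrier V" "x \<noteq> \<one>"
  shows "\<exists>U. irred U \<and> x \<in> U"
proof -
  have irrW: "irred W" and span: "\<And>S. subgroup S V \<Longrightarrow> (\<And>U. irred U \<Longrightarrow> isom W U \<Longrightarrow> U \<subseteq> S) \<Longrightarrow> S = carrier V"
    using W unfolding isotypic_def by blast+
  note iW = irredD(1)[OF irrW]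
  have "W \<noteq> {}" using subgroup.one_closed[OF invariant_subgroup[OF iW]] by blast
  then obtain w where w: "w \<in> W" "w \<noteq> \<one>" using irredD(2)[OF irrW] by blast
  have wV: "w \<in> carrier V" using invariant_mem[OF iW w(1)] .
  have act_equiv: "equiv_hom (act h) (carrier V) (carrier V)" if "h \<in> carrier H" for h
    using that act_closed act_mult by (auto simp: equiv_hom_def act_comp[symmetric] abelian[OF that])
  have commute: "f (act h v) = act h (f v)" if "f \<in> group_ring" "h \<in> carrier H" "v \<in> carrier V" for f h v
    using group_ring_natural[OF that(1) act_equiv[OF that(2)] invariant_carrier invariant_carrier that(3)] by simp
  have agree: "f v = g v" if fg: "f \<in> group_ring" "g \<in> group_ring" "f w = g w" and v: "v \<in> carrier V" for f g v
  proof -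
    define E where "E = {v \<in> carrier V. f v = g v}"
    have iE: "invariant E"
      unfolding invariant_def
    proof (intro conjI ballI)
      have hom: "equiv_hom f (carrier V) (carrier V)" "equiv_hom g (carrier V) (carrier V)"
        using fg group_ring_hom commute group_ring_closed[OF _ invariant_carrier] by (auto simp: equiv_hom_def)
      note one = equiv_hom_one[OF _ subgroup_self subgroup_self] and inv = equiv_hom_inv[OF _ subgroup_self subgroup_self]
      show "subgroup E V"
        by (rule subgroupI) (use one[OF hom(1)] one[OF hom(2)] inv[OF hom(1)] inv[OF hom(2)] in
            \<open>auto simp: E_def equiv_homD(2)[OF hom(1)] equiv_homD(2)[OF hom(2)]\<close>)
      show "act h u \<in> E" if "h \<in> carrier H" "u \<in> E" for h u
        using that commute[OF fg(1)] commute[OF fg(2)] by (simp add: E_def act_closed)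
    qed
    have "W \<subseteq> E" using irred_cases[OF irrW iE] w wV fg(3) by (auto simp: E_def)
    have "E = carrier V"
    proof (rule span[OF invariant_subgroup[OF iE]])
      fix U assume U: "irred U" "isom W U"
      then obtain F where F: "equiv_hom F W U" "bij_betw F W U" by (auto simp: isom_def)
      note iU = irredD(1)[OF U(1)]
      show "U \<subseteq> E"
      proof
        fix u assume u: "u \<in> U"
        then obtain y where y: "y \<in> W" "u = F y" using F(2) by (auto simp: bij_betw_def)
        have "f y = g y" using y(1) \<open>W \<subseteq> E\<close> by (auto simp: E_def)
        then have "f u = g u"
          unfolding y(2) using group_ring_natural[OF fg(1) F(1) iW iU y(1)] group_ring_natural[OF fg(2) F(1) iW iU y(1)] by simp
        then show "u \<in> E" using invariant_mem[OF iU u] by (simp add: E_def)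
      qed
    qed
    then show ?thesis using v by (auto simp: E_def)
  qed
  define C where "C y = (\<lambda>f. f y) ` group_ring" for y
  have "C w \<subseteq> W" using group_ring_closed[OF _ iW w(1)] by (auto simp: C_def)
  then have Cw: "C w = W"
    using irredD(3)[OF irrW group_ring_orbit(1)[OF wV]] group_ring_orbit(2)[OF wV] w(2) by (auto simp: C_def)
  define r where "r y = (SOME f. f \<in> group_ring \<and> f w = y)" for y
  have r: "r y \<in> group_ring" "r y w = y" if "y \<in> W" for y
  proof -
    have "\<exists>f. f \<in> group_ring \<and> f w = y" using that Cw by (auto simp: C_def)
    from someI_ex[OF this] show "r y \<in> group_ring" "r y w = y" by (auto simp: r_def)
  qed
  have "C x \<subseteq> (\<lambda>y. r y x) ` W"
  proof
    fix z assume "z \<in> C x"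
    then obtain f where f: "f \<in> group_ring" "z = f x" by (auto simp: C_def)
    have fw: "f w \<in> W" using group_ring_closed[OF f(1) iW w(1)] .
    have "z = r (f w) x" unfolding f(2) using agree[OF f(1) r(1)[OF fw] _ x(1)] r(2)[OF fw] by simp
    with fw show "z \<in> (\<lambda>y. r y x) ` W" by blast
  qed
  then have cardC: "card (C x) \<le> card W" using surj_card_le sub_finite[OF invariant_subgroup[OF iW]] by blast
  have Cx: "invariant (C x)" "x \<in> C x" using group_ring_orbit[OF x(1)] by (auto simp: C_def)
  then obtain U where U: "irred U" "U \<subseteq> C x" using ex_irred[of "C x"] x(2) by blast
  have "card (C x) \<le> card U" using cardC card_irred[OF U(1)] by simp
  then have "U = C x" using U(2) sub_finite[OF invariant_subgroup[OF Cx(1)]] card_seteq by blast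
  with U(1) Cx(2) show ?thesis by blast
qed

section \<open>Homogeneity from invariant complements\<close>

text \<open>The component \<open>T\<close> is the smallest submodule containing all copies of \<open>W\<close>. To see that an
  irreducible \<open>Z \<le> T\<close> is a copy of \<open>W\<close>, take \<open>S\<close> maximal independent of \<open>Z\<close>: some copy \<open>U\<close> of \<open>W\<close> is not
  contained in \<open>S\<close>, and then \<open>Z \<le> U S\<close> projects isomorphically onto \<open>U\<close>.\<close>

lemma ex_isotypic_component:
  assumes W: "irred W"
  obtains T where "invariant T" "\<And>U. irred U \<Longrightarrow> isom W U \<Longrightarrow> U \<subseteq> T"
    "\<And>U. irred U \<Longrightarrow> U \<subseteq> T \<Longrightarrow> isom W U"
    "\<And>S. invariant S \<Longrightarrow> (\<And>U. irred U \<Longrightarrow> isom W U \<Longrightarrow> U \<subseteq> S) \<Longrightarrow> T \<subseteq> S"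
proof -
  define \<S> where "\<S> = {S. invariant S \<and> (\<forall>U. irred U \<and> isom W U \<longrightarrow> U \<subseteq> S)}"
  define T where "T = \<Inter> \<S>"
  have "carrier V \<in> \<S>" using invariant_carrier irredD(1) invariant_mem by (auto simp: \<S>_def)
  then have "subgroup T V"
    unfolding T_def by (intro subgroups_Inter) (auto simp: \<S>_def invariant_subgroup)
  then have T: "invariant T" unfolding invariant_def T_def by (auto simp: \<S>_def intro: invariant_act)
  have least: "T \<subseteq> S" if "invariant S" "\<And>U. irred U \<Longrightarrow> isom W U \<Longrightarrow> U \<subseteq> S" for S
    using that by (auto simp: T_def \<S>_def)
  have up: "U \<subseteq> T" if "irred U" "isom W U" for U using that by (auto simp: T_def \<S>_def)
  have down: "isom W Z" if Z: "irred Z" "Z \<subseteq> T" for Z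
  proof -
    note iZ = irredD(1)[OF Z(1)]
    obtain S where S: "subgroup S V" "invariant S" "S \<inter> Z = {\<one>}"
      "\<And>S'. subgroup S' V \<Longrightarrow> invariant S' \<Longrightarrow> S' \<inter> Z = {\<one>} \<Longrightarrow> S \<subseteq> S' \<Longrightarrow> S' = S"
      using ex_maximal_disjoint[OF invariant_subgroup[OF iZ], of invariant] invariant_triv by metis
    have "\<not> T \<subseteq> S" using Z S(3) irredD(2)[OF Z(1)] by blast
    then obtain U where U: "irred U" "isom W U" "\<not> U \<subseteq> S" using least[OF S(2)] by blast
    note iU = irredD(1)[OF U(1)]
    have US: "U \<inter> S = {\<one>}" using irred_cases[OF U(1) S(2)] U(3) by blast
    have iSU: "invariant (U <#> S)" by (rule invariant_set_mult[OF iU S(2)])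
    have "(U <#> S) \<inter> Z \<noteq> {\<one>}"
    proof
      assume "(U <#> S) \<inter> Z = {\<one>}"
      then have "U <#> S = S"
        using S(4) iSU invariant_subgroup set_mult_upper(2)[OF invariant_subgroup[OF iU] S(1)] by blast
      then show False using U(3) set_mult_upper(1)[OF invariant_subgroup[OF iU] S(1)] by simp
    qed
    then have ZSU: "Z \<subseteq> U <#> S" using irred_cases[OF Z(1) iSU] by blast
    have pr: "equiv_hom (proj U S) Z U"
      by (rule equiv_hom_mono[OF proj_equiv_hom[OF iU S(2) US] ZSU order_refl])
    obtain z where z: "z \<in> Z" "z \<noteq> \<one>"
      by (rule irred_nonzero[OF Z(1)])
    have "proj U S z \<noteq> \<one>"
    proof
      assume "proj U S z = \<one>"
      then obtain s where "s \<in> S" "z = \<one> \<otimes> s"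
        using proj_mem(2)[OF invariant_subgroup[OF iU] S(1) US, of z] ZSU z(1) by auto
      then have "z \<in> S" using sub_mem[OF S(1)] by simp
      then show False using z S(3) by blast
    qed
    from schur[OF Z(1) U(1) pr z(1) this] have "isom Z U" using pr by (auto simp: isom_def)
    then show ?thesis using isom_trans[OF U(2)] isom_sym[OF _ iZ] by blast
  qed
  show ?thesis by (rule that[OF T up down least])
qed

text \<open>If the two intersections did not span \<open>U\<close>, some irreducible submodule of \<open>U\<close> would lie in
  neither of \<open>T\<close> and \<open>C\<close>. It would be isomorphic to its projection to
  \<open>T\<close>, hence a copy of \<open>W\<close>, hence contained in \<open>T\<close>.\<close>

lemma invariant_split:
  assumes T: "invariant T" "\<And>U. irred U \<Longrightarrow> isom W U \<Longrightarrow> U \<subseteq> T"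
    "\<And>U. irred U \<Longrightarrow> U \<subseteq> T \<Longrightarrow> isom W U"
    and C: "invariant C" "T \<inter> C = {\<one>}" "T <#> C = carrier V"
    and U: "invariant U"
  shows "U = (U \<inter> T) <#> (U \<inter> C)"
proof (rule ccontr)
  define B where "B = (U \<inter> T) <#> (U \<inter> C)"
  have UT: "invariant (U \<inter> T)" and UC: "invariant (U \<inter> C)" using invariant_inter U T(1) C(1) by auto
  have B: "invariant B" unfolding B_def by (rule invariant_set_mult[OF UT UC])
  have BU: "B \<subseteq> U" unfolding B_def by (rule set_mult_least[OF invariant_subgroup[OF U]]) auto
  assume "U \<noteq> (U \<inter> T) <#> (U \<inter> C)"
  then obtain Z where Z: "irred Z" "Z \<subseteq> U" "B \<inter> Z = {\<one>}"
    using ex_irred_outside[OF B U BU] by (auto simp: B_def)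
  note iZ = irredD(1)[OF Z(1)]
  have nB: "\<not> Z \<subseteq> B" using Z(3) irredD(2)[OF Z(1)] by blast
  have nT: "\<not> Z \<subseteq> T"
    using nB Z(2) set_mult_upper(1)[OF invariant_subgroup[OF UT] invariant_subgroup[OF UC]] by (auto simp: B_def)
  have "\<not> Z \<subseteq> C"
    using nB Z(2) set_mult_upper(2)[OF invariant_subgroup[OF UT] invariant_subgroup[OF UC]] by (auto simp: B_def)
  then have CZ: "C \<inter> Z = {\<one>}" using irred_cases[OF Z(1) C(1)] by blast
  have ZV: "Z \<subseteq> T <#> C" using C(3) invariant_mem[OF iZ] by blast
  have pr: "equiv_hom (proj T C) Z T"
    by (rule equiv_hom_mono[OF proj_equiv_hom[OF T(1) C(1,2)] ZV order_refl])
  have inj: "inj_on (proj T C) Z"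
  proof (rule equiv_hom_injI[OF pr invariant_subgroup[OF iZ] invariant_subgroup[OF T(1)]])
    fix z assume z: "z \<in> Z" "proj T C z = \<one>"
    obtain c where "c \<in> C" "z = proj T C z \<otimes> c"
      using proj_mem(2)[OF invariant_subgroup[OF T(1)] invariant_subgroup[OF C(1)] C(2), of z] ZV z(1) by auto
    then have "z \<in> C" using z(2) invariant_mem[OF C(1)] by simp
    then show "z = \<one>" using CZ z(1) by blast
  qed
  define Z' where "Z' = proj T C ` Z"
  have iZ': "invariant Z'" unfolding Z'_def by (rule equiv_hom_image[OF pr iZ T(1)])
  have "equiv_hom (proj T C) Z Z'" using pr by (auto simp: equiv_hom_def Z'_def)
  then have "isom Z Z'" using inj by (auto simp: isom_def Z'_def bij_betw_def)
  then have "irred Z'" "isom Z' Z" using isom_irred[OF _ Z(1) iZ'] isom_sym[OF _ iZ] by auto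
  moreover have "Z' \<subseteq> T" using equiv_homD(1)[OF pr] by (auto simp: Z'_def)
  ultimately have "isom W Z" using T(3) isom_trans by blast
  then show False using T(2)[OF Z(1)] nT by blast
qed

text \<open>Splitting an invariant complement of \<open>A\<^sub>1 A\<^sub>2\<close>, with \<open>A\<^sub>1 \<le> T\<close> of order \<open>p\<^sup>a\<close> and \<open>A\<^sub>2 \<le> C\<close>, along
  \<open>V = T C\<close> produces a submodule of \<open>T\<close> of order \<open>p\<^sup>t\<^sup>-\<^sup>a\<close>, so that \<open>e\<close> divides \<open>t - a\<close>. This is the
  fact \<open>key\<close>; everything else is a choice of \<open>a\<close>.\<close>

theorem complementing_imp_isotypic:
  assumes compl: "complementing d" and d: "0 < d" "d < n"
    and W: "irred W" "card W = p ^ e" "1 < e"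
  shows "isotypic W" "\<And>U. irred U \<Longrightarrow> isom W U" "e dvd n" "e dvd d"
proof -
  obtain T where T: "invariant T" "\<And>U. irred U \<Longrightarrow> isom W U \<Longrightarrow> U \<subseteq> T"
    "\<And>U. irred U \<Longrightarrow> U \<subseteq> T \<Longrightarrow> isom W U"
    "\<And>S. invariant S \<Longrightarrow> (\<And>U. irred U \<Longrightarrow> isom W U \<Longrightarrow> U \<subseteq> S) \<Longrightarrow> T \<subseteq> S"
    using ex_isotypic_component[OF W(1)] by blast
  obtain C where C: "invariant C" "T \<inter> C = {\<one>}" "T <#> C = carrier V" using maschke[OF T(1)] by blast
  note sT = invariant_subgroup[OF T(1)] and sC = invariant_subgroup[OF C(1)]
  obtain t where t: "card T = p ^ t" using subgroup_card[OF sT] by blast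
  obtain c where c: "card C = p ^ c" using subgroup_card[OF sC] by blast
  have pow_eq: "p ^ i = p ^ j \<longleftrightarrow> i = j" and pow_le: "p ^ i \<le> p ^ j \<longleftrightarrow> i \<le> j" for i j
    using p_gt_1 by simp_all
  have tc: "t + c = n"
    using card_set_mult[OF sT sC C(2)] C(3) t c order_V by (simp add: order_def power_add[symmetric] pow_eq)
  have card_e: "card U = p ^ e" if "irred U" "U \<subseteq> T" for U using isom_card[OF T(3)[OF that]] W(2) by simp
  have key: "e dvd t - a" if a: "a \<le> t" "a \<le> d" "d - a \<le> c" for a
  proof -
    obtain A1 where A1: "subgroup A1 V" "A1 \<subseteq> T" "card A1 = p ^ a" using ex_subgroup_of_card[OF sT t a(1)] by blast
    obtain A2 where A2: "subgroup A2 V" "A2 \<subseteq> C" "card A2 = p ^ (d - a)" using ex_subgroup_of_card[OF sC c a(3)] by blast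
    define A where "A = A1 <#> A2"
    have disj: "A1 \<inter> A2 = {\<one>}" by (rule disjointI[OF A1(1) A2(1)]) (use A1(2) A2(2) C(2) in blast)
    have A: "subgroup A V" "card A = p ^ d" "A1 \<subseteq> A" "A2 \<subseteq> A"
      using mult_subgroups[OF A1(1) A2(1)] card_set_mult[OF A1(1) A2(1) disj] A1(3) A2(3) a(2)
        set_mult_upper[OF A1(1) A2(1)]
      by (simp_all add: A_def power_add[symmetric])
    obtain U where U: "invariant U" "A \<inter> U = {\<one>}" "A <#> U = carrier V"
      using compl A(1,2) unfolding complementing_def by blast
    note sU = invariant_subgroup[OF U(1)]
    have sUT: "subgroup (U \<inter> T) V" and sUC: "subgroup (U \<inter> C) V" using sub_inter sU sT sC by auto
    obtain u where u: "card U = p ^ u" using subgroup_card[OF sU] by blast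
    obtain u1 where u1: "card (U \<inter> T) = p ^ u1" using subgroup_card[OF sUT] by blast
    obtain u2 where u2: "card (U \<inter> C) = p ^ u2" using subgroup_card[OF sUC] by blast
    have "d + u = n"
      using card_set_mult[OF A(1) sU U(2)] U(3) A(2) u order_V by (simp add: order_def power_add[symmetric] pow_eq)
    moreover have "u = u1 + u2"
    proof -
      have "(U \<inter> T) \<inter> (U \<inter> C) = {\<one>}"
        by (rule disjointI[OF sUT sUC]) (use C(2) in blast)
      from card_set_mult[OF sUT sUC this] show ?thesis
        using invariant_split[OF T(1-3) C U(1)] u u1 u2 by (simp add: power_add[symmetric] pow_eq)
    qed
    moreover have "a + u1 \<le> t"
    proof -
      have "A1 \<inter> (U \<inter> T) = {\<one>}" by (rule disjointI[OF A1(1) sUT]) (use A(3) U(2) in blast)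
      moreover have "A1 <#> (U \<inter> T) \<subseteq> T" using set_mult_least[OF sT A1(2)] by blast
      ultimately show ?thesis
        using card_set_mult[OF A1(1) sUT] card_mono[OF sub_finite[OF sT]] A1(3) u1 t
        by (metis pow_le power_add)
    qed
    moreover have "(d - a) + u2 \<le> c"
    proof -
      have "A2 \<inter> (U \<inter> C) = {\<one>}" by (rule disjointI[OF A2(1) sUC]) (use A(4) U(2) in blast)
      moreover have "A2 <#> (U \<inter> C) \<subseteq> C" using set_mult_least[OF sC A2(2)] by blast
      ultimately show ?thesis
        using card_set_mult[OF A2(1) sUC] card_mono[OF sub_finite[OF sC]] A2(3) u2 c
        by (metis pow_le power_add)
    qed
    ultimately have "u1 = t - a" using tc a(2) by linarith
    moreover obtain k where "card (U \<inter> T) = p ^ (e * k)"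
      using invariant_card[OF invariant_inter[OF U(1) T(1)], of e] card_e by blast
    ultimately show ?thesis using u1 by (simp add: pow_eq)
  qed
  have c0: "c = 0"
  proof (rule ccontr)
    assume "c \<noteq> 0"
    have "W \<subseteq> T" using T(2)[OF W(1) isom_refl] .
    then have "card W \<le> card T" using card_mono[OF sub_finite[OF sT]] by blast
    then have "e \<le> t" using t W(2) by (simp add: pow_le)
    \<comment> \<open>The least admissible dimension of \<open>A\<^sub>1\<close>; the subtraction is truncated, which covers the case \<open>d \<le> c\<close>.\<close>
    define a where "a = d - c"
    have "a + 1 \<le> t" "a + 1 \<le> d" using d tc \<open>c \<noteq> 0\<close> \<open>e \<le> t\<close> W(3) by (auto simp: a_def)
    then have "e dvd t - a" "e dvd t - (a + 1)" by (auto intro!: key simp: a_def)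
    then have "e dvd (t - a) - (t - (a + 1))" by (rule dvd_diff_nat)
    also have "(t - a) - (t - (a + 1)) = 1" using \<open>a + 1 \<le> t\<close> by simp
    finally show False using W(3) by simp
  qed
  then have "T = carrier V"
    using tc t order_V sub_mem[OF sT] by (intro card_subset_eq[OF finite_V]) (auto simp: order_def)
  have all: "isom W U" if "irred U" for U
    using T(3)[OF that] irredD(1)[OF that] invariant_mem \<open>T = carrier V\<close> by blast
  then show "\<And>U. irred U \<Longrightarrow> isom W U" .
  show "isotypic W"
    unfolding isotypic_def using W(1) irreds_span all by blast
  obtain k where "card (carrier V) = p ^ (e * k)"
    using invariant_card[OF invariant_carrier, of e] isom_card[OF all] W(2) by metis
  then show en: "e dvd n" using order_V by (auto simp: order_def pow_eq)
  have "e dvd n - d" using key[of d] c0 tc d by simp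
  with en have "e dvd n - (n - d)" by (rule dvd_diff_nat)
  then show "e dvd d" using d by simp
qed

section \<open>Equivariant maps out of an irreducible submodule\<close>

text \<open>Maps are normalized outside \<open>W\<close>, so that they can be counted and form a ring.\<close>

definition Hom where
  "Hom W S = {f \<in> extensional W. equiv_hom f W S}"

lemma HomD: 
  assumes "f \<in> Hom W S" shows "equiv_hom f W S" "f \<in> extensional W"
  using assms by (auto simp: Hom_def)

lemma restrict_Hom:
  assumes "equiv_hom f W S" "invariant W" shows "restrict f W \<in> Hom W S"
  using assms invariant_subgroup[OF assms(2)] by (auto simp: Hom_def equiv_hom_def invariant_act subgroup.m_closed)

lemma finite_Hom: "invariant W \<Longrightarrow> invariant S \<Longrightarrow> finite (Hom W S)"
  using finite_PiE[of W "\<lambda>_. S"] sub_finite[OF invariant_subgroup]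
  by (intro finite_subset[of "Hom W S" "W \<rightarrow>\<^sub>E S"]) (auto simp: Hom_def equiv_hom_def PiE_def)

lemma equiv_hom_mult:
  assumes "equiv_hom f W S" "equiv_hom g W S" "invariant S"
  shows "equiv_hom (\<lambda>v. f v \<otimes> g v) W S"
  unfolding equiv_hom_def
proof (intro conjI ballI)
  note c = equiv_homD(1)[OF assms(1)] equiv_homD(1)[OF assms(2)]
  note cV = invariant_mem[OF assms(3) c(1)] invariant_mem[OF assms(3) c(2)]
  show "(\<lambda>v. f v \<otimes> g v) \<in> W \<rightarrow> S"
    using c subgroup.m_closed[OF invariant_subgroup[OF assms(3)]] by auto
  show "f (a \<otimes> b) \<otimes> g (a \<otimes> b) = f a \<otimes> g a \<otimes> (f b \<otimes> g b)" if "a \<in> W" "b \<in> W" for a b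
    using that cV by (simp add: equiv_homD(2)[OF assms(1)] equiv_homD(2)[OF assms(2)] m_ac)
  show "f (act h a) \<otimes> g (act h a) = act h (f a \<otimes> g a)" if "h \<in> carrier H" "a \<in> W" for h a
    using that cV by (simp add: equiv_homD(3)[OF assms(1)] equiv_homD(3)[OF assms(2)] act_mult)
qed

lemma equiv_hom_inverse_value:
  assumes "equiv_hom f W S" "invariant S"
  shows "equiv_hom (\<lambda>v. inv (f v)) W S"
  unfolding equiv_hom_def
proof (intro conjI ballI)
  note c = equiv_homD(1)[OF assms(1)]
  note cV = invariant_mem[OF assms(2) c]
  show "(\<lambda>v. inv (f v)) \<in> W \<rightarrow> S" using c subgroup.m_inv_closed[OF invariant_subgroup[OF assms(2)]] by auto
  show "inv (f (a \<otimes> b)) = inv (f a) \<otimes> inv (f b)" if "a \<in> W" "b \<in> W" for a b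
    using that cV by (simp add: equiv_homD(2)[OF assms(1)] inv_mult)
  show "inv (f (act h a)) = act h (inv (f a))" if "h \<in> carrier H" "a \<in> W" for h a
    using that cV by (simp add: equiv_homD(3)[OF assms(1)] act_inv)
qed

lemma equiv_hom_const: "invariant S \<Longrightarrow> equiv_hom (\<lambda>v. \<one>) W S"
  using subgroup.one_closed[OF invariant_subgroup] by (auto simp: equiv_hom_def act_one)

text \<open>The quotient of the two maps is equivariant and not injective, hence trivial.\<close>

lemma Hom_eqI:
  assumes "irred W" "invariant S" "f \<in> Hom W S" "g \<in> Hom W S" "w \<in> W" "w \<noteq> \<one>" "f w = g w"
  shows "f = g"
proof (rule extensionalityI[OF HomD(2)[OF assms(3)] HomD(2)[OF assms(4)]])
  note iW = irredD(1)[OF assms(1)]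
  have q: "equiv_hom (\<lambda>v. f v \<otimes> inv (g v)) W S"
    by (intro equiv_hom_mult equiv_hom_inverse_value HomD(1) assms)
  have mem: "f v \<in> carrier V" "g v \<in> carrier V" if "v \<in> W" for v
    using equiv_homD(1)[OF HomD(1)[OF assms(3)] that] equiv_homD(1)[OF HomD(1)[OF assms(4)] that]
      invariant_mem[OF assms(2)] by auto
  fix v assume v: "v \<in> W"
  show "f v = g v"
  proof (rule ccontr)
    assume "f v \<noteq> g v"
    then have "f v \<otimes> inv (g v) \<noteq> \<one>" using mem[OF v] inv_equality[of "f v" "inv (g v)"] by auto
    then have inj: "inj_on (\<lambda>v. f v \<otimes> inv (g v)) W" by (rule irred_hom_inj[OF assms(1,2) q v])
    have "f w \<otimes> inv (g w) = \<one>" unfolding assms(7) using mem[OF assms(5)] by simp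
    moreover have "f \<one> \<otimes> inv (g \<one>) = \<one>"
      using equiv_hom_one[OF q invariant_subgroup[OF iW] invariant_subgroup[OF assms(2)]] .
    ultimately have "w = \<one>"
      using inj_onD[OF inj, of w \<one>] assms(5) subgroup.one_closed[OF invariant_subgroup[OF iW]] by simp
    with assms(6) show False by blast
  qed
qed

text \<open>The Hom-functor is additive, and each of the \<open>j\<close> irreducible summands of \<open>S\<close> contributes the
  number of endomorphisms of \<open>W\<close>.\<close>

lemma card_Hom_le:
  assumes W: "irred W" "card W = p ^ e" and S: "invariant S" "card S = p ^ (e * j)"
    and iso: "\<And>U. irred U \<Longrightarrow> U \<subseteq> S \<Longrightarrow> isom W U"
  shows "card (Hom W S) \<le> card (Hom W W) ^ j"
  using S iso
proof (induction j arbitrary: S)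
  case 0
  then have "S = {\<one>}" using card_one_iff[OF invariant_subgroup[OF 0(1)]] by simp
  then have "Hom W S \<subseteq> {\<lambda>x\<in>W. \<one>}" by (auto simp: Hom_def equiv_hom_def extensional_def Pi_iff fun_eq_iff)
  then have "card (Hom W S) \<le> card {\<lambda>x\<in>W. \<one>}" by (intro card_mono) auto
  then show ?case by simp
next
  case (Suc j)
  note iW = irredD(1)[OF W(1)]
  have "card W > 1"
    using card_one_iff[OF invariant_subgroup[OF iW]] irredD(2)[OF W(1)] W(2) p_gt_1
    by (metis gr0I less_one linorder_neqE_nat power_eq_0_iff not_one_less_zero)
  then have e: "e > 0" using W(2) by (cases e) auto
  then have "card S \<noteq> 1" using Suc.prems(2) p_gt_1 by simp
  then have S1: "S \<noteq> {\<one>}" using card_one_iff[OF invariant_subgroup[OF Suc.prems(1)]] by simp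
  obtain U C where UC: "irred U" "U \<subseteq> S" "invariant C" "C \<subseteq> S" "U \<inter> C = {\<one>}" "U <#> C = S"
    "card S = card U * card C"
    using irred_decompose[OF Suc.prems(1) S1] by metis
  note iU = irredD(1)[OF UC(1)]
  have WU: "isom W U" using Suc.prems(3) UC by blast
  then obtain g where g: "equiv_hom g U W" "bij_betw g U W"
    using isom_sym[OF _ iW] by (auto simp: isom_def)
  have "card U = p ^ e" using isom_card[OF WU] W(2) by simp
  then have "card C = p ^ (e * j)" using UC(7) Suc.prems(2) p_gt_1 by (simp add: power_add)
  then have IH: "card (Hom W C) \<le> card (Hom W W) ^ j" using Suc.IH[OF UC(3)] Suc.prems(3) UC(4) by blast
  have CU: "C \<inter> U = {\<one>}" "C <#> U = S"
    using UC(5,6) set_mult_commute[OF invariant_subgroup[OF UC(3)] invariant_subgroup[OF iU]] by auto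
  have prU: "equiv_hom (proj U C) S U" using proj_equiv_hom[OF iU UC(3,5)] UC(6) by simp
  have prC: "equiv_hom (proj C U) S C" using proj_equiv_hom[OF UC(3) iU CU(1)] CU(2) by simp
  define F where "F f = (restrict (\<lambda>v. g (proj U C (f v))) W, restrict (\<lambda>v. proj C U (f v)) W)" for f
  have "F \<in> Hom W S \<rightarrow> Hom W W \<times> Hom W C"
  proof
    fix f assume "f \<in> Hom W S"
    note f = HomD(1)[OF this]
    show "F f \<in> Hom W W \<times> Hom W C"
      unfolding F_def
      using restrict_Hom[OF equiv_hom_comp[OF equiv_hom_comp[OF f prU] g(1)] iW]
        restrict_Hom[OF equiv_hom_comp[OF f prC] iW] by simp
  qed
  moreover have "inj_on F (Hom W S)"
  proof (rule inj_onI)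
    fix f f' assume f: "f \<in> Hom W S" "f' \<in> Hom W S" "F f = F f'"
    show "f = f'"
    proof (rule extensionalityI[OF HomD(2)[OF f(1)] HomD(2)[OF f(2)]])
      fix v assume v: "v \<in> W"
      have m: "f v \<in> S" "f' v \<in> S" using equiv_homD(1)[OF HomD(1)] f v by auto
      have "g (proj U C (f v)) = g (proj U C (f' v))" "proj C U (f v) = proj C U (f' v)"
        using f(3) v by (auto simp: F_def fun_eq_iff restrict_def dest: spec[of _ v])
      moreover have "proj U C (f v) \<in> U" "proj U C (f' v) \<in> U" using equiv_homD(1)[OF prU] m by auto
      ultimately have "proj U C (f v) = proj U C (f' v)" "proj C U (f v) = proj C U (f' v)"
        using g(2) by (auto simp: bij_betw_def dest: inj_onD)
      moreover have "x = proj U C x \<otimes> proj C U x" if "x \<in> S" for x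
        by (rule proj_decomp[OF invariant_subgroup[OF iU] invariant_subgroup[OF UC(3)] UC(5)]) (use that UC(6) in simp)
      ultimately show "f v = f' v" using m by metis
    qed
  qed
  ultimately have "card (Hom W S) \<le> card (Hom W W \<times> Hom W C)"
    using finite_Hom[OF iW iW] finite_Hom[OF iW UC(3)]
    by (intro card_inj_on_le[of F] finite_cartesian_product) (simp_all add: image_subset_iff_funcset)
  also have "\<dots> \<le> card (Hom W W) * card (Hom W W) ^ j" using IH by (simp add: card_cartesian_product)
  finally show ?case by simp
qed

lemma ex_invariant_of_card:
  assumes "\<And>U. irred U \<Longrightarrow> card U = p ^ e" "e * j \<le> n" "e > 0"
  shows "\<exists>S. invariant S \<and> card S = p ^ (e * j)"
  using assms(2)
proof (induction j)
  case 0
  show ?case by (rule exI[of _ "{\<one>}"]) (simp add: invariant_triv)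
next
  case (Suc j)
  then obtain S where S: "invariant S" "card S = p ^ (e * j)" by auto
  have "p ^ (e * j) < p ^ n" using Suc.prems assms(3) p_gt_1 by simp
  then have "S \<noteq> carrier V" using S(2) order_V by (auto simp: order_def)
  then obtain W where W: "irred W" "S \<inter> W = {\<one>}"
    using ex_irred_outside[OF S(1) invariant_carrier] invariant_mem[OF S(1)] by blast
  note iW = irredD(1)[OF W(1)]
  have "card (S <#> W) = p ^ (e * Suc j)"
    using card_set_mult[OF invariant_subgroup[OF S(1)] invariant_subgroup[OF iW] W(2)] S(2) assms(1)[OF W(1)] by (simp add: power_add)
  then show ?case using invariant_set_mult[OF S(1) iW] by blast
qed

lemma Hom_orbit_subgroup:
  assumes "invariant W" "invariant S" "v \<in> W"
  shows "subgroup ((\<lambda>f. f v) ` Hom W S) V" "(\<lambda>f. f v) ` Hom W S \<subseteq> S"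
proof -
  show sub: "(\<lambda>f. f v) ` Hom W S \<subseteq> S" using equiv_homD(1)[OF HomD(1)] assms(3) by auto
  show "subgroup ((\<lambda>f. f v) ` Hom W S) V"
  proof (rule subgroupI)
    show "(\<lambda>f. f v) ` Hom W S \<subseteq> carrier V" using sub invariant_mem[OF assms(2)] by blast
    show "(\<lambda>f. f v) ` Hom W S \<noteq> {}" using restrict_Hom[OF equiv_hom_const[OF assms(2)] assms(1)] by blast
    fix x y assume "x \<in> (\<lambda>f. f v) ` Hom W S" "y \<in> (\<lambda>f. f v) ` Hom W S"
    then obtain f g where fg: "f \<in> Hom W S" "g \<in> Hom W S" "x = f v" "y = g v" by auto
    show "inv x \<in> (\<lambda>f. f v) ` Hom W S"
      by (rule image_eqI[OF _ restrict_Hom[OF equiv_hom_inverse_value[OF HomD(1)[OF fg(1)] assms(2)] assms(1)]])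
        (use fg(3) assms(3) in simp)
    show "x \<otimes> y \<in> (\<lambda>f. f v) ` Hom W S"
      by (rule image_eqI[OF _ restrict_Hom[OF equiv_hom_mult[OF HomD(1)[OF fg(1)] HomD(1)[OF fg(2)] assms(2)] assms(1)]])
        (use fg(3,4) assms(3) in simp)
  qed
qed

lemma Hom_orbit_card:
  assumes "irred W" "invariant S" "w \<in> W" "w \<noteq> \<one>"
  shows "card ((\<lambda>f. f w) ` Hom W S) = card (Hom W S)"
  by (rule card_image, rule inj_onI) (use Hom_eqI[OF assms(1,2)] assms(3,4) in blast)

lemma endo_inverse:
  assumes "irred W" "f \<in> Hom W W" "v \<in> W" "f v \<noteq> \<one>"
  obtains g where "g \<in> Hom W W" "\<And>x. x \<in> W \<Longrightarrow> g (f x) = x" "\<And>x. x \<in> W \<Longrightarrow> f (g x) = x"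
proof -
  note iW = irredD(1)[OF assms(1)]
  note f = HomD(1)[OF assms(2)]
  have bij: "bij_betw f W W" by (rule schur[OF assms(1,1) f assms(3,4)])
  define g where "g = restrict (inv_into W f) W"
  show ?thesis
  proof (rule that)
    show "g \<in> Hom W W" unfolding g_def by (rule restrict_Hom[OF equiv_hom_inv_into[OF f bij iW] iW])
    show "g (f x) = x" "f (g x) = x" if "x \<in> W" for x
      using bij that equiv_homD(1)[OF f that] by (auto simp: g_def bij_betw_def f_inv_into_f)
  qed
qed

text \<open>With \<open>q\<close> the number of endomorphisms of \<open>W\<close> and \<open>w'\<close> outside the orbit of \<open>w\<close>, the orbits of \<open>w\<close>
  and \<open>w'\<close> are independent subgroups of order \<open>q\<close>, because nonzero endomorphisms are invertible;
  so \<open>q\<^sup>2 \<le> p\<^sup>e\<close>. For a submodule \<open>S\<close> of order \<open>p\<^sup>d\<^sup>+\<^sup>e\<close>, that is with \<open>k + 1 = d / e + 1\<close> summands, the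
  subgroup \<open>L\<close> of the values at \<open>w\<close> of the equivariant maps \<open>W \<rightarrow> S\<close> has order at most
  \<open>q\<^sup>k\<^sup>+\<^sup>1 \<le> q\<^sup>2\<^sup>k \<le> p\<^sup>d\<close>. But \<open>L\<close> meets all irreducible submodules of \<open>S\<close>, and an invariant complement
  of a subgroup of order \<open>p\<^sup>d\<close> between \<open>L\<close> and \<open>S\<close> has to contain one of them.\<close>

lemma endo_transitive:
  assumes compl: "complementing d" and d: "0 < d" "d < n" and W: "irred W" "card W = p ^ e" "0 < e"
    and iso: "\<And>U. irred U \<Longrightarrow> isom W U" and dvd: "e dvd n" "e dvd d"
    and w: "w \<in> W" "w \<noteq> \<one>"
  shows "(\<lambda>f. f w) ` Hom W W = W"
proof (rule ccontr)
  assume proper: "(\<lambda>f. f w) ` Hom W W \<noteq> W"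
  note iW = irredD(1)[OF W(1)]
  define q where "q = card (Hom W W)"
  have card_irred: "card U = p ^ e" if "irred U" for U using isom_card[OF iso[OF that]] W(2) by simp
  have "q * q \<le> p ^ e"
  proof -
    define L where "L v = (\<lambda>f. f v) ` Hom W W" for v
    have L: "subgroup (L v) V" "L v \<subseteq> W" if "v \<in> W" for v using Hom_orbit_subgroup[OF iW iW that] by (simp_all add: L_def)
    obtain w' where w': "w' \<in> W" "w' \<notin> L w" using proper L(2)[OF w(1)] by (auto simp: L_def)
    have "w' \<noteq> \<one>" using w'(2) subgroup.one_closed[OF L(1)[OF w(1)]] by blast
    have "L w \<inter> L w' = {\<one>}"
    proof (rule disjointI[OF L(1)[OF w(1)] L(1)[OF w'(1)]], rule ccontr)
      fix x assume x: "x \<in> L w" "x \<in> L w'" "x \<noteq> \<one>"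
      then obtain f f' where f: "f \<in> Hom W W" "x = f w" "f' \<in> Hom W W" "x = f' w'" by (auto simp: L_def)
      have "f' w' \<noteq> \<one>" using f(4) x(3) by simp
      then obtain g where g: "g \<in> Hom W W" "\<And>y. y \<in> W \<Longrightarrow> g (f' y) = y"
        using endo_inverse[OF W(1) f(3) w'(1)] by blast
      have "w' = g (f w)" using g(2)[OF w'(1)] f by simp
      also have "\<dots> = restrict (\<lambda>v. g (f v)) W w" using w(1) by simp
      finally have "w' \<in> L w"
        unfolding L_def using restrict_Hom[OF equiv_hom_comp[OF HomD(1)[OF f(1)] HomD(1)[OF g(1)]] iW] by blast
      with w'(2) show False by blast
    qed
    then have "card (L w <#> L w') = q * q"
      using card_set_mult[OF L(1)[OF w(1)] L(1)[OF w'(1)]] Hom_orbit_card[OF W(1) iW] w w'(1) \<open>w' \<noteq> \<one>\<close>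
      by (simp add: L_def q_def)
    moreover have "L w <#> L w' \<subseteq> W"
      using set_mult_least[OF invariant_subgroup[OF iW]] L(2) w(1) w'(1) by blast
    ultimately show ?thesis using card_mono[OF sub_finite[OF invariant_subgroup[OF iW]]] W(2) by metis
  qed
  obtain k where k: "d = e * k" using dvd(2) by blast
  obtain m where m: "n = e * m" using dvd(1) by blast
  have "k < m" "0 < k" using d k m by auto
  then have "e * Suc k \<le> n" unfolding m by (intro mult_left_mono) auto
  then obtain S where S: "invariant S" "card S = p ^ (e * Suc k)"
    using ex_invariant_of_card[OF card_irred _ W(3)] by blast
  note sS = invariant_subgroup[OF S(1)]
  define L where "L = (\<lambda>f. f w) ` Hom W S"
  have L: "subgroup L V" "L \<subseteq> S" using Hom_orbit_subgroup[OF iW S(1) w(1)] by (simp_all add: L_def)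
  have "card L \<le> q ^ Suc k"
    using Hom_orbit_card[OF W(1) S(1) w] card_Hom_le[OF W(1,2) S iso] by (simp add: L_def q_def)
  also have "\<dots> \<le> (q * q) ^ k"
  proof -
    have "q > 0" using restrict_Hom[OF equiv_hom_id iW] finite_Hom[OF iW iW] by (auto simp: q_def card_gt_0_iff)
    then have "q ^ Suc k \<le> q ^ (2 * k)" using \<open>0 < k\<close> by (intro power_increasing) auto
    then show ?thesis by (simp add: power_mult power2_eq_square)
  qed
  also have "\<dots> \<le> (p ^ e) ^ k" using \<open>q * q \<le> p ^ e\<close> by (rule power_mono) simp
  finally have "card L \<le> p ^ d" by (simp add: k power_mult)
  moreover obtain l where l: "card L = p ^ l" using subgroup_card[OF L(1)] by blast
  ultimately have "l \<le> d" using p_gt_1 by simp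
  then obtain A where A: "subgroup A V" "L \<subseteq> A" "A \<subseteq> S" "card A = p ^ d"
    using ex_subgroup_between[OF L(1) sS L(2) l S(2), of d] k by auto
  then obtain U where U: "invariant U" "A \<inter> U = {\<one>}" "A <#> U = carrier V"
    using compl unfolding complementing_def by blast
  note sU = invariant_subgroup[OF U(1)]
  have "U \<inter> S \<noteq> {\<one>}"
  proof
    assume "U \<inter> S = {\<one>}"
    then have "card U * card S \<le> p ^ n"
      using card_set_mult[OF sU sS] card_mono[OF finite_V subgroup.subset[OF mult_subgroups[OF sU sS]]] order_V
      by (simp add: order_def)
    moreover have "p ^ d * card U = p ^ n"
      using card_set_mult[OF A(1) sU U(2)] U(3) A(4) order_V by (simp add: order_def)
    moreover have "card S = p ^ d * p ^ e" using S(2) k by (simp add: power_add[symmetric] add.commute)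
    ultimately have "p ^ n * p ^ e \<le> p ^ n" by (metis mult.assoc mult.commute)
    moreover have "1 < p ^ e" "0 < p ^ n" using one_less_power[OF p_gt_1 W(3)] p_gt_1 by simp_all
    ultimately show False by simp
  qed
  then obtain Z where Z: "irred Z" "Z \<subseteq> U \<inter> S" using ex_irred[OF invariant_inter[OF U(1) S(1)]] by blast
  note iZ = irredD(1)[OF Z(1)]
  obtain f where f: "equiv_hom f W Z" "bij_betw f W Z" using iso[OF Z(1)] by (auto simp: isom_def)
  have "restrict f W \<in> Hom W S" by (rule restrict_Hom[OF equiv_hom_mono[OF f(1)] iW]) (use Z in auto)
  then have "f w \<in> L" unfolding L_def by (rule image_eqI[rotated]) (use w in simp)
  moreover have "f w \<in> U" using equiv_homD(1)[OF f(1) w(1)] Z(2) by blast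
  ultimately have "f w = \<one>" using A(2) U(2) by blast
  moreover have "f \<one> = \<one>" by (rule equiv_hom_one[OF f(1) invariant_subgroup[OF iW] invariant_subgroup[OF iZ]])
  ultimately have "w = \<one>"
    using inj_onD[OF bij_betw_imp_inj_on[OF f(2)], of w \<one>] w(1) subgroup.one_closed[OF invariant_subgroup[OF iW]] by simp
  with w(2) show False by blast
qed

section \<open>The endomorphism ring of an irreducible submodule\<close>

definition endo_ring :: "'a set \<Rightarrow> ('a \<Rightarrow> 'a) ring" where
  "endo_ring W = \<lparr>carrier = Hom W W, monoid.mult = compose W, one = (\<lambda>x\<in>W. x),
     ring.zero = (\<lambda>x\<in>W. \<one>), ring.add = (\<lambda>f g. \<lambda>x\<in>W. f x \<otimes> g x)\<rparr>"

lemma endo_ring_simps: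
  "carrier (endo_ring W) = Hom W W" "f \<otimes>\<^bsub>endo_ring W\<^esub> g = compose W f g"
  "\<one>\<^bsub>endo_ring W\<^esub> = (\<lambda>x\<in>W. x)" "\<zero>\<^bsub>endo_ring W\<^esub> = (\<lambda>x\<in>W. \<one>)"
  "f \<oplus>\<^bsub>endo_ring W\<^esub> g = (\<lambda>x\<in>W. f x \<otimes> g x)"
  by (simp_all add: endo_ring_def)

lemma endo_ring_closed:
  assumes iW: "invariant W" and fg: "f \<in> Hom W W" "g \<in> Hom W W"
  shows "compose W f g \<in> Hom W W" "(\<lambda>x\<in>W. x) \<in> Hom W W" "(\<lambda>x\<in>W. \<one>) \<in> Hom W W"
    "(\<lambda>x\<in>W. f x \<otimes> g x) \<in> Hom W W" "(\<lambda>x\<in>W. inv (f x)) \<in> Hom W W"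
  using restrict_Hom[OF equiv_hom_comp[OF HomD(1)[OF fg(2)] HomD(1)[OF fg(1)]] iW]
    restrict_Hom[OF equiv_hom_id iW] restrict_Hom[OF equiv_hom_const[OF iW] iW]
    restrict_Hom[OF equiv_hom_mult[OF HomD(1)[OF fg(1)] HomD(1)[OF fg(2)] iW] iW]
    restrict_Hom[OF equiv_hom_inverse_value[OF HomD(1)[OF fg(1)] iW] iW]
  by (simp_all add: compose_def)

lemma endo_ring_ring:
  assumes iW: "invariant W" shows "ring (endo_ring W)"
proof -
  note [simp] = endo_ring_simps
  have m: "f x \<in> W" "f x \<in> carrier V" if "f \<in> Hom W W" "x \<in> W" for f x
    using equiv_homD(1)[OF HomD(1)[OF that(1)] that(2)] invariant_mem[OF iW] by auto
  have ext: "f = g" if "f \<in> Hom W W" "g \<in> Hom W W" "\<And>x. x \<in> W \<Longrightarrow> f x = g x" for f g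
    by (rule extensionalityI[OF HomD(2)[OF that(1)] HomD(2)[OF that(2)]]) (use that(3) in blast)
  have wm: "x \<otimes> y \<in> W" if "x \<in> W" "y \<in> W" for x y using subgroup.m_closed[OF invariant_subgroup[OF iW] that] .
  have wo: "\<one> \<in> W" using subgroup.one_closed[OF invariant_subgroup[OF iW]] .
  note cl = endo_ring_closed[OF iW]
  show ?thesis
  proof (rule ringI)
    show "abelian_group (endo_ring W)"
    proof (rule abelian_groupI)
      fix f assume f: "f \<in> carrier (endo_ring W)"
      show "\<exists>g\<in>carrier (endo_ring W). g \<oplus>\<^bsub>endo_ring W\<^esub> f = \<zero>\<^bsub>endo_ring W\<^esub>"
        by (rule bexI[of _ "\<lambda>x\<in>W. inv (f x)"]) (use f m cl[of f f] in \<open>auto intro: ext\<close>)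
    next
      fix f g assume fg: "f \<in> carrier (endo_ring W)" "g \<in> carrier (endo_ring W)"
      show "f \<oplus>\<^bsub>endo_ring W\<^esub> g = g \<oplus>\<^bsub>endo_ring W\<^esub> f"
        by (rule ext) (use fg m cl in \<open>auto simp: m_comm\<close>)
      show "f \<oplus>\<^bsub>endo_ring W\<^esub> g \<in> carrier (endo_ring W)" using fg cl by simp
      fix h assume h: "h \<in> carrier (endo_ring W)"
      show "f \<oplus>\<^bsub>endo_ring W\<^esub> g \<oplus>\<^bsub>endo_ring W\<^esub> h = f \<oplus>\<^bsub>endo_ring W\<^esub> (g \<oplus>\<^bsub>endo_ring W\<^esub> h)"
        unfolding endo_ring_simps
      proof (rule ext)
        show "(\<lambda>x\<in>W. (\<lambda>x\<in>W. f x \<otimes> g x) x \<otimes> h x) \<in> Hom W W" using cl(4)[OF cl(4)] fg h by simp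
        show "(\<lambda>x\<in>W. f x \<otimes> (\<lambda>x\<in>W. g x \<otimes> h x) x) \<in> Hom W W" using cl(4)[OF _ cl(4)] fg h by simp
      qed (use fg h m in \<open>simp add: m_assoc\<close>)
    next
      show "\<zero>\<^bsub>endo_ring W\<^esub> \<in> carrier (endo_ring W)"
        using restrict_Hom[OF equiv_hom_const[OF iW] iW] by simp
      fix f assume f: "f \<in> carrier (endo_ring W)"
      show "\<zero>\<^bsub>endo_ring W\<^esub> \<oplus>\<^bsub>endo_ring W\<^esub> f = f"
        unfolding endo_ring_simps
      proof (rule ext)
        show "(\<lambda>x\<in>W. (\<lambda>x\<in>W. \<one>) x \<otimes> f x) \<in> Hom W W" using cl(4)[OF cl(3)] f by simp
      qed (use f m in simp_all)
    qed
    show "Group.monoid (endo_ring W)"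
    proof (rule Group.monoidI)
      show "\<one>\<^bsub>endo_ring W\<^esub> \<in> carrier (endo_ring W)"
        using restrict_Hom[OF equiv_hom_id iW] by simp
      fix f g assume fg: "f \<in> carrier (endo_ring W)" "g \<in> carrier (endo_ring W)"
      show "f \<otimes>\<^bsub>endo_ring W\<^esub> g \<in> carrier (endo_ring W)" using fg cl by simp
      fix h assume h: "h \<in> carrier (endo_ring W)"
      show "f \<otimes>\<^bsub>endo_ring W\<^esub> g \<otimes>\<^bsub>endo_ring W\<^esub> h = f \<otimes>\<^bsub>endo_ring W\<^esub> (g \<otimes>\<^bsub>endo_ring W\<^esub> h)"
        using h m by (simp add: compose_def fun_eq_iff restrict_def)
    next
      fix f assume f: "f \<in> carrier (endo_ring W)"
      show "\<one>\<^bsub>endo_ring W\<^esub> \<otimes>\<^bsub>endo_ring W\<^esub> f = f" "f \<otimes>\<^bsub>endo_ring W\<^esub> \<one>\<^bsub>endo_ring W\<^esub> = f"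
        using f m HomD(2)[of f W W] by (auto simp: compose_def fun_eq_iff restrict_def extensional_def)
    qed
    fix f g h
    assume fgh: "f \<in> carrier (endo_ring W)" "g \<in> carrier (endo_ring W)" "h \<in> carrier (endo_ring W)"
    show "(f \<oplus>\<^bsub>endo_ring W\<^esub> g) \<otimes>\<^bsub>endo_ring W\<^esub> h =
        f \<otimes>\<^bsub>endo_ring W\<^esub> h \<oplus>\<^bsub>endo_ring W\<^esub> g \<otimes>\<^bsub>endo_ring W\<^esub> h"
      using fgh m by (simp add: compose_def fun_eq_iff restrict_def)
    show "h \<otimes>\<^bsub>endo_ring W\<^esub> (f \<oplus>\<^bsub>endo_ring W\<^esub> g) =
        h \<otimes>\<^bsub>endo_ring W\<^esub> f \<oplus>\<^bsub>endo_ring W\<^esub> h \<otimes>\<^bsub>endo_ring W\<^esub> g"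
      using fgh m equiv_homD(2)[OF HomD(1)[of h W W]] by (simp add: compose_def fun_eq_iff restrict_def)
  qed
qed

lemma endo_ring_division:
  assumes W: "irred W" shows "finite_division_ring (endo_ring W)"
proof -
  note iW = irredD(1)[OF W]
  interpret R: ring "endo_ring W" by (rule endo_ring_ring[OF iW])
  obtain w where w: "w \<in> W" "w \<noteq> \<one>" by (rule irred_nonzero[OF W])
  have "Units (endo_ring W) = carrier (endo_ring W) - {\<zero>\<^bsub>endo_ring W\<^esub>}"
  proof
    show "Units (endo_ring W) \<subseteq> carrier (endo_ring W) - {\<zero>\<^bsub>endo_ring W\<^esub>}"
    proof
      fix f assume f: "f \<in> Units (endo_ring W)"
      then obtain g where g: "g \<in> carrier (endo_ring W)" "f \<otimes>\<^bsub>endo_ring W\<^esub> g = \<one>\<^bsub>endo_ring W\<^esub>"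
        by (auto simp: Units_def)
      have "f \<noteq> \<zero>\<^bsub>endo_ring W\<^esub>"
      proof
        assume "f = \<zero>\<^bsub>endo_ring W\<^esub>"
        then have "\<zero>\<^bsub>endo_ring W\<^esub> = \<one>\<^bsub>endo_ring W\<^esub>" using g by simp
        then have "(\<lambda>x\<in>W. \<one>) w = (\<lambda>x\<in>W. x) w" unfolding endo_ring_simps by simp
        with w show False by simp
      qed
      with f show "f \<in> carrier (endo_ring W) - {\<zero>\<^bsub>endo_ring W\<^esub>}" by (simp add: R.Units_closed)
    qed
    show "carrier (endo_ring W) - {\<zero>\<^bsub>endo_ring W\<^esub>} \<subseteq> Units (endo_ring W)"
    proof
      fix f assume f: "f \<in> carrier (endo_ring W) - {\<zero>\<^bsub>endo_ring W\<^esub>}"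
      then have fH: "f \<in> Hom W W" by (simp add: endo_ring_simps)
      have "\<exists>v\<in>W. f v \<noteq> \<one>"
      proof (rule ccontr)
        assume "\<not> ?thesis"
        then have "f = (\<lambda>x\<in>W. \<one>)" using HomD(2)[OF fH] by (auto simp: extensional_def fun_eq_iff)
        with f show False by (simp add: endo_ring_simps)
      qed
      then obtain g where g: "g \<in> Hom W W" "\<And>x. x \<in> W \<Longrightarrow> g (f x) = x" "\<And>x. x \<in> W \<Longrightarrow> f (g x) = x"
        using endo_inverse[OF W fH] by blast
      have "g \<otimes>\<^bsub>endo_ring W\<^esub> f = \<one>\<^bsub>endo_ring W\<^esub>" "f \<otimes>\<^bsub>endo_ring W\<^esub> g = \<one>\<^bsub>endo_ring W\<^esub>"
        using g by (auto simp: endo_ring_simps compose_def fun_eq_iff restrict_def)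
      with f g(1) show "f \<in> Units (endo_ring W)" by (auto simp: Units_def endo_ring_simps)
    qed
  qed
  moreover have "finite (carrier (endo_ring W))" using finite_Hom[OF iW iW] by (simp add: endo_ring_simps)
  ultimately show ?thesis by unfold_locales
qed

lemma endo_commute:
  assumes "irred W" "f \<in> Hom W W" "g \<in> Hom W W" "x \<in> W" shows "f (g x) = g (f x)"
proof -
  interpret D: finite_division_ring "endo_ring W" by (rule endo_ring_division[OF assms(1)])
  have "compose W f g = compose W g f"
    using D.wedderburn[of f g] assms(2,3) by (simp add: endo_ring_simps)
  then show ?thesis using assms(4) by (metis compose_eq)
qed

text \<open>On \<open>w\<close>, the element \<open>h\<close> acts like some endomorphism \<open>f\<close>. Every vector of \<open>W\<close> has the form \<open>g w\<close> with
  an endomorphism \<open>g\<close>, and \<open>g\<close> commutes with \<open>h\<close> by equivariance and with \<open>f\<close> by Wedderburn's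
  theorem, so \<open>h\<close> acts like \<open>f\<close> on all of \<open>W\<close>.\<close>

lemma endo_transitive_act:
  assumes W: "irred W" and w: "w \<in> W" "w \<noteq> \<one>" "(\<lambda>f. f w) ` Hom W W = W" and h: "h \<in> carrier H"
  shows "restrict (act h) W \<in> Hom W W"
proof -
  note iW = irredD(1)[OF W]
  have "act h w \<in> W" by (rule invariant_act[OF iW h w(1)])
  then have "act h w \<in> (\<lambda>f. f w) ` Hom W W" by (subst w(3))
  then obtain f where f: "f \<in> Hom W W" "act h w = f w" by blast
  have "act h x = f x" if x: "x \<in> W" for x
  proof -
    have "x \<in> (\<lambda>f. f w) ` Hom W W" using x by (subst w(3))
    then obtain g where g: "g \<in> Hom W W" "x = g w" by blast
    have "act h x = g (f w)" using equiv_homD(3)[OF HomD(1)[OF g(1)] h w(1)] f(2) g(2) by simp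
    also have "\<dots> = f x" using endo_commute[OF W f(1) g(1) w(1)] g(2) by simp
    finally show ?thesis .
  qed
  then have "restrict (act h) W = f" using HomD(2)[OF f(1)] by (auto simp: fun_eq_iff restrict_def extensional_def)
  with f(1) show ?thesis by simp
qed

lemma fixes_isotypic:
  assumes W: "isotypic W" and h: "h \<in> carrier H" and fix_W: "\<And>x. x \<in> W \<Longrightarrow> act h x = x"
    and v: "v \<in> carrier V"
  shows "act h v = v"
proof -
  define S where "S = {v \<in> carrier V. act h v = v}"
  have S: "subgroup S V"
    by (rule subgroupI) (use h in \<open>auto simp: S_def act_mult act_inv act_one intro!: exI[of _ \<one>]\<close>)
  have "U \<subseteq> S" if U: "irred U" "isom W U" for U
  proof
    fix u assume u: "u \<in> U"
    obtain F where F: "equiv_hom F W U" "bij_betw F W U" using U(2) by (auto simp: isom_def)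
    then obtain x where x: "x \<in> W" "u = F x" using u by (auto simp: bij_betw_def)
    have "act h u = u" using equiv_homD(3)[OF F(1) h x(1)] fix_W[OF x(1)] x(2) by simp
    with invariant_mem[OF irredD(1)[OF U(1)] u] show "u \<in> S" by (simp add: S_def)
  qed
  then have "S = carrier V" using W S unfolding isotypic_def by blast
  with v show ?thesis by (auto simp: S_def)
qed

text \<open>Restriction to \<open>W\<close> embeds \<open>H\<close> into the multiplicative group of the finite field of endomorphisms
  of \<open>W\<close>.\<close>

lemma cyclic_of_transitive:
  assumes W: "isotypic W" and w: "w \<in> W" "w \<noteq> \<one>" "(\<lambda>f. f w) ` Hom W W = W"
    and faithful: "\<And>h. h \<in> carrier H \<Longrightarrow> (\<And>v. v \<in> carrier V \<Longrightarrow> act h v = v) \<Longrightarrow> h = \<one>\<^bsub>H\<^esub>"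
  shows "cyclic_group H"
proof -
  have irrW: "irred W" using W by (simp add: isotypic_def)
  note iW = irredD(1)[OF irrW]
  interpret D: finite_division_ring "endo_ring W" by (rule endo_ring_division[OF irrW])
  interpret K: field "endo_ring W"
  proof (rule cring.cring_fieldI)
    show "cring (endo_ring W)"
      by (rule cring.intro[OF D.ring_axioms], rule D.monoid_comm_monoidI)
        (rule D.wedderburn)
  qed (rule D.Units_eq)
  define \<rho> where "\<rho> h = restrict (act h) W" for h
  have \<rho>: "\<rho> h \<in> carrier (endo_ring W)" if "h \<in> carrier H" for h
    using endo_transitive_act[OF irrW w that] by (simp add: \<rho>_def endo_ring_simps)
  have \<rho>_mult: "\<rho> (h \<otimes>\<^bsub>H\<^esub> k) = \<rho> h \<otimes>\<^bsub>endo_ring W\<^esub> \<rho> k" if "h \<in> carrier H" "k \<in> carrier H" for h k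
    using that invariant_act[OF iW] invariant_mem[OF iW]
    by (auto simp: \<rho>_def endo_ring_simps compose_def fun_eq_iff restrict_def act_comp)
  have \<rho>_one: "\<rho> \<one>\<^bsub>H\<^esub> = \<one>\<^bsub>endo_ring W\<^esub>"
    using act_id invariant_mem[OF iW] by (auto simp: \<rho>_def endo_ring_simps fun_eq_iff restrict_def)
  have \<rho>_nz: "\<rho> h \<noteq> \<zero>\<^bsub>endo_ring W\<^esub>" if h: "h \<in> carrier H" for h
  proof
    assume z: "\<rho> h = \<zero>\<^bsub>endo_ring W\<^esub>"
    have "\<one>\<^bsub>endo_ring W\<^esub> = \<rho> h \<otimes>\<^bsub>endo_ring W\<^esub> \<rho> (inv\<^bsub>H\<^esub> h)"
      using h by (simp add: \<rho>_mult[symmetric] \<rho>_one)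
    then show False using z \<rho>[of "inv\<^bsub>H\<^esub> h"] h D.one_nonzero by simp
  qed
  have \<rho>_inj: "h = \<one>\<^bsub>H\<^esub>" if h: "h \<in> carrier H" "\<rho> h = \<one>\<^bsub>endo_ring W\<^esub>" for h
  proof (rule faithful[OF h(1)])
    have "act h x = x" if "x \<in> W" for x
      using fun_cong[OF h(2), of x] that by (simp add: \<rho>_def endo_ring_simps)
    then show "act h v = v" if "v \<in> carrier V" for v
      using fixes_isotypic[OF W h(1) _ that] by blast
  qed
  interpret M: group "Multiplicative_Group.mult_of (endo_ring W)" by (rule K.field_mult_group)
  obtain g where g: "g \<in> carrier (Multiplicative_Group.mult_of (endo_ring W))"
    "carrier (Multiplicative_Group.mult_of (endo_ring W)) = {g [^]\<^bsub>endo_ring W\<^esub> i |i::nat. i \<in> UNIV}"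
    using K.finite_field_mult_group_has_gen[OF D.finite_carrier] by (rule bexE)
  have "cyclic_group (Multiplicative_Group.mult_of (endo_ring W))"
    unfolding M.cyclic_group
  proof (rule bexI[OF _ g(1)], intro equalityI subsetI)
    fix f assume "f \<in> carrier (Multiplicative_Group.mult_of (endo_ring W))"
    then obtain i :: nat where "f = g [^]\<^bsub>endo_ring W\<^esub> i" unfolding g(2) by blast
    then have "f = g [^]\<^bsub>Multiplicative_Group.mult_of (endo_ring W)\<^esub> int i"
      by (simp only: int_pow_int Multiplicative_Group.nat_pow_mult_of)
    then show "f \<in> range (\<lambda>i::int. g [^]\<^bsub>Multiplicative_Group.mult_of (endo_ring W)\<^esub> i)" by blast
  next
    fix f assume "f \<in> range (\<lambda>i::int. g [^]\<^bsub>Multiplicative_Group.mult_of (endo_ring W)\<^esub> i)"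
    then obtain i :: int where "f = g [^]\<^bsub>Multiplicative_Group.mult_of (endo_ring W)\<^esub> i" by blast
    then show "f \<in> carrier (Multiplicative_Group.mult_of (endo_ring W))" using M.int_pow_closed[OF g(1)] by simp
  qed
  moreover have hom: "\<rho> \<in> hom H (Multiplicative_Group.mult_of (endo_ring W))"
    using \<rho> \<rho>_nz \<rho>_mult by (auto simp: hom_def)
  moreover have "inj_on \<rho> (carrier H)"
  proof -
    interpret \<rho>: group_hom H "Multiplicative_Group.mult_of (endo_ring W)" \<rho> by unfold_locales (rule hom)
    have "kernel H (Multiplicative_Group.mult_of (endo_ring W)) \<rho> = {\<one>\<^bsub>H\<^esub>}"
      using \<rho>_inj \<rho>_one by (auto simp: kernel_def)
    then show ?thesis by (simp add: \<rho>.inj_iff_trivial_ker)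
  qed
  ultimately show ?thesis using cyclic_group_injective[OF H.is_group M.is_group] by blast
qed

section \<open>Direct decompositions\<close>

lemma ex_direct_decomposition:
  assumes "invariant S"
  shows "\<exists>(m::nat) W. (\<forall>i<m. irred (W i)) \<and>
     bij_betw (\<lambda>x. finprod V x {..<m}) (\<Pi>\<^sub>E i\<in>{..<m}. W i) S"
  using assms
proof (induction "card S" arbitrary: S rule: less_induct)
  case less
  show ?case
  proof (cases "S = {\<one>}")
    case True
    then show ?thesis by (intro exI[of _ 0]) (simp add: bij_betw_def)
  next
    case False
    obtain U C where UC: "irred U" "U \<subseteq> S" "invariant C" "C \<subseteq> S" "U \<inter> C = {\<one>}" "U <#> C = S"
      "card C < card S"
      using irred_decompose[OF less.prems False] by metis
    have iU: "invariant U" using irredD(1)[OF UC(1)] .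
    from less.hyps[OF UC(7,3)] obtain m :: nat and W where mW: "\<forall>i<m. irred (W i)"
      "bij_betw (\<lambda>x. finprod V x {..<m}) (\<Pi>\<^sub>E i\<in>{..<m}. W i) C" by blast
    define W' where "W' = W(m := U)"
    have W'_lt: "W' i = W i" if "i < m" for i using that by (simp add: W'_def)
    have W'_m: "W' m = U" by (simp add: W'_def)
    have split: "x m \<in> U" "restrict x {..<m} \<in> (\<Pi>\<^sub>E i\<in>{..<m}. W i)"
      "finprod V x {..<Suc m} = x m \<otimes> finprod V (restrict x {..<m}) {..<m}"
      "finprod V (restrict x {..<m}) {..<m} \<in> C"
      if x: "x \<in> (\<Pi>\<^sub>E i\<in>{..<Suc m}. W' i)" for x
    proof -
      show xm: "x m \<in> U" using PiE_mem[OF x, of m] W'_m by simp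
      have lt: "x i \<in> W i" if "i < m" for i using PiE_mem[OF x, of i] W'_lt[OF that] that by simp
      then show r: "restrict x {..<m} \<in> (\<Pi>\<^sub>E i\<in>{..<m}. W i)" by auto
      have ltV: "x i \<in> carrier V" if "i < m" for i using lt[OF that] mW(1) that irredD(1) invariant_mem by blast
      have "finprod V x {..<Suc m} = x m \<otimes> finprod V x {..<m}"
        unfolding lessThan_Suc using ltV xm invariant_mem[OF iU] by (intro finprod_insert) auto
      also have "finprod V x {..<m} = finprod V (restrict x {..<m}) {..<m}"
        by (rule finprod_cong') (use ltV in auto)
      finally show "finprod V x {..<Suc m} = x m \<otimes> finprod V (restrict x {..<m}) {..<m}" .
      show "finprod V (restrict x {..<m}) {..<m} \<in> C" using mW(2) r by (auto simp: bij_betw_def)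
    qed
    have "bij_betw (\<lambda>x. finprod V x {..<Suc m}) (\<Pi>\<^sub>E i\<in>{..<Suc m}. W' i) S"
      unfolding bij_betw_def
    proof
      show "inj_on (\<lambda>x. finprod V x {..<Suc m}) (\<Pi>\<^sub>E i\<in>{..<Suc m}. W' i)"
      proof (rule inj_onI)
        fix x y assume xy: "x \<in> (\<Pi>\<^sub>E i\<in>{..<Suc m}. W' i)" "y \<in> (\<Pi>\<^sub>E i\<in>{..<Suc m}. W' i)"
          "finprod V x {..<Suc m} = finprod V y {..<Suc m}"
        note sx = split[OF xy(1)] and sy = split[OF xy(2)]
        have eq: "x m \<otimes> finprod V (restrict x {..<m}) {..<m} = y m \<otimes> finprod V (restrict y {..<m}) {..<m}"
          using xy(3) sx(3) sy(3) by simp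
        note u = disjoint_unique[OF invariant_subgroup[OF iU] invariant_subgroup[OF UC(3)] UC(5) sx(1) sy(1) sx(4) sy(4) eq]
        have r: "restrict x {..<m} = restrict y {..<m}"
          using bij_betw_imp_inj_on[OF mW(2)] u(2) sx(2) sy(2) by (simp add: inj_on_def)
        show "x = y"
        proof (rule PiE_ext[OF xy(1,2)])
          fix i assume "i \<in> {..<Suc m}"
          then consider "i = m" | "i < m" by (auto simp: less_Suc_eq)
          then show "x i = y i" using u(1) fun_cong[OF r, of i] by cases auto
        qed
      qed
      show "(\<lambda>x. finprod V x {..<Suc m}) ` (\<Pi>\<^sub>E i\<in>{..<Suc m}. W' i) = S"
      proof
        show "(\<lambda>x. finprod V x {..<Suc m}) ` (\<Pi>\<^sub>E i\<in>{..<Suc m}. W' i) \<subseteq> S"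
        proof
          fix s assume "s \<in> (\<lambda>x. finprod V x {..<Suc m}) ` (\<Pi>\<^sub>E i\<in>{..<Suc m}. W' i)"
          then obtain x where x: "x \<in> (\<Pi>\<^sub>E i\<in>{..<Suc m}. W' i)" "s = finprod V x {..<Suc m}" by blast
          have "s \<in> U <#> C" unfolding set_mult_iff x(2) using split(1,3,4)[OF x(1)] by blast
          then show "s \<in> S" using UC(6) by simp
        qed
        show "S \<subseteq> (\<lambda>x. finprod V x {..<Suc m}) ` (\<Pi>\<^sub>E i\<in>{..<Suc m}. W' i)"
        proof
          fix s assume "s \<in> S"
          then obtain u c where uc: "u \<in> U" "c \<in> C" "s = u \<otimes> c" using UC(6) by (auto simp: set_mult_iff)
          obtain y where y: "y \<in> (\<Pi>\<^sub>E i\<in>{..<m}. W i)" "c = finprod V y {..<m}"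
            using mW(2) uc(2) by (auto simp: bij_betw_def)
          define x where "x = y(m := u)"
          have x: "x \<in> (\<Pi>\<^sub>E i\<in>{..<Suc m}. W' i)"
            using y(1) uc(1) by (auto simp: x_def W'_def PiE_def extensional_def Pi_iff less_Suc_eq)
          have "restrict x {..<m} = y" using y(1) by (auto simp: x_def fun_eq_iff PiE_def extensional_def restrict_def)
          then have "finprod V x {..<Suc m} = s" using split(3)[OF x] y(2) uc(3) by (simp add: x_def)
          with x show "s \<in> (\<lambda>x. finprod V x {..<Suc m}) ` (\<Pi>\<^sub>E i\<in>{..<Suc m}. W' i)" by blast
        qed
      qed
    qed
    moreover have "\<forall>i<Suc m. irred (W' i)" using mW(1) UC(1) by (auto simp: W'_def less_Suc_eq)
    ultimately show ?thesis by blast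
  qed
qed

lemma isotypic_of_direct_decomposition:
  assumes "\<And>i. i < m \<Longrightarrow> irred (W i)" "\<And>i j. i < m \<Longrightarrow> j < m \<Longrightarrow> isom (W i) (W j)"
    and bij: "bij_betw (\<lambda>x. finprod V x {..<m}) (\<Pi>\<^sub>E i\<in>{..<m}. W i) (carrier V)" and "0 < (m::nat)"
  shows "isotypic (W 0)"
  unfolding isotypic_def
proof (intro conjI allI impI)
  fix S assume S: "subgroup S V \<and> (\<forall>U. irred U \<and> isom (W 0) U \<longrightarrow> U \<subseteq> S)"
  have "carrier V \<subseteq> S"
  proof
    fix v assume "v \<in> carrier V"
    then obtain x where x: "x \<in> (\<Pi>\<^sub>E i\<in>{..<m}. W i)" "v = finprod V x {..<m}" using bij by (auto simp: bij_betw_def)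
    have "x \<in> {..<m} \<rightarrow> S"
    proof
      fix i assume "i \<in> {..<m}"
      then have "W i \<subseteq> S" "x i \<in> W i" using S assms(1)[of i] assms(2)[of 0 i] assms(4) x(1) by (auto simp: PiE_iff)
      then show "x i \<in> S" by blast
    qed
    with x(2) show "v \<in> S" using finprod_in_subgroup S by blast
  qed
  with S show "S = carrier V" using subgroup.subset by blast
qed (use assms in auto)

section \<open>The action as a module over the prime field\<close>

lemma pow_mod_p: "v \<in> carrier V \<Longrightarrow> v [^] (k mod int p) = v [^] (k::int)"
proof -
  assume v: "v \<in> carrier V"
  have "v [^] k = v [^] (int p * (k div int p) + k mod int p)" by simp
  also have "\<dots> = (v [^] int p) [^] (k div int p) \<otimes> v [^] (k mod int p)"
    using v by (simp only: int_pow_mult int_pow_pow)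
  also have "v [^] int p = \<one>" using pow_p[OF v] by (simp add: int_pow_int)
  finally show ?thesis using v by simp
qed

lemma Fp_field: "field (residue_ring (int p))"
proof -
  interpret residues_prime p "residue_ring (int p)" by unfold_locales (rule prime_p)
  show ?thesis by (rule is_field)
qed

lemma Fp_space_simps:
  "carrier (Fp_space V) = carrier V" "\<zero>\<^bsub>Fp_space V\<^esub> = \<one>" "a \<oplus>\<^bsub>Fp_space V\<^esub> b = a \<otimes> b"
  "k \<odot>\<^bsub>Fp_space V\<^esub> a = a [^] k"
  by (simp_all add: Fp_space_def)

lemma Fp_space_module: "module (residue_ring (int p)) (Fp_space V)"
proof (rule moduleI)
  show "cring (residue_ring (int p))" using Fp_field by (rule fieldE(1))
  show "abelian_group (Fp_space V)"
  proof (rule abelian_groupI)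
    fix x assume "x \<in> carrier (Fp_space V)"
    then show "\<exists>y\<in>carrier (Fp_space V). y \<oplus>\<^bsub>Fp_space V\<^esub> x = \<zero>\<^bsub>Fp_space V\<^esub>"
      by (intro bexI[of _ "inv x"]) (auto simp: Fp_space_simps)
  qed (auto simp: Fp_space_simps m_ac)
qed (auto simp: Fp_space_simps residue_ring_def pow_mod_p int_pow_mult int_pow_distrib int_pow_pow mult.commute)

lemma submodule_iff: "Module.submodule W (residue_ring (int p)) (Fp_space V) \<longleftrightarrow> subgroup W V"
proof
  assume "Module.submodule W (residue_ring (int p)) (Fp_space V)"
  then have "subgroup W (add_monoid (Fp_space V))" by (simp add: Module.submodule_def)
  then show "subgroup W V" unfolding subgroup_def m_inv_def by (simp add: Fp_space_def)
next
  assume W: "subgroup W V"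
  then have "subgroup W (add_monoid (Fp_space V))" unfolding subgroup_def m_inv_def by (simp add: Fp_space_def)
  then show "Module.submodule W (residue_ring (int p)) (Fp_space V)"
    unfolding Module.submodule_def submodule_axioms_def
    using subgroup_int_pow_closed[OF W] by (simp add: Fp_space_simps)
qed

lemma KH_submodule_iff: "KH_submodule (residue_ring (int p)) H act (Fp_space V) W \<longleftrightarrow> invariant W"
  unfolding KH_submodule_def submodule_iff invariant_def ..

lemma irreducible_iff: "irreducible_KH_submodule (residue_ring (int p)) H act (Fp_space V) W \<longleftrightarrow> irred W"
  unfolding irreducible_KH_submodule_def KH_submodule_iff irred_def Fp_space_simps ..

text \<open>Additive maps are linear over the prime field.\<close>

lemma KH_isomorphic_iff:
  assumes W: "subgroup W V" and U: "subgroup U V"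
  shows "KH_isomorphic (residue_ring (int p)) H act (Fp_space V) W U \<longleftrightarrow> isom W U"
proof -
  have "f (w [^] k) = f w [^] k"
    if f: "f \<in> W \<rightarrow> U" "\<forall>a\<in>W. \<forall>b\<in>W. f (a \<otimes> b) = f a \<otimes> f b" and k: "k \<in> {0..int p - 1}" and w: "w \<in> W" for f w k
  proof -
    have "f \<one> \<otimes> f \<one> = f \<one>" using f(2) subgroup.one_closed[OF W] by (metis l_one one_closed)
    moreover have "f \<one> \<in> carrier V" using f(1) subgroup.one_closed[OF W] sub_mem[OF U] by auto
    ultimately have one: "f \<one> = \<one>" by (simp add: l_cancel_one')
    have "f (w [^] j) = f w [^] j \<and> w [^] j \<in> W" for j :: nat
    proof (induction j)
      case (Suc j)
      then show ?case using f(2) w subgroup.m_closed[OF W] by simp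
    qed (use one subgroup.one_closed[OF W] in simp)
    from this[of "nat k"] k show ?thesis using int_pow_int[of V _ "nat k"] by simp
  qed
  then have "f \<in> module_hom (residue_ring (int p)) (Fp_space V\<lparr>carrier := W\<rparr>) (Fp_space V\<lparr>carrier := U\<rparr>)
      \<longleftrightarrow> f \<in> W \<rightarrow> U \<and> (\<forall>a\<in>W. \<forall>b\<in>W. f (a \<otimes> b) = f a \<otimes> f b)" for f
    unfolding module_hom_def by (auto simp: Fp_space_def residue_ring_def)
  then show ?thesis unfolding KH_isomorphic_def isom_def equiv_hom_def by blast
qed

lemma internal_direct_sum_iff:
  "internal_direct_sum (Fp_space V) I W \<longleftrightarrow> bij_betw (\<lambda>x. finprod V x I) (\<Pi>\<^sub>E i\<in>I. W i) (carrier V)"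
  unfolding internal_direct_sum_def finsum_def finprod_def Fp_space_def by (simp cong: if_cong)

text \<open>Coordinates with respect to a basis.\<close>

lemma card_eq_p_power_dim:
  assumes W: "subgroup W V"
  shows "card W = p ^ vectorspace.dim (residue_ring (int p)) (Fp_space V\<lparr>carrier := W\<rparr>)"
proof -
  interpret VW: vectorspace "residue_ring (int p)" "Fp_space V\<lparr>carrier := W\<rparr>"
  proof (rule vectorspace.intro)
    show "module (residue_ring (int p)) (Fp_space V\<lparr>carrier := W\<rparr>)"
      using submodule.submodule_is_module[OF _ Fp_space_module] submodule_iff W by blast
  qed (rule Fp_field)
  have fin: "finite W" using sub_finite[OF W] .
  have "VW.fin_dim" unfolding VW.fin_dim_def
    by (rule exI[of _ W]) (use fin VW.span_is_subset2[of W] VW.in_own_span[of W] in auto)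
  then obtain B where B: "finite B" "VW.basis B" using VW.finite_basis_exists by blast
  have BW: "B \<subseteq> W" using B(2) by (simp add: VW.basis_def)
  have ex1: "\<exists>!a. a \<in> B \<rightarrow>\<^sub>E carrier (residue_ring (int p)) \<and> VW.lincomb a B = v" if "v \<in> W" for v
    using VW.basis_criterion[OF B(1)] BW B(2) that by simp
  have "bij_betw (\<lambda>a. VW.lincomb a B) (B \<rightarrow>\<^sub>E carrier (residue_ring (int p))) W"
    unfolding bij_betw_def
  proof
    have cl: "VW.lincomb a B \<in> W" if "a \<in> B \<rightarrow>\<^sub>E carrier (residue_ring (int p))" for a
      using VW.lincomb_closed[of B a] BW that by (auto simp: PiE_def)
    show "inj_on (\<lambda>a. VW.lincomb a B) (B \<rightarrow>\<^sub>E carrier (residue_ring (int p)))"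
      using ex1 cl by (intro inj_onI) blast
    show "(\<lambda>a. VW.lincomb a B) ` (B \<rightarrow>\<^sub>E carrier (residue_ring (int p))) = W"
    proof
      show "W \<subseteq> (\<lambda>a. VW.lincomb a B) ` (B \<rightarrow>\<^sub>E carrier (residue_ring (int p)))"
        using ex1 by blast
    qed (use cl in blast)
  qed
  then have "card W = card (B \<rightarrow>\<^sub>E carrier (residue_ring (int p)))" by (rule bij_betw_same_card[symmetric])
  also have "\<dots> = p ^ card B" using B(1) by (simp add: card_PiE residue_ring_def)
  also have "card B = VW.dim" using VW.dim_basis[OF B] by simp
  finally show ?thesis .
qed

section \<open>Complements in the semidirect product\<close>

abbreviation SD where "SD \<equiv> semidirect_product H V act"

lemma SD_simps:
  "carrier SD = carrier H \<times> carrier V" "\<one>\<^bsub>SD\<^esub> = (\<one>\<^bsub>H\<^esub>, \<one>)"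
  "(h, v) \<otimes>\<^bsub>SD\<^esub> (k, w) = (h \<otimes>\<^bsub>H\<^esub> k, v \<otimes> act h w)"
  by (simp_all add: semidirect_product_def)

lemma SD_group: "group SD"
proof (rule groupI)
  show "\<exists>y\<in>carrier SD. y \<otimes>\<^bsub>SD\<^esub> x = \<one>\<^bsub>SD\<^esub>" if "x \<in> carrier SD" for x
  proof (cases x)
    case (Pair h v)
    then show ?thesis using that
      by (intro bexI[of _ "(inv\<^bsub>H\<^esub> h, act (inv\<^bsub>H\<^esub> h) (inv v))"])
        (auto simp: SD_simps act_closed act_mult[symmetric] act_one)
  qed
qed (auto simp: SD_simps act_closed act_mult act_comp act_one act_id H.m_assoc m_assoc)

interpretation SD: group SD by (rule SD_group)

lemma SD_order: "order SD = order H * p ^ n"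
  using order_V by (simp add: order_def SD_simps card_cartesian_product)

lemma SD_inv_V: "v \<in> carrier V \<Longrightarrow> inv\<^bsub>SD\<^esub> (\<one>\<^bsub>H\<^esub>, v) = (\<one>\<^bsub>H\<^esub>, inv v)"
  by (intro SD.inv_equality) (auto simp: SD_simps act_id)

lemma SD_subgroup_V:
  assumes "subgroup U V" shows "subgroup ({\<one>\<^bsub>H\<^esub>} \<times> U) SD"
proof (rule SD.subgroupI)
  show "{\<one>\<^bsub>H\<^esub>} \<times> U \<noteq> {}" using subgroup.one_closed[OF assms] by blast
  show "{\<one>\<^bsub>H\<^esub>} \<times> U \<subseteq> carrier SD" using sub_mem[OF assms] by (auto simp: SD_simps)
  fix x y assume xy: "x \<in> {\<one>\<^bsub>H\<^esub>} \<times> U" "y \<in> {\<one>\<^bsub>H\<^esub>} \<times> U"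
  then show "x \<otimes>\<^bsub>SD\<^esub> y \<in> {\<one>\<^bsub>H\<^esub>} \<times> U"
    using sub_mem[OF assms] by (auto simp: SD_simps act_id subgroup.m_closed[OF assms])
  obtain u where u: "x = (\<one>\<^bsub>H\<^esub>, u)" "u \<in> U" using xy by blast
  have "inv\<^bsub>SD\<^esub> x = (\<one>\<^bsub>H\<^esub>, inv u)" using u sub_mem[OF assms u(2)] by (simp add: SD_inv_V)
  then show "inv\<^bsub>SD\<^esub> x \<in> {\<one>\<^bsub>H\<^esub>} \<times> U" using subgroup.m_inv_closed[OF assms u(2)] by simp
qed

lemma SD_subgroup_times:
  assumes L: "subgroup L H" and U: "invariant U"
  shows "subgroup (L \<times> U) SD"
proof (rule SD.subgroupI)
  note sU = invariant_subgroup[OF U]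
  show "L \<times> U \<noteq> {}" using subgroup.one_closed[OF L] subgroup.one_closed[OF sU] by blast
  show "L \<times> U \<subseteq> carrier SD" using sub_mem[OF sU] subgroup.mem_carrier[OF L] by (auto simp: SD_simps)
  fix x y assume xy: "x \<in> L \<times> U" "y \<in> L \<times> U"
  then show "x \<otimes>\<^bsub>SD\<^esub> y \<in> L \<times> U"
    using subgroup.mem_carrier[OF L] invariant_act[OF U]
    by (auto simp: SD_simps subgroup.m_closed[OF sU] subgroup.m_closed[OF L])
  obtain h u where u: "x = (h, u)" "h \<in> L" "u \<in> U" using xy by blast
  have hH: "h \<in> carrier H" and uV: "u \<in> carrier V" using u subgroup.mem_carrier[OF L] sub_mem[OF sU] by auto
  have "inv\<^bsub>SD\<^esub> x = (inv\<^bsub>H\<^esub> h, act (inv\<^bsub>H\<^esub> h) (inv u))"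
    using u(1) hH uV by (intro SD.inv_equality) (auto simp: SD_simps act_closed act_mult[symmetric] act_one)
  then show "inv\<^bsub>SD\<^esub> x \<in> L \<times> U"
    using u hH subgroup.m_inv_closed[OF L u(2)] subgroup.m_inv_closed[OF sU u(3)] invariant_act[OF U] by simp
qed

text \<open>The hypothesis says that \<open>L\<close> is normal in \<open>H\<close> and acts trivially on \<open>V\<close> modulo \<open>U\<close>.\<close>

lemma SD_normal_times:
  assumes L: "subgroup L H" and U: "invariant U"
    and "\<And>h l v. h \<in> carrier H \<Longrightarrow> v \<in> carrier V \<Longrightarrow> l \<in> L \<Longrightarrow>
      h \<otimes>\<^bsub>H\<^esub> l \<otimes>\<^bsub>H\<^esub> inv\<^bsub>H\<^esub> h \<in> L \<and> v \<otimes> inv (act (h \<otimes>\<^bsub>H\<^esub> l \<otimes>\<^bsub>H\<^esub> inv\<^bsub>H\<^esub> h) v) \<in> U"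
  shows "L \<times> U \<lhd> SD"
  unfolding SD.normal_inv_iff
proof (intro conjI ballI)
  show "subgroup (L \<times> U) SD" by (rule SD_subgroup_times[OF L U])
  fix x y assume x: "x \<in> carrier SD" and y: "y \<in> L \<times> U"
  obtain h v where hv: "x = (h, v)" "h \<in> carrier H" "v \<in> carrier V" using x by (auto simp: SD_simps)
  obtain l u where lu: "y = (l, u)" "l \<in> L" "u \<in> U" using y by blast
  have lH: "l \<in> carrier H" and uV: "u \<in> carrier V" using lu subgroup.mem_carrier[OF L] invariant_mem[OF U] by auto
  define k where "k = h \<otimes>\<^bsub>H\<^esub> l \<otimes>\<^bsub>H\<^esub> inv\<^bsub>H\<^esub> h"
  have k: "k \<in> L" "k \<in> carrier H" "v \<otimes> inv (act k v) \<in> U" "k \<otimes>\<^bsub>H\<^esub> h = h \<otimes>\<^bsub>H\<^esub> l"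
    using assms(3)[OF hv(2,3) lu(2)] subgroup.mem_carrier[OF L] hv lH by (auto simp: k_def H.m_assoc)
  define z where "z = act h u \<otimes> (v \<otimes> inv (act k v))"
  have z: "z \<in> U" unfolding z_def using invariant_act[OF U hv(2) lu(3)] k(3) by (rule subgroup.m_closed[OF invariant_subgroup[OF U]])
  have zV: "z \<in> carrier V" using invariant_mem[OF U z] .
  have "(k, z) \<otimes>\<^bsub>SD\<^esub> x = x \<otimes>\<^bsub>SD\<^esub> y"
    using hv lu lH uV k by (simp add: SD_simps z_def act_closed m_ac)
  then have "x \<otimes>\<^bsub>SD\<^esub> y \<otimes>\<^bsub>SD\<^esub> inv\<^bsub>SD\<^esub> x = (k, z)"
    using x k(2) zV by (metis SD.inv_solve_right SD.m_closed SD_simps(1) SigmaI lH lu(1) uV)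
  then show "x \<otimes>\<^bsub>SD\<^esub> y \<otimes>\<^bsub>SD\<^esub> inv\<^bsub>SD\<^esub> x \<in> L \<times> U" using k(1) z by simp
qed

lemma SD_conj_V:
  assumes "h \<in> carrier H" "w \<in> carrier V" "v \<in> carrier V"
  shows "(h, w) \<otimes>\<^bsub>SD\<^esub> (\<one>\<^bsub>H\<^esub>, v) \<otimes>\<^bsub>SD\<^esub> inv\<^bsub>SD\<^esub> (h, w) = (\<one>\<^bsub>H\<^esub>, act h v)"
proof -
  have "(\<one>\<^bsub>H\<^esub>, act h v) \<otimes>\<^bsub>SD\<^esub> (h, w) = (h, w) \<otimes>\<^bsub>SD\<^esub> (\<one>\<^bsub>H\<^esub>, v)"
    using assms by (simp add: SD_simps act_id act_closed m_comm)
  then have "(\<one>\<^bsub>H\<^esub>, act h v) = (h, w) \<otimes>\<^bsub>SD\<^esub> (\<one>\<^bsub>H\<^esub>, v) \<otimes>\<^bsub>SD\<^esub> inv\<^bsub>SD\<^esub> (h, w)"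
    using assms act_closed by (intro SD.inv_solve_right[THEN iffD2]) (auto simp: SD_simps)
  then show ?thesis by simp
qed

text \<open>The intersection with \<open>V\<close>, as a subgroup of \<open>V\<close>.\<close>

lemma SD_slice:
  assumes "subgroup K SD" shows "subgroup {v \<in> carrier V. (\<one>\<^bsub>H\<^esub>, v) \<in> K} V" (is "subgroup ?U V")
proof (rule subgroupI)
  show "?U \<subseteq> carrier V" by blast
  have "\<one> \<in> ?U" using subgroup.one_closed[OF assms] by (simp add: SD_simps)
  then show "?U \<noteq> {}" by blast
  fix a b assume ab: "a \<in> ?U" "b \<in> ?U"
  show "a \<otimes> b \<in> ?U"
    using subgroup.m_closed[OF assms, of "(\<one>\<^bsub>H\<^esub>, a)" "(\<one>\<^bsub>H\<^esub>, b)"] ab by (simp add: SD_simps act_id)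
  show "inv a \<in> ?U" using subgroup.m_inv_closed[OF assms, of "(\<one>\<^bsub>H\<^esub>, a)"] ab by (simp add: SD_inv_V)
qed

text \<open>The first component of an element of \<open>p\<close>-power order has \<open>p\<close>-power order in the \<open>p'\<close>-group \<open>H\<close>, so it is
  trivial.\<close>

lemma p_subgroup_in_V:
  assumes A: "subgroup A SD" "card A = p ^ d"
  obtains A' where "subgroup A' V" "card A' = p ^ d" "A = {\<one>\<^bsub>H\<^esub>} \<times> A'"
proof -
  have fst1: "h = \<one>\<^bsub>H\<^esub>" if "(h, v) \<in> A" for h v
  proof -
    have hv: "h \<in> carrier H" "v \<in> carrier V" using subgroup.mem_carrier[OF A(1) that] by (auto simp: SD_simps)
    interpret A: group "SD\<lparr>carrier := A\<rparr>" by (rule SD.subgroup_imp_group[OF A(1)])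
    have "(h, v) [^]\<^bsub>SD\<lparr>carrier := A\<rparr>\<^esub> order (SD\<lparr>carrier := A\<rparr>) = \<one>\<^bsub>SD\<^esub>"
      using A.pow_order_eq_1[of "(h, v)"] that by simp
    then have "(h, v) [^]\<^bsub>SD\<^esub> (p ^ d) = \<one>\<^bsub>SD\<^esub>"
      using A(2) by (simp add: order_def nat_pow_def)
    moreover have "fst ((h, v) [^]\<^bsub>SD\<^esub> j) = h [^]\<^bsub>H\<^esub> j \<and> (h, v) [^]\<^bsub>SD\<^esub> j \<in> carrier SD" for j :: nat
    proof (induction j)
      case (Suc j)
      then obtain k w where kw: "(h, v) [^]\<^bsub>SD\<^esub> j = (k, w)" "k = h [^]\<^bsub>H\<^esub> j" "k \<in> carrier H" "w \<in> carrier V"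
        by (cases "(h, v) [^]\<^bsub>SD\<^esub> j") (auto simp: SD_simps)
      then show ?case using hv by (simp add: SD_simps act_closed)
    qed (simp add: SD_simps)
    ultimately have "h [^]\<^bsub>H\<^esub> (p ^ d) = \<one>\<^bsub>H\<^esub>" by (metis SD_simps(2) fst_conv)
    then have "H.ord h dvd p ^ d" using H.pow_eq_id hv(1) by blast
    moreover have "H.ord h dvd order H" using H.ord_dvd_group_order[OF hv(1)] .
    moreover have "coprime (order H) (p ^ d)" using coprime_H by simp
    ultimately have "H.ord h = 1" by (metis coprime_common_divisor_nat)
    then show ?thesis using H.ord_eq_1 hv(1) by blast
  qed
  define A' where "A' = {v \<in> carrier V. (\<one>\<^bsub>H\<^esub>, v) \<in> A}"
  have AA': "A = {\<one>\<^bsub>H\<^esub>} \<times> A'"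
    using fst1 subgroup.subset[OF A(1)] by (force simp: A'_def SD_simps)
  have "subgroup A' V" unfolding A'_def by (rule SD_slice[OF A(1)])
  moreover have "card A' = p ^ d" using A(2) AA' by (simp add: card_cartesian_product)
  ultimately show ?thesis using that AA' by blast
qed

text \<open>From a complement \<open>K\<close> one obtains \<open>U = K \<inter> V\<close>. It is invariant because every \<open>h \<in> H\<close> is the first
  component of some element \<open>(h, w)\<close> of \<open>K\<close>, and conjugation by \<open>(h, w)\<close> acts on the abelian group \<open>V\<close>
  like \<open>h\<close>. Conversely \<open>H \<times> U\<close> is a complement.\<close>

lemma complemented_iff:
  assumes A: "subgroup A V"
  shows "complemented SD ({\<one>\<^bsub>H\<^esub>} \<times> A) \<longleftrightarrow> (\<exists>U. invariant U \<and> A \<inter> U = {\<one>} \<and> A <#> U = carrier V)"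
proof
  assume "\<exists>U. invariant U \<and> A \<inter> U = {\<one>} \<and> A <#> U = carrier V"
  then obtain U where U: "invariant U" "A \<inter> U = {\<one>}" "A <#> U = carrier V" by blast
  define K where "K = carrier H \<times> U"
  have "subgroup K SD" unfolding K_def by (rule SD_subgroup_times[OF H.subgroup_self U(1)])
  moreover have "carrier SD = ({\<one>\<^bsub>H\<^esub>} \<times> A) <#>\<^bsub>SD\<^esub> K"
  proof
    show "({\<one>\<^bsub>H\<^esub>} \<times> A) <#>\<^bsub>SD\<^esub> K \<subseteq> carrier SD"
      using sub_mem[OF A] invariant_mem[OF U(1)] by (auto simp: set_mult_def SD_simps K_def act_id)
    show "carrier SD \<subseteq> ({\<one>\<^bsub>H\<^esub>} \<times> A) <#>\<^bsub>SD\<^esub> K"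
    proof
      fix x assume "x \<in> carrier SD"
      then obtain h v where hv: "x = (h, v)" "h \<in> carrier H" "v \<in> carrier V" by (auto simp: SD_simps)
      then have "v \<in> A <#> U" using U(3) by simp
      then obtain a u where au: "a \<in> A" "u \<in> U" "v = a \<otimes> u" by (auto simp: set_mult_iff)
      have "x = (\<one>\<^bsub>H\<^esub>, a) \<otimes>\<^bsub>SD\<^esub> (h, u)" using hv au invariant_mem[OF U(1)] by (simp add: SD_simps act_id)
      then show "x \<in> ({\<one>\<^bsub>H\<^esub>} \<times> A) <#>\<^bsub>SD\<^esub> K"
        unfolding set_mult_def K_def using au hv(2) by blast
    qed
  qed
  moreover have "({\<one>\<^bsub>H\<^esub>} \<times> A) \<inter> K = {\<one>\<^bsub>SD\<^esub>}"
    using U(2) by (auto simp: K_def SD_simps)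
  ultimately show "complemented SD ({\<one>\<^bsub>H\<^esub>} \<times> A)" unfolding complemented_def by blast
next
  assume "complemented SD ({\<one>\<^bsub>H\<^esub>} \<times> A)"
  then obtain K where K: "subgroup K SD" "carrier SD = ({\<one>\<^bsub>H\<^esub>} \<times> A) <#>\<^bsub>SD\<^esub> K"
    "({\<one>\<^bsub>H\<^esub>} \<times> A) \<inter> K = {\<one>\<^bsub>SD\<^esub>}" unfolding complemented_def by blast
  have factor: "\<exists>a\<in>A. \<exists>w. (h, w) \<in> K \<and> w \<in> carrier V \<and> v = a \<otimes> w" if "h \<in> carrier H" "v \<in> carrier V" for h v
  proof -
    have "(h, v) \<in> ({\<one>\<^bsub>H\<^esub>} \<times> A) <#>\<^bsub>SD\<^esub> K" using that K(2) by (auto simp: SD_simps)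
    then obtain a k w where akw: "a \<in> A" "(k, w) \<in> K" "(h, v) = (\<one>\<^bsub>H\<^esub>, a) \<otimes>\<^bsub>SD\<^esub> (k, w)"
      unfolding set_mult_def by auto
    have kw: "k \<in> carrier H" "w \<in> carrier V" using subgroup.mem_carrier[OF K(1) akw(2)] by (auto simp: SD_simps)
    with akw show ?thesis by (auto simp: SD_simps act_id)
  qed
  define U where "U = {v \<in> carrier V. (\<one>\<^bsub>H\<^esub>, v) \<in> K}"
  have sU: "subgroup U V" unfolding U_def by (rule SD_slice[OF K(1)])
  have "act h u \<in> U" if h: "h \<in> carrier H" and u: "u \<in> U" for h u
  proof -
    obtain w where w: "(h, w) \<in> K" "w \<in> carrier V" using factor[OF h one_closed] by blast
    have uV: "u \<in> carrier V" "(\<one>\<^bsub>H\<^esub>, u) \<in> K" using u by (auto simp: U_def)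
    have "(\<one>\<^bsub>H\<^esub>, act h u) = (h, w) \<otimes>\<^bsub>SD\<^esub> (\<one>\<^bsub>H\<^esub>, u) \<otimes>\<^bsub>SD\<^esub> inv\<^bsub>SD\<^esub> (h, w)"
      using SD_conj_V[OF h w(2) uV(1)] by simp
    also have "\<dots> \<in> K" using K(1) w(1) uV(2) by (intro subgroup.m_closed subgroup.m_inv_closed)
    finally show ?thesis using h uV act_closed by (simp add: U_def)
  qed
  then have "invariant U" using sU by (simp add: invariant_def)
  moreover have "A \<inter> U = {\<one>}"
  proof (rule disjointI[OF A sU])
    fix x assume "x \<in> A" "x \<in> U"
    then have "(\<one>\<^bsub>H\<^esub>, x) \<in> ({\<one>\<^bsub>H\<^esub>} \<times> A) \<inter> K" by (auto simp: U_def)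
    then show "x = \<one>" using K(3) by (auto simp: SD_simps)
  qed
  moreover have "A <#> U = carrier V"
  proof
    show "A <#> U \<subseteq> carrier V" using subgroup.subset[OF mult_subgroups[OF A sU]] .
    show "carrier V \<subseteq> A <#> U"
    proof
      fix v assume "v \<in> carrier V"
      then obtain a w where "a \<in> A" "(\<one>\<^bsub>H\<^esub>, w) \<in> K" "w \<in> carrier V" "v = a \<otimes> w" using factor[of "\<one>\<^bsub>H\<^esub>" v] by auto
      then show "v \<in> A <#> U" by (auto simp: set_mult_iff U_def)
    qed
  qed
  ultimately show "\<exists>U. invariant U \<and> A \<inter> U = {\<one>} \<and> A <#> U = carrier V" by blast
qed

lemma nontrivial_C_group_iff:
  assumes "d < n"
  shows "nontrivial_C_group p d SD \<longleftrightarrow> complementing d"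
proof -
  have "C_group (p ^ d) SD \<longleftrightarrow> complementing d"
  proof
    assume C: "C_group (p ^ d) SD"
    show "complementing d"
      unfolding complementing_def
    proof (intro allI impI)
      fix A assume A: "subgroup A V \<and> card A = p ^ d"
      then have "complemented SD ({\<one>\<^bsub>H\<^esub>} \<times> A)"
        using C SD_subgroup_V[of A] by (auto simp: C_group_def card_cartesian_product)
      then show "\<exists>U. invariant U \<and> A \<inter> U = {\<one>} \<and> A <#> U = carrier V" using complemented_iff A by blast
    qed
  next
    assume C: "complementing d"
    show "C_group (p ^ d) SD"
      unfolding C_group_def
    proof (intro allI impI)
      fix A assume "subgroup A SD \<and> card A = p ^ d"
      then obtain A' where "subgroup A' V" "card A' = p ^ d" "A = {\<one>\<^bsub>H\<^esub>} \<times> A'"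
        using p_subgroup_in_V by blast
      with C show "complemented SD A" using complemented_iff unfolding complementing_def by blast
    qed
  qed
  moreover have "p ^ d \<le> p ^ multiplicity p (order SD)"
  proof (rule power_increasing)
    have "order SD \<noteq> 0" using SD_order H.order_gt_0_iff_finite finite_H p_gt_1 by simp
    then have "n \<le> multiplicity p (order SD)"
      using prime_p by (intro multiplicity_geI) (auto simp: SD_order)
    then show "d \<le> multiplicity p (order SD)" using assms by simp
  qed (use p_gt_1 in simp)
  ultimately show ?thesis by (simp add: nontrivial_C_group_def)
qed

section \<open>Supersolvability of the semidirect product\<close>

lemma card_cyclic_subgroup:
  assumes "subgroup W V" "W \<noteq> {\<one>}" "cyclic_group (V\<lparr>carrier := W\<rparr>)"
  shows "card W = p"
proof -
  interpret W: group "V\<lparr>carrier := W\<rparr>" using assms(1) by (rule subgroup_imp_group)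
  obtain x where x: "x \<in> W" "W = range (\<lambda>i::int. x [^]\<^bsub>V\<lparr>carrier := W\<rparr>\<^esub> i)"
    using assms(3) W.cyclic_group by auto
  have xV: "x \<in> carrier V" using sub_mem[OF assms(1) x(1)] .
  have W: "W = generate V {x}"
    by (subst x(2)) (auto simp: generate_pow[OF xV] int_pow_consistent[OF assms(1) x(1), symmetric])
  have "x \<noteq> \<one>"
  proof
    assume "x = \<one>"
    then have "W = {\<one>}" using W generate_one by simp
    with assms(2) show False by blast
  qed
  with cyclic_subgroup(3)[OF xV] W show ?thesis by simp
qed

text \<open>Let \<open>B\<close> be the first term of the series that meets \<open>W\<close> nontrivially. As \<open>B\<close> is normal, it contains
  \<open>W\<close>; so \<open>W\<close> embeds into a cyclic factor of the series, and it has exponent \<open>p\<close>.\<close>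

lemma supersolvable_imp_lines:
  assumes "supersolvable SD" and W: "irred W"
  shows "card W = p"
proof -
  obtain k :: nat and N where N: "N 0 = {\<one>\<^bsub>SD\<^esub>}" "N k = carrier SD" "\<forall>i\<le>k. N i \<lhd> SD"
    "\<forall>i<k. N i \<subseteq> N (Suc i) \<and> cyclic_group (SD\<lparr>carrier := N (Suc i)\<rparr> Mod N i)"
    using assms(1) unfolding supersolvable_def by blast
  note iW = irredD(1)[OF W]
  note sW = invariant_subgroup[OF iW]
  define W' where "W' = {\<one>\<^bsub>H\<^esub>} \<times> W"
  have W': "subgroup W' SD" unfolding W'_def by (rule SD_subgroup_V[OF sW])
  define P where "P i \<longleftrightarrow> N i \<inter> W' \<noteq> {\<one>\<^bsub>SD\<^esub>}" for i
  have "N k \<inter> W' = W'" using N(2) subgroup.subset[OF W'] by blast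
  moreover have "W' \<noteq> {\<one>\<^bsub>SD\<^esub>}" using irredD(2)[OF W] by (auto simp: W'_def SD_simps)
  ultimately have "P k" by (simp add: P_def)
  define i where "i = (LEAST i. P i)"
  have "P i" unfolding i_def using \<open>P k\<close> by (rule LeastI[of P])
  have "i \<le> k" unfolding i_def using \<open>P k\<close> by (rule Least_le)
  have "\<not> P 0" using N(1) subgroup.one_closed[OF W'] by (auto simp: P_def)
  then obtain j where j: "i = Suc j" using \<open>P i\<close> by (cases i) auto
  have "\<not> P j" using not_less_Least[of j P] j i_def by simp
  then have disj: "N j \<inter> W' = {\<one>\<^bsub>SD\<^esub>}" by (simp add: P_def)
  have "j < k" using \<open>i \<le> k\<close> j by simp
  define B where "B = N (Suc j)"
  have nB: "B \<lhd> SD" and nN: "N j \<lhd> SD" using N(3) \<open>j < k\<close> by (auto simp: B_def)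
  have NB: "N j \<subseteq> B" and cyc: "cyclic_group (SD\<lparr>carrier := B\<rparr> Mod N j)"
    using N(4) \<open>j < k\<close> by (auto simp: B_def)
  have sB: "subgroup B SD" using nB by (rule normal_imp_subgroup)
  define S where "S = {v \<in> carrier V. (\<one>\<^bsub>H\<^esub>, v) \<in> B} \<inter> W"
  have "invariant {v \<in> carrier V. (\<one>\<^bsub>H\<^esub>, v) \<in> B}"
    unfolding invariant_def
  proof (intro conjI ballI SD_slice[OF sB])
    fix h u assume h: "h \<in> carrier H" and u: "u \<in> {v \<in> carrier V. (\<one>\<^bsub>H\<^esub>, v) \<in> B}"
    have "(h, \<one>) \<in> carrier SD" using h by (simp add: SD_simps)
    then have "(h, \<one>) \<otimes>\<^bsub>SD\<^esub> (\<one>\<^bsub>H\<^esub>, u) \<otimes>\<^bsub>SD\<^esub> inv\<^bsub>SD\<^esub> (h, \<one>) \<in> B" using nB u SD.normal_inv_iff by blast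
    then show "act h u \<in> {v \<in> carrier V. (\<one>\<^bsub>H\<^esub>, v) \<in> B}"
      using h u act_closed by (simp add: SD_conj_V)
  qed
  then have "invariant S" unfolding S_def using iW by (rule invariant_inter)
  moreover have "S \<noteq> {\<one>}"
  proof
    assume S1: "S = {\<one>}"
    have "B \<inter> W' = {\<one>\<^bsub>SD\<^esub>}"
    proof
      show "B \<inter> W' \<subseteq> {\<one>\<^bsub>SD\<^esub>}"
      proof
        fix x assume "x \<in> B \<inter> W'"
        then obtain v where v: "x = (\<one>\<^bsub>H\<^esub>, v)" "v \<in> S" using sub_mem[OF sW] by (auto simp: W'_def S_def)
        with S1 show "x \<in> {\<one>\<^bsub>SD\<^esub>}" by (simp add: SD_simps)
      qed
    qed (use subgroup.one_closed[OF sB] subgroup.one_closed[OF W'] in simp)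
    with \<open>P i\<close> j show False by (simp add: P_def B_def)
  qed
  ultimately have "S = W" by (intro irredD(3)[OF W]) (auto simp: S_def)
  then have WB: "(\<one>\<^bsub>H\<^esub>, v) \<in> B" if "v \<in> W" for v using that by (auto simp: S_def)
  interpret B: group "SD\<lparr>carrier := B\<rparr>" by (rule SD.subgroup_imp_group[OF sB])
  interpret NB: normal "N j" "SD\<lparr>carrier := B\<rparr>" by (rule SD.normal_restrict_supergroup[OF sB nN NB])
  interpret Q: group "SD\<lparr>carrier := B\<rparr> Mod N j" by (rule NB.factorgroup_is_group)
  define \<theta> where "\<theta> v = N j #>\<^bsub>SD\<lparr>carrier := B\<rparr>\<^esub> (\<one>\<^bsub>H\<^esub>, v)" for v
  have "(\<lambda>v. (\<one>\<^bsub>H\<^esub>, v)) \<in> hom (V\<lparr>carrier := W\<rparr>) (SD\<lparr>carrier := B\<rparr>)"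
    using WB sub_mem[OF sW] by (auto simp: hom_def SD_simps act_id)
  from Group.hom_compose[OF this NB.r_coset_hom_Mod]
  have hom: "\<theta> \<in> hom (V\<lparr>carrier := W\<rparr>) (SD\<lparr>carrier := B\<rparr> Mod N j)"
    by (simp add: \<theta>_def[abs_def] comp_def)
  have "inj_on \<theta> (carrier (V\<lparr>carrier := W\<rparr>))"
  proof (rule inj_onI)
    fix v w assume "v \<in> carrier (V\<lparr>carrier := W\<rparr>)" "w \<in> carrier (V\<lparr>carrier := W\<rparr>)" and eq: "\<theta> v = \<theta> w"
    then have vw: "v \<in> W" "w \<in> W" "v \<in> carrier V" "w \<in> carrier V" using sub_mem[OF sW] by auto
    have "(\<one>\<^bsub>H\<^esub>, v) \<in> N j #>\<^bsub>SD\<lparr>carrier := B\<rparr>\<^esub> (\<one>\<^bsub>H\<^esub>, w)"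
      using B.repr_independenceD[OF NB.is_subgroup, of "(\<one>\<^bsub>H\<^esub>, v)" "(\<one>\<^bsub>H\<^esub>, w)"] eq WB vw by (simp add: \<theta>_def)
    then obtain x where x: "x \<in> N j" "(\<one>\<^bsub>H\<^esub>, v) = x \<otimes>\<^bsub>SD\<^esub> (\<one>\<^bsub>H\<^esub>, w)" by (auto simp: r_coset_def)
    have xS: "x \<in> carrier SD" using x(1) NB subgroup.subset[OF sB] by blast
    have "x = (\<one>\<^bsub>H\<^esub>, v \<otimes> inv w)"
    proof (rule SD.r_cancel[of _ "(\<one>\<^bsub>H\<^esub>, w)"])
      show "x \<otimes>\<^bsub>SD\<^esub> (\<one>\<^bsub>H\<^esub>, w) = (\<one>\<^bsub>H\<^esub>, v \<otimes> inv w) \<otimes>\<^bsub>SD\<^esub> (\<one>\<^bsub>H\<^esub>, w)"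
        using x(2)[symmetric] vw by (simp add: SD_simps act_id m_assoc)
    qed (use xS vw in \<open>auto simp: SD_simps\<close>)
    moreover have "v \<otimes> inv w \<in> W" using vw sW by (intro subgroup.m_closed subgroup.m_inv_closed)
    ultimately have "x \<in> N j \<inter> W'" using x(1) by (simp add: W'_def)
    then have "x = \<one>\<^bsub>SD\<^esub>" using disj by blast
    then show "v = w" using x(2) vw by (simp add: SD_simps act_id)
  qed
  from cyclic_group_injective[OF subgroup_imp_group[OF sW] Q.is_group hom this cyc]
  show ?thesis by (rule card_cyclic_subgroup[OF sW irredD(2)[OF W]])
qed

lemma line_generate:
  assumes "irred W" "card W = p" "x \<in> W" "x \<noteq> \<one>"
  shows "W = generate V {x}"
proof (rule card_subset_eq[symmetric])
  note sW = invariant_subgroup[OF irredD(1)[OF assms(1)]]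
  show "finite W" by (rule sub_finite[OF sW])
  show "generate V {x} \<subseteq> W" using generate_subgroup_incl[of "{x}" W] assms(3) sW by simp
  show "card (generate V {x}) = card W"
    using cyclic_subgroup(3)[OF sub_mem[OF sW assms(3)] assms(4)] assms(2) by simp
qed

text \<open>On a submodule of order \<open>p\<close> all elements of \<open>H\<close> act as power maps, so their actions commute.\<close>

lemma lines_imp_abelian:
  assumes lines: "\<And>W. irred W \<Longrightarrow> card W = p"
    and faithful: "\<And>h. h \<in> carrier H \<Longrightarrow> (\<And>v. v \<in> carrier V \<Longrightarrow> act h v = v) \<Longrightarrow> h = \<one>\<^bsub>H\<^esub>"
    and hk: "h \<in> carrier H" "k \<in> carrier H"
  shows "h \<otimes>\<^bsub>H\<^esub> k = k \<otimes>\<^bsub>H\<^esub> h"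
proof -
  define S where "S = {v \<in> carrier V. act h (act k v) = act k (act h v)}"
  have S: "subgroup S V"
    by (rule subgroupI)
      (use hk in \<open>auto simp: S_def act_mult act_inv act_one act_closed intro!: exI[of _ \<one>]\<close>)
  have "W \<subseteq> S" if W: "irred W" for W
  proof -
    note iW = irredD(1)[OF W]
    obtain x where x: "x \<in> W" "x \<noteq> \<one>" by (rule irred_nonzero[OF W])
    have xV: "x \<in> carrier V" using invariant_mem[OF iW x(1)] .
    note gen = line_generate[OF W lines[OF W] x]
    have act_pow: "act l (y [^] j) = act l y [^] j" if "l \<in> carrier H" "y \<in> carrier V" for l y and j :: nat
      by (induction j) (use that in \<open>auto simp: act_one act_mult\<close>)
    have "\<exists>j::nat. y = x [^] j" if "y \<in> W" for y
      using that gen generate_pow_nat[OF xV] ord_ge_1[OF finite_V xV] by auto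
    then obtain a b :: nat where ab: "act h x = x [^] a" "act k x = x [^] b"
      using invariant_act[OF iW hk(1) x(1)] invariant_act[OF iW hk(2) x(1)] by blast
    have "x \<in> S" using xV by (simp add: S_def ab act_pow hk nat_pow_pow mult.commute)
    then show ?thesis using generate_subgroup_incl[of "{x}" S] S gen by simp
  qed
  then have "S = carrier V" by (rule irreds_span[OF S])
  then have comm: "act (h \<otimes>\<^bsub>H\<^esub> k) v = act (k \<otimes>\<^bsub>H\<^esub> h) v" if "v \<in> carrier V" for v
    using that hk by (auto simp: S_def act_comp)
  have "inv\<^bsub>H\<^esub> (k \<otimes>\<^bsub>H\<^esub> h) \<otimes>\<^bsub>H\<^esub> (h \<otimes>\<^bsub>H\<^esub> k) = \<one>\<^bsub>H\<^esub>"
  proof (rule faithful)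
    fix v assume v: "v \<in> carrier V"
    have "act (inv\<^bsub>H\<^esub> (k \<otimes>\<^bsub>H\<^esub> h) \<otimes>\<^bsub>H\<^esub> (h \<otimes>\<^bsub>H\<^esub> k)) v = act (inv\<^bsub>H\<^esub> (k \<otimes>\<^bsub>H\<^esub> h)) (act (k \<otimes>\<^bsub>H\<^esub> h) v)"
      using comm[OF v] v hk by (simp add: act_comp[of "inv\<^bsub>H\<^esub> (k \<otimes>\<^bsub>H\<^esub> h)"])
    also have "\<dots> = v" using v hk by (simp add: act_comp[symmetric] act_id)
    finally show "act (inv\<^bsub>H\<^esub> (k \<otimes>\<^bsub>H\<^esub> h) \<otimes>\<^bsub>H\<^esub> (h \<otimes>\<^bsub>H\<^esub> k)) v = v" .
  qed (use hk in simp)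
  then have "\<one>\<^bsub>H\<^esub> = inv\<^bsub>H\<^esub> (k \<otimes>\<^bsub>H\<^esub> h) \<otimes>\<^bsub>H\<^esub> (h \<otimes>\<^bsub>H\<^esub> k)" by (rule sym)
  then have "h \<otimes>\<^bsub>H\<^esub> k = k \<otimes>\<^bsub>H\<^esub> h \<otimes>\<^bsub>H\<^esub> \<one>\<^bsub>H\<^esub>" using hk by (subst (asm) H.inv_solve_left) auto
  then show ?thesis using hk by simp
qed

lemma SD_cyclic_factor:
  assumes N: "N \<lhd> SD" and N': "subgroup N' SD" "N \<subseteq> N'" and g: "g \<in> N'"
    and "\<And>x. x \<in> N' \<Longrightarrow> \<exists>a\<in>N. \<exists>i::int. x = a \<otimes>\<^bsub>SD\<^esub> g [^]\<^bsub>SD\<^esub> i"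
  shows "cyclic_group (SD\<lparr>carrier := N'\<rparr> Mod N)"
proof (rule cyclic_factor_group[of _ _ g])
  show "N \<lhd> SD\<lparr>carrier := N'\<rparr>" by (rule SD.normal_restrict_supergroup[OF N'(1) N N'(2)])
  show "\<exists>a\<in>N. \<exists>i::int. x = a \<otimes>\<^bsub>SD\<lparr>carrier := N'\<rparr>\<^esub> g [^]\<^bsub>SD\<lparr>carrier := N'\<rparr>\<^esub> i"
    if "x \<in> carrier (SD\<lparr>carrier := N'\<rparr>)" for x
    using assms(5)[of x] that SD.int_pow_consistent[OF N'(1) g] by simp
qed (use g in simp)

text \<open>The series first climbs through submodules of \<open>V\<close>, adding one submodule of order \<open>p\<close> at a time,
  and then through the groups \<open>L \<times> V\<close>, adding one element to \<open>L \<le> H\<close> at a time; these are normal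
  since \<open>H\<close> is abelian.\<close>

lemma lines_imp_supersolvable:
  assumes lines: "\<And>W. irred W \<Longrightarrow> card W = p"
    and faithful: "\<And>h. h \<in> carrier H \<Longrightarrow> (\<And>v. v \<in> carrier V \<Longrightarrow> act h v = v) \<Longrightarrow> h = \<one>\<^bsub>H\<^esub>"
  shows "supersolvable SD"
proof -
  have abelian: "h \<otimes>\<^bsub>H\<^esub> k = k \<otimes>\<^bsub>H\<^esub> h" if "h \<in> carrier H" "k \<in> carrier H" for h k
    by (rule lines_imp_abelian) (use lines faithful that in blast)+
  define P where "P N \<longleftrightarrow> (\<exists>U. invariant U \<and> N = {\<one>\<^bsub>H\<^esub>} \<times> U) \<or> (\<exists>L. subgroup L H \<and> N = L \<times> carrier V)" for N
  have triv: "subgroup {\<one>\<^bsub>H\<^esub>} H" by (rule H.triv_subgroup)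
  have normal: "N \<lhd> SD" if "P N" for N
    using that unfolding P_def
  proof (elim disjE exE conjE)
    fix U assume U: "invariant U" "N = {\<one>\<^bsub>H\<^esub>} \<times> U"
    show ?thesis
      unfolding U(2) by (rule SD_normal_times[OF triv U(1)])
        (auto simp: act_id subgroup.one_closed[OF invariant_subgroup[OF U(1)]])
  next
    fix L assume L: "subgroup L H" "N = L \<times> carrier V"
    show ?thesis
      unfolding L(2)
    proof (rule SD_normal_times[OF L(1) invariant_carrier], intro conjI)
      fix h l v assume hlv: "h \<in> carrier H" "v \<in> carrier V" "l \<in> L"
      have lH: "l \<in> carrier H" using subgroup.mem_carrier[OF L(1) hlv(3)] .
      have "h \<otimes>\<^bsub>H\<^esub> l \<otimes>\<^bsub>H\<^esub> inv\<^bsub>H\<^esub> h = l"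
        using hlv(1) lH abelian[OF hlv(1) lH] by (simp add: H.m_assoc)
      then show "h \<otimes>\<^bsub>H\<^esub> l \<otimes>\<^bsub>H\<^esub> inv\<^bsub>H\<^esub> h \<in> L" "v \<otimes> inv (act (h \<otimes>\<^bsub>H\<^esub> l \<otimes>\<^bsub>H\<^esub> inv\<^bsub>H\<^esub> h) v) \<in> carrier V"
        using hlv lH by (simp_all add: act_closed)
    qed
  qed
  have Vstep: "\<exists>N'. P N' \<and> N \<subset> N' \<and> cyclic_group (SD\<lparr>carrier := N'\<rparr> Mod N)"
    if U: "invariant U" "N = {\<one>\<^bsub>H\<^esub>} \<times> U" "U \<noteq> carrier V" for N U
  proof -
    note sU = invariant_subgroup[OF U(1)]
    obtain W where W: "irred W" "U \<inter> W = {\<one>}"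
      using ex_irred_outside[OF U(1) invariant_carrier _ U(3)] invariant_mem[OF U(1)] by blast
    note iW = irredD(1)[OF W(1)]
    note sW = invariant_subgroup[OF iW]
    obtain x where x: "x \<in> W" "x \<noteq> \<one>" by (rule irred_nonzero[OF W(1)])
    have xV: "x \<in> carrier V" using invariant_mem[OF iW x(1)] .
    note gen = line_generate[OF W(1) lines[OF W(1)] x]
    define N' where "N' = {\<one>\<^bsub>H\<^esub>} \<times> (U <#> W)"
    have iUW: "invariant (U <#> W)" by (rule invariant_set_mult[OF U(1) iW])
    have "P N'" using iUW by (auto simp: P_def N'_def)
    moreover have "N \<subset> N'"
    proof
      show "N \<subseteq> N'" using set_mult_upper(1)[OF sU sW] by (auto simp: U(2) N'_def)
      have "(\<one>\<^bsub>H\<^esub>, x) \<in> N'" using set_mult_upper(2)[OF sU sW] x(1) by (auto simp: N'_def)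
      moreover have "(\<one>\<^bsub>H\<^esub>, x) \<notin> N" using W(2) x by (auto simp: U(2))
      ultimately show "N \<noteq> N'" by blast
    qed
    moreover have "cyclic_group (SD\<lparr>carrier := N'\<rparr> Mod N)"
    proof (rule SD_cyclic_factor[of _ _ "(\<one>\<^bsub>H\<^esub>, x)"])
      show "N \<lhd> SD" by (rule normal) (use U(1,2) in \<open>auto simp: P_def\<close>)
      show "subgroup N' SD" unfolding N'_def by (rule SD_subgroup_V[OF invariant_subgroup[OF iUW]])
      show "N \<subseteq> N'" using \<open>N \<subset> N'\<close> by blast
      show "(\<one>\<^bsub>H\<^esub>, x) \<in> N'" using set_mult_upper(2)[OF sU sW] x(1) by (auto simp: N'_def)
      fix y assume "y \<in> N'"
      then obtain u w where uw: "u \<in> U" "w \<in> W" "y = (\<one>\<^bsub>H\<^esub>, u \<otimes> w)" by (auto simp: N'_def set_mult_iff)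
      then obtain i :: int where i: "w = x [^] i" using gen generate_pow[OF xV] by auto
      have hom: "(\<lambda>v. (\<one>\<^bsub>H\<^esub>, v)) \<in> hom V SD" by (auto simp: hom_def SD_simps act_id)
      have "(\<one>\<^bsub>H\<^esub>, x) [^]\<^bsub>SD\<^esub> i = (\<one>\<^bsub>H\<^esub>, x [^] i)"
        using hom_int_pow[OF hom xV is_group SD.is_group, of i] by simp
      then have "y = (\<one>\<^bsub>H\<^esub>, u) \<otimes>\<^bsub>SD\<^esub> (\<one>\<^bsub>H\<^esub>, x) [^]\<^bsub>SD\<^esub> i"
        using uw i sub_mem[OF sU] xV by (simp add: SD_simps act_id)
      with uw(1) show "\<exists>a\<in>N. \<exists>i::int. y = a \<otimes>\<^bsub>SD\<^esub> (\<one>\<^bsub>H\<^esub>, x) [^]\<^bsub>SD\<^esub> i" unfolding U(2) by blast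
    qed
    ultimately show ?thesis by blast
  qed
  have Hstep: "\<exists>N'. P N' \<and> N \<subset> N' \<and> cyclic_group (SD\<lparr>carrier := N'\<rparr> Mod N)"
    if L: "subgroup L H" "N = L \<times> carrier V" "N \<noteq> carrier SD" for N L
  proof -
    have "L \<noteq> carrier H" using L(2,3) by (auto simp: SD_simps)
    then obtain x where x: "x \<in> carrier H" "x \<notin> L" using subgroup.subset[OF L(1)] by blast
    interpret CH: comm_group H
      by (rule group.group_comm_groupI[OF H.is_group]) (rule abelian)
    define E where "E = generate H {x}"
    have sE: "subgroup E H" unfolding E_def using H.generate_is_subgroup x(1) by simp
    have xE: "x \<in> E" by (simp add: E_def generate.incl)
    define N' where "N' = (L <#>\<^bsub>H\<^esub> E) \<times> carrier V"
    have sLE: "subgroup (L <#>\<^bsub>H\<^esub> E) H" by (rule CH.mult_subgroups[OF L(1) sE])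
    have "P N'" using sLE by (auto simp: P_def N'_def)
    have LE: "L \<subseteq> L <#>\<^bsub>H\<^esub> E"
    proof
      fix l assume "l \<in> L"
      then have "l = l \<otimes>\<^bsub>H\<^esub> \<one>\<^bsub>H\<^esub>" using subgroup.mem_carrier[OF L(1)] by simp
      with \<open>l \<in> L\<close> show "l \<in> L <#>\<^bsub>H\<^esub> E" unfolding set_mult_def using subgroup.one_closed[OF sE] by blast
    qed
    have xLE: "x \<in> L <#>\<^bsub>H\<^esub> E"
    proof -
      have "x = \<one>\<^bsub>H\<^esub> \<otimes>\<^bsub>H\<^esub> x" using x(1) by simp
      then show ?thesis unfolding set_mult_def using subgroup.one_closed[OF L(1)] xE by blast
    qed
    have sub: "N \<subset> N'"
    proof
      show "N \<subseteq> N'" using LE by (auto simp: L(2) N'_def)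
      have "(x, \<one>) \<in> N'" "(x, \<one>) \<notin> N" using xLE x(2) by (auto simp: N'_def L(2))
      then show "N \<noteq> N'" by blast
    qed
    moreover have "cyclic_group (SD\<lparr>carrier := N'\<rparr> Mod N)"
    proof (rule SD_cyclic_factor[of _ _ "(x, \<one>)"])
      show "N \<lhd> SD" by (rule normal) (use L(1,2) in \<open>auto simp: P_def\<close>)
      show "subgroup N' SD" unfolding N'_def by (rule SD_subgroup_times[OF sLE invariant_carrier])
      show "N \<subseteq> N'" using sub by blast
      show "(x, \<one>) \<in> N'" using xLE by (auto simp: N'_def)
      fix y assume "y \<in> N'"
      then obtain l e v where y: "l \<in> L" "e \<in> E" "v \<in> carrier V" "y = (l \<otimes>\<^bsub>H\<^esub> e, v)"
        by (auto simp: N'_def set_mult_def)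
      then obtain i :: int where i: "e = x [^]\<^bsub>H\<^esub> i" using H.generate_pow[OF x(1)] by (auto simp: E_def)
      have hom: "(\<lambda>h. (h, \<one>)) \<in> hom H SD" by (auto simp: hom_def SD_simps act_one)
      have "(x, \<one>) [^]\<^bsub>SD\<^esub> i = (x [^]\<^bsub>H\<^esub> i, \<one>)"
        using hom_int_pow[OF hom x(1) H.is_group SD.is_group, of i] by simp
      then have "y = (l, v) \<otimes>\<^bsub>SD\<^esub> (x, \<one>) [^]\<^bsub>SD\<^esub> i"
        using y i subgroup.mem_carrier[OF L(1)] by (simp add: SD_simps act_one)
      with y(1,3) show "\<exists>a\<in>N. \<exists>i::int. y = a \<otimes>\<^bsub>SD\<^esub> (x, \<one>) [^]\<^bsub>SD\<^esub> i" unfolding L(2) by blast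
    qed
    ultimately show ?thesis using \<open>P N'\<close> by blast
  qed
  show ?thesis
  proof (rule supersolvableI[of _ P])
    show "finite (carrier SD)" using finite_H finite_V by (simp add: SD_simps)
    show "P {\<one>\<^bsub>SD\<^esub>}" using invariant_triv by (auto simp: P_def SD_simps)
    show "N \<lhd> SD" if "P N" for N using normal that .
    show "\<exists>N'. P N' \<and> N \<subset> N' \<and> cyclic_group (SD\<lparr>carrier := N'\<rparr> Mod N)" if N: "P N" "N \<noteq> carrier SD" for N
      using N(1) unfolding P_def[of N]
    proof (elim disjE exE conjE)
      fix U assume U: "invariant U" "N = {\<one>\<^bsub>H\<^esub>} \<times> U"
      show ?thesis
      proof (cases "U = carrier V")
        case True
        then show ?thesis using Hstep[OF triv _ N(2)] U(2) by simp
      qed (rule Vstep[OF U])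
    qed (rule Hstep[OF _ _ N(2)])
  qed
qed

section \<open>The classification\<close>

theorem classification:
  assumes faithful: "\<And>h. h \<in> carrier H \<Longrightarrow> (\<And>v. v \<in> carrier V \<Longrightarrow> act h v = v) \<Longrightarrow> h = \<one>\<^bsub>H\<^esub>"
    and d: "0 < d" "d < n"
  shows "nontrivial_C_group p d SD \<longleftrightarrow> supersolvable SD \<or>
     (cyclic_group H \<and> homogeneous_KH_module (residue_ring (int p)) H act (Fp_space V) \<and>
      (\<exists>e>1. (\<forall>W. irreducible_KH_submodule (residue_ring (int p)) H act (Fp_space V) W \<longrightarrow>
          vectorspace.dim (residue_ring (int p)) (Fp_space V\<lparr>carrier := W\<rparr>) = e) \<and> e dvd gcd d n))"
    (is "_ \<longleftrightarrow> _ \<or> cyclic_group H \<and> ?homogeneous \<and> (\<exists>e>1. ?dims e \<and> e dvd gcd d n)")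
proof -
  have pow_eq: "p ^ i = p ^ j \<longleftrightarrow> i = j" for i j using p_gt_1 by simp
  have dims: "?dims e \<longleftrightarrow> (\<forall>W. irred W \<longrightarrow> card W = p ^ e)" for e
    unfolding irreducible_iff using card_eq_p_power_dim[OF invariant_subgroup[OF irredD(1)]] pow_eq by metis
  have homog: "?homogeneous \<longleftrightarrow> (\<exists>(m::nat) W. (\<forall>i<m. irred (W i)) \<and> (\<forall>i<m. \<forall>j<m. isom (W i) (W j)) \<and>
      bij_betw (\<lambda>x. finprod V x {..<m}) (\<Pi>\<^sub>E i\<in>{..<m}. W i) (carrier V))"
    unfolding homogeneous_KH_module_def irreducible_iff internal_direct_sum_iff
    using KH_isomorphic_iff[OF invariant_subgroup[OF irredD(1)] invariant_subgroup[OF irredD(1)]] by metis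
  show ?thesis
    unfolding nontrivial_C_group_iff[OF d(2)] dims homog
  proof
    assume compl: "complementing d"
    show "supersolvable SD \<or> cyclic_group H \<and>
      (\<exists>(m::nat) W. (\<forall>i<m. irred (W i)) \<and> (\<forall>i<m. \<forall>j<m. isom (W i) (W j)) \<and>
        bij_betw (\<lambda>x. finprod V x {..<m}) (\<Pi>\<^sub>E i\<in>{..<m}. W i) (carrier V)) \<and>
      (\<exists>e>1. (\<forall>W. irred W \<longrightarrow> card W = p ^ e) \<and> e dvd gcd d n)"
    proof (cases "\<forall>W. irred W \<longrightarrow> card W = p")
      case True
      then show ?thesis using lines_imp_supersolvable faithful by blast
    next
      case False
      then obtain W where W: "irred W" "card W \<noteq> p" by blast
      note iW = irredD(1)[OF W(1)]
      obtain e where e: "card W = p ^ e" using subgroup_card[OF invariant_subgroup[OF iW]] by blast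
      have "e \<noteq> 0"
      proof
        assume "e = 0"
        then have "W = {\<one>}" using e card_one_iff[OF invariant_subgroup[OF iW]] by simp
        then show False using irredD(2)[OF W(1)] by blast
      qed
      moreover have "e \<noteq> 1" using W(2) e by auto
      ultimately have e1: "1 < e" by simp
      note iso = complementing_imp_isotypic[OF compl d W(1) e e1]
      obtain w where w: "w \<in> W" "w \<noteq> \<one>"
        by (rule irred_nonzero[OF W(1)])
      have e0: "0 < e" using e1 by simp
      have "(\<lambda>f. f w) ` Hom W W = W" by (rule endo_transitive[OF compl d W(1) e e0 iso(2-4) w])
      from cyclic_of_transitive[OF iso(1) w this faithful] have "cyclic_group H" by blast
      moreover obtain m :: nat and W' where W': "\<forall>i<m. irred (W' i)"
        "bij_betw (\<lambda>x. finprod V x {..<m}) (\<Pi>\<^sub>E i\<in>{..<m}. W' i) (carrier V)"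
        using ex_direct_decomposition[OF invariant_carrier] by blast
      moreover have "isom (W' i) (W' j)" if ij: "i < m" "j < m" for i j
        using isom_trans[OF isom_sym[OF iso(2)[of "W' i"] iW] iso(2)[of "W' j"]] W'(1) ij by blast
      moreover have "\<forall>U. irred U \<longrightarrow> card U = p ^ e" using isom_card[OF iso(2)] e by simp
      moreover have "e dvd gcd d n" using iso(3,4) by simp
      ultimately show ?thesis using e1 by blast
    qed
  next
    assume "supersolvable SD \<or> cyclic_group H \<and>
      (\<exists>(m::nat) W. (\<forall>i<m. irred (W i)) \<and> (\<forall>i<m. \<forall>j<m. isom (W i) (W j)) \<and>
        bij_betw (\<lambda>x. finprod V x {..<m}) (\<Pi>\<^sub>E i\<in>{..<m}. W i) (carrier V)) \<and>
      (\<exists>e>1. (\<forall>W. irred W \<longrightarrow> card W = p ^ e) \<and> e dvd gcd d n)"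
    then show "complementing d"
    proof (elim disjE conjE exE)
      assume "supersolvable SD"
      then show ?thesis using lines_imp_complementing supersolvable_imp_lines by blast
    next
      fix m :: nat and W and e
      assume cyc: "cyclic_group H" and W: "\<forall>i<m. irred (W i)" "\<forall>i<m. \<forall>j<m. isom (W i) (W j)"
        "bij_betw (\<lambda>x. finprod V x {..<m}) (\<Pi>\<^sub>E i\<in>{..<m}. W i) (carrier V)"
        and e: "e > 1" "\<forall>W. irred W \<longrightarrow> card W = p ^ e" "e dvd gcd d n"
      have "m \<noteq> 0"
      proof
        assume "m = 0"
        then have "carrier V = {\<one>}" using W(3) by (simp add: bij_betw_def)
        then have "p ^ n = 1" using order_V by (simp add: order_def)
        then show False using one_less_power[OF p_gt_1, of n] d by simp
      qed
      then have m: "0 < m" by simp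
      have iso: "isotypic (W 0)" by (rule isotypic_of_direct_decomposition[OF _ _ W(3) m]) (use W(1,2) in auto)
      interpret CH: comm_group H by (rule H.cyclic_imp_abelian_group[OF cyc])
      have "\<exists>U. irred U \<and> x \<in> U" if "x \<in> carrier V" "x \<noteq> \<one>" for x
        by (rule isotypic_abelian_irred_cover[OF iso _ _ that]) (use e(2) W(1) m CH.m_comm in auto)
      then show ?thesis
        by (rule irred_cover_imp_complementing[of e]) (use e d in auto)
    qed
  qed
qed

end

theorem theoremB:
  fixes p n d :: nat
    and H :: "('h, 'a) monoid_scheme"
    and V :: "('v, 'b) monoid_scheme"
    and \<phi> :: "'h \<Rightarrow> 'v \<Rightarrow> 'v"
  defines "G \<equiv> semidirect_product H V \<phi>"
    and "F \<equiv> residue_ring (int p)"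
    and "M \<equiv> Fp_space V"
  assumes "Factorial_Ring.prime p"
    and "group H" and "finite (carrier H)" and "coprime (order H) p"
    and "elementary_abelian_group p V" and "order V = p ^ n"
    and "\<phi> \<in> hom H (AutoGroup V)" and "inj_on \<phi> (carrier H)"
    and "0 < d" and "d < n"
  shows "nontrivial_C_group p d G \<longleftrightarrow>
     supersolvable G \<or>
     (cyclic_group H \<and> homogeneous_KH_module F H \<phi> M \<and>
      (\<exists>e>1. (\<forall>W. irreducible_KH_submodule F H \<phi> M W \<longrightarrow>
                   vectorspace.dim F (M\<lparr>carrier := W\<rparr>) = e) \<and>
             e dvd gcd d n))"
proof -
  interpret H: group H by fact
  interpret V: comm_group V using assms(8) by (simp add: elementary_abelian_group_def)
  have auto: "\<phi> h \<in> hom V V" "\<phi> h \<in> Bij (carrier V)" if "h \<in> carrier H" for h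
    using hom_in_carrier[OF assms(10) that] by (auto simp: AutoGroup_def auto_def)
  have mult: "\<phi> (h \<otimes>\<^bsub>H\<^esub> k) = compose (carrier V) (\<phi> h) (\<phi> k)" if "h \<in> carrier H" "k \<in> carrier H" for h k
    using hom_mult[OF assms(10) that] auto that by (simp add: AutoGroup_def BijGroup_def)
  have one: "\<phi> \<one>\<^bsub>H\<^esub> = (\<lambda>x\<in>carrier V. x)"
    using hom_one[OF assms(10) assms(5) V.AutoGroup] by (simp add: AutoGroup_def BijGroup_def)
  interpret coprime_action V p n H \<phi>
  proof unfold_locales
    show "v [^]\<^bsub>V\<^esub> p = \<one>\<^bsub>V\<^esub>" if "v \<in> carrier V" for v
      using assms(8) that by (simp add: elementary_abelian_group_def)
    show "\<phi> h v \<in> carrier V" if "h \<in> carrier H" "v \<in> carrier V" for h v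
      using hom_in_carrier[OF auto(1)] that by blast
    show "\<phi> h (v \<otimes>\<^bsub>V\<^esub> w) = \<phi> h v \<otimes>\<^bsub>V\<^esub> \<phi> h w" if "h \<in> carrier H" "v \<in> carrier V" "w \<in> carrier V" for h v w
      using hom_mult[OF auto(1)] that by blast
    show "\<phi> (h \<otimes>\<^bsub>H\<^esub> k) v = \<phi> h (\<phi> k v)" if "h \<in> carrier H" "k \<in> carrier H" "v \<in> carrier V" for h k v
      using mult that by (simp add: compose_eq)
    show "\<phi> \<one>\<^bsub>H\<^esub> v = v" if "v \<in> carrier V" for v using one that by simp
  qed (use assms in auto)
  have "h = \<one>\<^bsub>H\<^esub>" if h: "h \<in> carrier H" "\<And>v. v \<in> carrier V \<Longrightarrow> \<phi> h v = v" for h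
  proof -
    have "\<phi> h = \<phi> \<one>\<^bsub>H\<^esub>"
      unfolding one
      by (rule extensionalityI[of _ "carrier V"]) (use auto(2)[OF h(1)] h(2) in \<open>auto simp: Bij_def\<close>)
    then show ?thesis using inj_onD[OF assms(11)] h(1) by blast
  qed
  from classification[OF this assms(12,13)] show ?thesis unfolding G_def F_def M_def .
qed

end
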